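(* Let $G$ be a finite simple undirected graph with nonempty vertex set. Then the following are equivalent: (i) $G$ has complex sparsity order at most $2$, i.e., $\mathrm{ord}_{\mathbb{C}}(G)\le 2$; (ii) $G$ contains none of the cycles $C_n$, $n\ge 5$, and none of the graphs $D_1,\dots,D_6$ as an induced subgraph; (iii) $G$ is a clique-sum of graphs from the classes $\mathcal{K}_2$ and $\mathcal{K}_3$.
   Context: For a graph $G=(V,E)$ with $V=\{1,\dots,n\}$, let $\mathcal{H}_G$ be the real linear space of Hermitian $n\times n$ complex matrices whose $(i,j)$ entry is $0$ whenever $i\ne j$ and $i,j$ are non-adjacent in $G$, and let $\mathrm{PSD}_G$ be the convex cone of positive semidefinite matrices in $\mathcal{H}_G$. A nonzero $X\in\mathrm{PSD}_G$ is extremal if whenever $X=X'+X''$ with $X',X''\in\mathrm{PSD}_G$ both nonzero, then $X'$ and $X''$ are positive scalar multiples of $X$. The sparsity order $\mathrm{ord}_{\mathbb{C}}(G)$ is the maximum rank among all extremal elements of $\mathrm{PSD}_G$. $C_n$, $P_n$, $K_n$ denote the cycle, path and complete graph on $n$ vertices, $\overline{G}$ the complement of $G$, and $\sqcup$ disjoint union of graphs. The graphs $D_1,\dots,D_6$ are given by their complements: $\overline{D}_1=P_6$, $\overline{D}_2=C_6$, $\overline{D}_3=P_4\sqcup K_2$, $\overline{D}_4=K_3\sqcup K_2$, $\overline{D}_5=P_3\sqcup K_2\sqcup K_2$, $\overline{D}_6=K_2\sqcup K_2\sqcup K_2\sqcup K_2$. $\mathcal{K}_2$ is the class of graphs whose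 vertex set can be partitioned into (possibly empty) cliques $X_1,Y_1,X_2,Y_2,Z$ such that two vertices in different parts are non-adjacent if and only if, for some $j\in\{1,2\}$, one lies in $X_j$ and the other in $Y_j$. $\mathcal{K}_3$ is the class of graphs whose vertex set can be partitioned into six distinct single vertices $x_1,y_1,x_2,y_2,x_3,y_3$ and a (possibly empty) clique $Z$ such that the only non-adjacent pairs of distinct vertices are $\{x_j,y_j\}$, $j=1,2,3$. If graphs $G_1=(V_1,E_1)$ and $G_2=(V_2,E_2)$ each have a clique of the same cardinality (possibly $0$), a clique-sum of $G_1$ and $G_2$ is the graph $(V_1\cup V_2,E_1\cup E_2)$ obtained by identifying the vertices of these two cliques (no edges are removed). Clique-sums of more than two graphs are defined inductively; a single graph counts as a clique-sum of itself. *)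

theory Defs
  imports "HOL-Analysis.Analysis"
begin

section \<open>Finite simple graphs\<close>

type_synonym 'a ugraph = "'a set \<times> 'a set set"

abbreviation verts :: "'a ugraph \<Rightarrow> 'a set" where "verts G \<equiv> fst G"
abbreviation edges :: "'a ugraph \<Rightarrow> 'a set set" where "edges G \<equiv> snd G"

definition simple_graph :: "'a ugraph \<Rightarrow> bool" where
  "simple_graph G \<longleftrightarrow>
     finite (verts G) \<and> edges G \<subseteq> {{u, v} |u v. u \<in> verts G \<and> v \<in> verts G \<and> u \<noteq> v}"

definition complement :: "'a ugraph \<Rightarrow> 'a ugraph" where
  "complement G =
     (verts G, {{u, v} |u v. u \<in> verts G \<and> v \<in> verts G \<and> u \<noteq> v \<and> {u, v} \<notin> edges G})"

definition disjoint_union :: "'a ugraph \<Rightarrow> 'b ugraph \<Rightarrow> ('a + 'b) ugraph"  (infixr "\<squnion>\<^sub>g" 65) where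
  "G \<squnion>\<^sub>g H = (Inl ` verts G \<union> Inr ` verts H, (`) Inl ` edges G \<union> (`) Inr ` edges H)"

definition induced_subgraph :: "'a ugraph \<Rightarrow> 'a set \<Rightarrow> 'a ugraph" where
  "induced_subgraph G S = (S, {e \<in> edges G. e \<subseteq> S})"

definition graph_iso :: "'a ugraph \<Rightarrow> 'b ugraph \<Rightarrow> bool" where
  "graph_iso G H \<longleftrightarrow>
     (\<exists>f. bij_betw f (verts G) (verts H) \<and>
          (\<forall>u\<in>verts G. \<forall>v\<in>verts G. {u, v} \<in> edges G \<longleftrightarrow> {f u, f v} \<in> edges H))"

definition contains_induced :: "'a ugraph \<Rightarrow> 'b ugraph \<Rightarrow> bool" where
  "contains_induced G H \<longleftrightarrow> (\<exists>S\<subseteq>verts G. graph_iso H (induced_subgraph G S))"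

definition clique :: "'a ugraph \<Rightarrow> 'a set \<Rightarrow> bool" where
  "clique G K \<longleftrightarrow> K \<subseteq> verts G \<and> (\<forall>u\<in>K. \<forall>v\<in>K. u \<noteq> v \<longrightarrow> {u, v} \<in> edges G)"

definition path_graph :: "nat \<Rightarrow> nat ugraph" where
  "path_graph n = ({..<n}, {{i, Suc i} |i. Suc i < n})"

text \<open>Meant for \<open>n \<ge> 3\<close>.\<close>

definition cycle_graph :: "nat \<Rightarrow> nat ugraph" where
  "cycle_graph n = ({..<n}, {{i, Suc i mod n} |i. i < n})"

definition complete_graph :: "nat \<Rightarrow> nat ugraph" where
  "complete_graph n = ({..<n}, {{i, j} |i j. i < n \<and> j < n \<and> i \<noteq> j})"

definition "D1 = complement (path_graph 6)"
definition "D2 = complement (cycle_graph 6)"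
definition "D3 = complement (path_graph 4 \<squnion>\<^sub>g complete_graph 2)"
definition "D4 = complement (complete_graph 3 \<squnion>\<^sub>g complete_graph 2)"
definition "D5 = complement (path_graph 3 \<squnion>\<^sub>g complete_graph 2 \<squnion>\<^sub>g complete_graph 2)"
definition "D6 = complement
  (complete_graph 2 \<squnion>\<^sub>g complete_graph 2 \<squnion>\<^sub>g complete_graph 2 \<squnion>\<^sub>g complete_graph 2)"


section \<open>Sparsity order\<close>

text \<open>
  A matrix with rows and columns indexed by the vertex set \<open>V\<close> of \<open>G\<close> is represented by a square
  matrix over the ambient finite type that vanishes outside \<open>V \<times> V\<close>; this padding by zeros changes
  neither rank nor semidefiniteness, and it is void if \<open>V = UNIV\<close>.
\<close>

definition hermitian_space :: "'n::finite ugraph \<Rightarrow> (complex^'n^'n) set" where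
  "hermitian_space G =
     {A. (\<forall>i j. A $ i $ j = cnj (A $ j $ i)) \<and>
         (\<forall>i j. i \<notin> verts G \<or> j \<notin> verts G \<longrightarrow> A $ i $ j = 0) \<and>
         (\<forall>i\<in>verts G. \<forall>j\<in>verts G. i \<noteq> j \<and> {i, j} \<notin> edges G \<longrightarrow> A $ i $ j = 0)}"

text \<open>For Hermitian \<open>A\<close> the quadratic form is real, so \<open>Re\<close> discards nothing in \<open>psd_cone\<close>.\<close>

definition pos_semidef :: "complex^'n^'n \<Rightarrow> bool" where
  "pos_semidef A \<longleftrightarrow> (\<forall>x. 0 \<le> Re (\<Sum>i\<in>UNIV. \<Sum>j\<in>UNIV. cnj (x $ i) * A $ i $ j * x $ j))"

definition psd_cone :: "'n::finite ugraph \<Rightarrow> (complex^'n^'n) set" where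
  "psd_cone G = {A \<in> hermitian_space G. pos_semidef A}"

definition extremal :: "'n::finite ugraph \<Rightarrow> complex^'n^'n \<Rightarrow> bool" where
  "extremal G X \<longleftrightarrow>
     X \<in> psd_cone G \<and> X \<noteq> 0 \<and>
     (\<forall>X'\<in>psd_cone G. \<forall>X''\<in>psd_cone G. X' \<noteq> 0 \<and> X'' \<noteq> 0 \<and> X = X' + X'' \<longrightarrow>
        (\<exists>a>0. X' = a *\<^sub>R X) \<and> (\<exists>b>0. X'' = b *\<^sub>R X))"

definition sparsity_order :: "'n::finite ugraph \<Rightarrow> nat" where
  "sparsity_order G = Max {rank X |X. extremal G X}"


section \<open>The classes and clique-sums\<close>

definition in_K2 :: "'a ugraph \<Rightarrow> bool" where
  "in_K2 G \<longleftrightarrow> simple_graph G \<and>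
     (\<exists>X1 Y1 X2 Y2 Z. let P = (!) [X1, Y1, X2, Y2, Z] in
        verts G = (\<Union>i<5. P i) \<and> disjoint_family_on P {..<5} \<and> (\<forall>i<5. clique G (P i)) \<and>
        (\<forall>i<5. \<forall>j<5. i \<noteq> j \<longrightarrow> (\<forall>u\<in>P i. \<forall>v\<in>P j.
           {u, v} \<notin> edges G \<longleftrightarrow>
           (\<exists>(X, Y)\<in>{(X1, Y1), (X2, Y2)}. u \<in> X \<and> v \<in> Y \<or> u \<in> Y \<and> v \<in> X))))"

definition in_K3 :: "'a ugraph \<Rightarrow> bool" where
  "in_K3 G \<longleftrightarrow> simple_graph G \<and>
     (\<exists>x1 y1 x2 y2 x3 y3 Z.
        distinct [x1, y1, x2, y2, x3, y3] \<and> {x1, y1, x2, y2, x3, y3} \<inter> Z = {} \<and>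
        verts G = {x1, y1, x2, y2, x3, y3} \<union> Z \<and> clique G Z \<and>
        (\<forall>u\<in>verts G. \<forall>v\<in>verts G. u \<noteq> v \<longrightarrow>
           ({u, v} \<notin> edges G \<longleftrightarrow> {u, v} \<in> {{x1, y1}, {x2, y2}, {x3, y3}})))"

text \<open>
  The summands are taken with the identified vertices already having the same names, so that the two
  cliques that are glued together are both equal to the intersection of the vertex sets.
\<close>

definition clique_sum :: "'a ugraph \<Rightarrow> 'a ugraph \<Rightarrow> 'a ugraph \<Rightarrow> bool" where
  "clique_sum G1 G2 G \<longleftrightarrow>
     clique G1 (verts G1 \<inter> verts G2) \<and> clique G2 (verts G1 \<inter> verts G2) \<and>
     G = (verts G1 \<union> verts G2, edges G1 \<union> edges G2)"

inductive clique_sum_of :: "('a ugraph \<Rightarrow> bool) \<Rightarrow> 'a ugraph \<Rightarrow> bool" for C where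
  single: "C G \<Longrightarrow> clique_sum_of C G"
| sum: "\<lbrakk>clique_sum_of C G1; clique_sum_of C G2; clique_sum G1 G2 G\<rbrakk> \<Longrightarrow> clique_sum_of C G"

end

theory Submission
  imports Defs
begin

text \<open>
  The equivalence is proved as a circle: small order excludes the forbidden patterns, a graph without
  forbidden patterns decomposes into basic graphs, and clique-sums of basic graphs have small order.
  Throughout, the matrices of the cone are treated as Gram matrices of vectors \<open>a\<^sub>v\<close>, one for each
  vertex, that are orthogonal for non-adjacent vertices; a perturbation inside the face of such a
  matrix is \<open>a\<^sub>u\<^sup>* U a\<^sub>v\<close> with \<open>U\<close> Hermitian, and it has to vanish on the same pairs. If the
  vectors span their space, the matrix is extremal exactly if only scalar \<open>U\<close> survive. It is convenient
  to read everything in the complement: a non-edge, or co-edge, is an orthogonality constraint.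

  Small order excludes the patterns (\<open>obstruction_free_if_order_le_2\<close>). Each pattern has a rigid family
  of vectors, i.e. one that forces \<open>U\<close> to be scalar, in dimension 3 for \<open>D1, \<dots>, D6\<close> and in dimension
  \<open>n - 2\<close> for the cycle. Put on an induced copy, with the zero vector at all other vertices, it is still
  rigid and yields an extremal matrix (\<open>rigid_frame_extremal\<close>).

  Decomposition (\<open>clique_sum_of_if_obstruction_free\<close>). By induction it suffices that an obstruction-free
  graph has a clique separator or is basic. In a graph that is not complete, take a vertex and a connected
  set \<open>B\<close> that the vertex does not see, with \<open>B\<close> as large as possible. Its neighbourhood \<open>T\<close> separates it
  from the rest \<open>A\<close>, and by maximality every vertex of \<open>A\<close> is adjacent to all of \<open>T\<close>. If \<open>T\<close> is not a
  clique, the absence of long holes provides common neighbours in \<open>B\<close> for the co-edges of \<open>T\<close>, and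
  together with a vertex of \<open>A\<close> these produce a forbidden pattern unless the co-edges inside \<open>T\<close> form
  one complete bipartite graph or two disjoint edges. The vertices of \<open>B\<close> that are such common neighbours
  form a clique; a component of the remaining vertices of \<open>B\<close> has a clique as neighbourhood, and if nothing
  remains, the graph is basic.

  Small order of clique-sums (\<open>order_le_2_if_clique_sum_of\<close>). Schur elimination of the vertices on one
  side of a clique separator splits a matrix of the cone into summands that live on the two sides, so
  extremal matrices of a clique-sum are extremal for a summand. For the first basic class the constraints
  hold for every \<open>U\<close> that commutes with two orthogonal projections \<open>P\<^sub>1\<close>, \<open>P\<^sub>2\<close>; as \<open>(P\<^sub>1 - P\<^sub>2)\<^sup>2\<close> commutes with
  both, it is scalar on an extremal matrix, and then a vector \<open>v\<close> in the range of \<open>P\<^sub>1\<close> spans together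
  with \<open>P\<^sub>2 v\<close> an invariant subspace, which must be everything. For the second class a dimension
  count suffices: Hermitian matrices of size 3 have nine real parameters, and three complex constraints
  remove only six.
\<close>

section \<open>Adjacency, non-adjacency and the forbidden patterns\<close>

abbreviation adj :: "'a ugraph \<Rightarrow> 'a \<Rightarrow> 'a \<Rightarrow> bool" where
  "adj G u v \<equiv> {u, v} \<in> edges G"

text \<open>
  Such a pair is an edge of the complement. It is called a co-edge below, and likewise the prefix
  co- refers to the complement in names such as co-triangle or co-path.
\<close>

definition nadj :: "'a ugraph \<Rightarrow> 'a \<Rightarrow> 'a \<Rightarrow> bool" where
  "nadj G u v \<longleftrightarrow> u \<in> verts G \<and> v \<in> verts G \<and> u \<noteq> v \<and> {u, v} \<notin> edges G"

lemma adj_commute: "adj G u v \<longleftrightarrow> adj G v u"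
  by (simp add: insert_commute)

lemma nadj_commute: "nadj G u v \<longleftrightarrow> nadj G v u"
  by (auto simp: nadj_def insert_commute)

lemma simple_graph_adjD:
  assumes "simple_graph G" "adj G u v"
  shows "u \<in> verts G" "v \<in> verts G" "u \<noteq> v"
  using assms unfolding simple_graph_def by (auto simp: doubleton_eq_iff)

lemma contains_induced_iff:
  "contains_induced G H \<longleftrightarrow>
     (\<exists>f. inj_on f (verts H) \<and> f ` verts H \<subseteq> verts G \<and>
          (\<forall>u\<in>verts H. \<forall>v\<in>verts H. {u, v} \<in> edges H \<longleftrightarrow> {f u, f v} \<in> edges G))"
proof
  assume "contains_induced G H"
  then obtain S f where "S \<subseteq> verts G" "bij_betw f (verts H) S"
    "\<forall>u\<in>verts H. \<forall>v\<in>verts H. {u, v} \<in> edges H \<longleftrightarrow> {f u, f v} \<in> edges G \<and> {f u, f v} \<subseteq> S"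
    unfolding contains_induced_def graph_iso_def induced_subgraph_def by auto
  then show "\<exists>f. inj_on f (verts H) \<and> f ` verts H \<subseteq> verts G \<and>
          (\<forall>u\<in>verts H. \<forall>v\<in>verts H. {u, v} \<in> edges H \<longleftrightarrow> {f u, f v} \<in> edges G)"
    by (intro exI[of _ f]) (auto simp: bij_betw_def)
next
  assume "\<exists>f. inj_on f (verts H) \<and> f ` verts H \<subseteq> verts G \<and>
          (\<forall>u\<in>verts H. \<forall>v\<in>verts H. {u, v} \<in> edges H \<longleftrightarrow> {f u, f v} \<in> edges G)"
  then obtain f where "inj_on f (verts H)" "f ` verts H \<subseteq> verts G"
    "\<forall>u\<in>verts H. \<forall>v\<in>verts H. {u, v} \<in> edges H \<longleftrightarrow> {f u, f v} \<in> edges G" by blast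
  then show "contains_induced G H"
    unfolding contains_induced_def graph_iso_def induced_subgraph_def
    by (intro exI[of _ "f ` verts H"] conjI exI[of _ f]) (auto simp: bij_betw_def)
qed

text \<open>
  For the patterns defined as complements it is shorter to match the edges of the
  uncomplemented pattern with the non-edges of \<open>G\<close>.
\<close>

lemma contains_induced_complement_iff:
  assumes "simple_graph G"
  shows "contains_induced G (complement F) \<longleftrightarrow>
     (\<exists>f. inj_on f (verts F) \<and> f ` verts F \<subseteq> verts G \<and>
          (\<forall>u\<in>verts F. \<forall>v\<in>verts F. u \<noteq> v \<longrightarrow> ({u, v} \<in> edges F \<longleftrightarrow> {f u, f v} \<notin> edges G)))"
proof -
  have e: "{u, v} \<in> edges (complement F) \<longleftrightarrow> u \<noteq> v \<and> {u, v} \<notin> edges F"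
    if "u \<in> verts F" "v \<in> verts F" for u v
    using that by (auto simp: complement_def doubleton_eq_iff insert_commute)
  have "verts (complement F) = verts F" by (simp add: complement_def)
  moreover have "{x, x} \<notin> edges G" for x using simple_graph_adjD(3)[OF assms, of x x] by auto
  ultimately show ?thesis
    unfolding contains_induced_iff using e by (metis (no_types, lifting))
qed

lemma lessThan_numerals:
  "{..<2::nat} = {0, 1}" "{..<3::nat} = {0, 1, 2}" "{..<4::nat} = {0, 1, 2, 3}"
  "{..<6::nat} = {0, 1, 2, 3, 4, 5}"
  by auto

lemma path_edge_iff: "{i, j} \<in> edges (path_graph n) \<longleftrightarrow> i < n \<and> j < n \<and> (j = Suc i \<or> i = Suc j)"
  by (auto simp: path_graph_def doubleton_eq_iff)

lemma complete_edge_iff: "{i, j} \<in> edges (complete_graph n) \<longleftrightarrow> i < n \<and> j < n \<and> i \<noteq> j"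
  by (auto simp: complete_graph_def doubleton_eq_iff)

lemma cycle_edge_iff:
  "{i, j} \<in> edges (cycle_graph n) \<longleftrightarrow> i < n \<and> j < n \<and> (j = Suc i mod n \<or> i = Suc j mod n)"
  by (auto simp: cycle_graph_def doubleton_eq_iff)

lemma disjoint_union_edge_iff:
  "{Inl u, Inl v} \<in> edges (G \<squnion>\<^sub>g H) \<longleftrightarrow> {u, v} \<in> edges G"
  "{Inr x, Inr y} \<in> edges (G \<squnion>\<^sub>g H) \<longleftrightarrow> {x, y} \<in> edges H"
  "{Inl u, Inr x} \<notin> edges (G \<squnion>\<^sub>g H)"
  "{Inr x, Inl u} \<notin> edges (G \<squnion>\<^sub>g H)"
proof -
  have l: "{Inl u, Inl v} = (Inl :: 'a \<Rightarrow> 'a + 'b) ` A \<longleftrightarrow> {u, v} = A" for A :: "'a set" and u v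
    using inj_image_eq_iff[of "Inl :: 'a \<Rightarrow> 'a + 'b" "{u, v}" A] by simp
  have r: "{Inr u, Inr v} = (Inr :: 'b \<Rightarrow> 'a + 'b) ` A \<longleftrightarrow> {u, v} = A" for A :: "'b set" and u v
    using inj_image_eq_iff[of "Inr :: 'b \<Rightarrow> 'a + 'b" "{u, v}" A] by simp
  have nr: "{Inl u, s} \<noteq> (Inr :: 'b \<Rightarrow> 'a + 'b) ` A" "{s, Inl u} \<noteq> (Inr :: 'b \<Rightarrow> 'a + 'b) ` A"
    and nl: "{Inr w, s} \<noteq> (Inl :: 'a \<Rightarrow> 'a + 'b) ` A'" "{s, Inr w} \<noteq> (Inl :: 'a \<Rightarrow> 'a + 'b) ` A'" for u w s A A'
    by blast+
  show "{Inl u, Inl v} \<in> edges (G \<squnion>\<^sub>g H) \<longleftrightarrow> {u, v} \<in> edges G"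
    "{Inr x, Inr y} \<in> edges (G \<squnion>\<^sub>g H) \<longleftrightarrow> {x, y} \<in> edges H"
    "{Inl u, Inr x} \<notin> edges (G \<squnion>\<^sub>g H)"
    "{Inr x, Inl u} \<notin> edges (G \<squnion>\<^sub>g H)"
    by (simp_all add: disjoint_union_def image_iff l r nl nr)
qed

lemma disjoint_union_verts: "verts (G \<squnion>\<^sub>g H) = Inl ` verts G \<union> Inr ` verts H"
  by (simp add: disjoint_union_def)

lemma pattern_verts:
  "verts (path_graph n) = {..<n}" "verts (cycle_graph n) = {..<n}" "verts (complete_graph n) = {..<n}"
  by (simp_all add: path_graph_def cycle_graph_def complete_graph_def)

lemmas pattern_simps = pattern_verts path_edge_iff cycle_edge_iff complete_edge_iff
  disjoint_union_verts disjoint_union_edge_iff lessThan_numerals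

text \<open>
  Both orientations of all consequences of an adjacency, ready for the simplifier: the pattern
  lemmas below check every ordered pair of vertices of the pattern by rewriting.
\<close>

lemma adj_sym_facts:
  assumes "simple_graph G" "adj G u v"
  shows "u \<in> verts G \<and> v \<in> verts G \<and> u \<noteq> v \<and> v \<noteq> u \<and> adj G u v \<and> adj G v u"
  using simple_graph_adjD[OF assms] assms(2) by (auto simp: insert_commute)

lemma nadj_sym_facts:
  assumes "nadj G u v"
  shows "u \<in> verts G \<and> v \<in> verts G \<and> u \<noteq> v \<and> v \<noteq> u \<and> {u, v} \<notin> edges G \<and> {v, u} \<notin> edges G"
  using assms by (auto simp: nadj_def insert_commute)

lemma contains_D4I:
  assumes G: "simple_graph G"
    and "nadj G x y" "nadj G y z" "nadj G x z" "nadj G s t"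
    and "adj G x s" "adj G y s" "adj G z s" "adj G x t" "adj G y t" "adj G z t"
  shows "contains_induced G D4"
  unfolding D4_def contains_induced_complement_iff[OF G]
  using assms(2-5)[THEN nadj_sym_facts] assms(6-)[THEN adj_sym_facts[OF G]]
  by (intro exI[of _ "case_sum (\<lambda>i. [x, y, z] ! i) (\<lambda>i. [s, t] ! i)"])
    (simp_all add: pattern_simps inj_on_def)

lemma contains_D1I:
  assumes G: "simple_graph G"
    and "nadj G a b" "nadj G b c" "nadj G c d" "nadj G d e" "nadj G e f"
    and "adj G a c" "adj G a d" "adj G a e" "adj G a f" "adj G b d" "adj G b e" "adj G b f"
      "adj G c e" "adj G c f" "adj G d f"
  shows "contains_induced G D1"
  unfolding D1_def contains_induced_complement_iff[OF G]
  using assms(2-6)[THEN nadj_sym_facts] assms(7-)[THEN adj_sym_facts[OF G]]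
  by (intro exI[of _ "\<lambda>i. [a, b, c, d, e, f] ! i"])
    (simp_all add: pattern_simps inj_on_def)

lemma contains_D2I:
  assumes G: "simple_graph G"
    and "nadj G a b" "nadj G b c" "nadj G c d" "nadj G d e" "nadj G e f" "nadj G f a"
    and "adj G a c" "adj G a d" "adj G a e" "adj G b d" "adj G b e" "adj G b f"
      "adj G c e" "adj G c f" "adj G d f"
  shows "contains_induced G D2"
  unfolding D2_def contains_induced_complement_iff[OF G]
  using assms(2-7)[THEN nadj_sym_facts] assms(8-)[THEN adj_sym_facts[OF G]]
  by (intro exI[of _ "\<lambda>i. [a, b, c, d, e, f] ! i"])
    (simp_all add: pattern_simps inj_on_def)

lemma contains_D3I:
  assumes G: "simple_graph G"
    and "nadj G a b" "nadj G b c" "nadj G c d" "nadj G s t"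
    and "adj G a c" "adj G a d" "adj G b d"
      "adj G a s" "adj G b s" "adj G c s" "adj G d s"
      "adj G a t" "adj G b t" "adj G c t" "adj G d t"
  shows "contains_induced G D3"
  unfolding D3_def contains_induced_complement_iff[OF G]
  using assms(2-5)[THEN nadj_sym_facts] assms(6-)[THEN adj_sym_facts[OF G]]
  by (intro exI[of _ "case_sum (\<lambda>i. [a, b, c, d] ! i) (\<lambda>i. [s, t] ! i)"])
    (simp_all add: pattern_simps inj_on_def)

lemma contains_D5I:
  assumes G: "simple_graph G"
    and "nadj G a b" "nadj G b c" "nadj G s t" "nadj G x y"
    and "adj G a c" 
      "adj G a s" "adj G b s" "adj G c s" "adj G a t" "adj G b t" "adj G c t"
      "adj G a x" "adj G b x" "adj G c x" "adj G a y" "adj G b y" "adj G c y"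
      "adj G s x" "adj G s y" "adj G t x" "adj G t y"
  shows "contains_induced G D5"
  unfolding D5_def contains_induced_complement_iff[OF G]
  using assms(2-5)[THEN nadj_sym_facts] assms(6-)[THEN adj_sym_facts[OF G]]
  by (intro exI[of _ "case_sum (\<lambda>i. [a, b, c] ! i)
      (case_sum (\<lambda>i. [s, t] ! i) (\<lambda>i. [x, y] ! i))"])
    (simp_all add: pattern_simps inj_on_def)

lemma contains_D6I:
  assumes G: "simple_graph G"
    and "nadj G a b" "nadj G p q" "nadj G s t" "nadj G x y"
    and "adj G a p" "adj G a q" "adj G b p" "adj G b q"
      "adj G a s" "adj G a t" "adj G b s" "adj G b t"
      "adj G a x" "adj G a y" "adj G b x" "adj G b y"
      "adj G p s" "adj G p t" "adj G q s" "adj G q t"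
      "adj G p x" "adj G p y" "adj G q x" "adj G q y"
      "adj G s x" "adj G s y" "adj G t x" "adj G t y"
  shows "contains_induced G D6"
  unfolding D6_def contains_induced_complement_iff[OF G]
  using assms(2-5)[THEN nadj_sym_facts] assms(6-)[THEN adj_sym_facts[OF G]]
  by (intro exI[of _ "case_sum (\<lambda>i. [a, b] ! i) (case_sum (\<lambda>i. [p, q] ! i)
      (case_sum (\<lambda>i. [s, t] ! i) (\<lambda>i. [x, y] ! i)))"])
    (simp_all add: pattern_simps inj_on_def)

lemma contains_C5I:
  assumes G: "simple_graph G"
    and "adj G a b" "adj G b c" "adj G c d" "adj G d e" "adj G e a"
    and "nadj G a c" "nadj G a d" "nadj G b d" "nadj G b e" "nadj G c e"
  shows "contains_induced G (cycle_graph 5)"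
proof -
  have "{x, x} \<notin> edges G" for x using simple_graph_adjD(3)[OF G, of x x] by auto
  moreover have "{..<5::nat} = {0, 1, 2, 3, 4}" by auto
  ultimately show ?thesis
    unfolding contains_induced_iff
    using assms(2-6)[THEN adj_sym_facts[OF G]] assms(7-)[THEN nadj_sym_facts]
    by (intro exI[of _ "\<lambda>i. [a, b, c, d, e] ! i"])
      (simp_all add: pattern_simps inj_on_def)
qed

lemma contains_C6I:
  assumes G: "simple_graph G"
    and "adj G a b" "adj G b c" "adj G c d" "adj G d e" "adj G e f" "adj G f a"
    and "nadj G a c" "nadj G a d" "nadj G a e" "nadj G b d" "nadj G b e" "nadj G b f"
      "nadj G c e" "nadj G c f" "nadj G d f"
  shows "contains_induced G (cycle_graph 6)"
proof -
  have "{x, x} \<notin> edges G" for x using simple_graph_adjD(3)[OF G, of x x] by auto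
  then show ?thesis
    unfolding contains_induced_iff
    using assms(2-7)[THEN adj_sym_facts[OF G]] assms(8-)[THEN nadj_sym_facts]
    by (intro exI[of _ "\<lambda>i. [a, b, c, d, e, f] ! i"])
      (simp_all add: pattern_simps inj_on_def)
qed

section \<open>Connected sets and induced cycles\<close>

definition arcs_on :: "'a ugraph \<Rightarrow> 'a set \<Rightarrow> ('a \<times> 'a) set" where
  "arcs_on G B = {(x, y). x \<in> B \<and> y \<in> B \<and> adj G x y}"

definition connected_on :: "'a ugraph \<Rightarrow> 'a set \<Rightarrow> bool" where
  "connected_on G B \<longleftrightarrow> (\<forall>u\<in>B. \<forall>v\<in>B. (u, v) \<in> (arcs_on G B)\<^sup>*)"

text \<open>
  Walks are functions rather than lists so that cutting out a segment is a shift of the index.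
\<close>

definition walk_through :: "'a ugraph \<Rightarrow> 'a set \<Rightarrow> 'a \<Rightarrow> 'a \<Rightarrow> (nat \<Rightarrow> 'a) \<Rightarrow> nat \<Rightarrow> bool" where
  "walk_through G R s t p m \<longleftrightarrow> p 0 = s \<and> p m = t \<and> (\<forall>i<m. adj G (p i) (p (Suc i))) \<and>
     (\<forall>i. 0 < i \<and> i < m \<longrightarrow> p i \<in> R)"

lemma walk_through_exists:
  assumes R: "connected_on G R" and u: "u \<in> R" "adj G s u" and v: "v \<in> R" "adj G v t"
  shows "\<exists>p m. walk_through G R s t p m"
proof -
  have "(u, v) \<in> (arcs_on G R)\<^sup>*" using R u v by (auto simp: connected_on_def)
  then have "\<exists>p m. p 0 = s \<and> p m = v \<and> 0 < m \<and> (\<forall>i<m. adj G (p i) (p (Suc i))) \<and>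
     (\<forall>i. 0 < i \<and> i \<le> m \<longrightarrow> p i \<in> R)"
  proof induction
    case base
    show ?case using u by (intro exI[of _ "\<lambda>i. if i = 0 then s else u"] exI[of _ 1]) auto
  next
    case (step y z)
    then obtain p m where p: "p 0 = s" "p m = y" "0 < m" "\<forall>i<m. adj G (p i) (p (Suc i))"
      "\<forall>i. 0 < i \<and> i \<le> m \<longrightarrow> p i \<in> R" by blast
    have "z \<in> R" "adj G y z" using step by (auto simp: arcs_on_def)
    then show ?case using p
      by (intro exI[of _ "p(Suc m := z)"] exI[of _ "Suc m"]) (auto simp: less_Suc_eq le_Suc_eq)
  qed
  then obtain p m where p: "p 0 = s" "p m = v" "0 < m" "\<forall>i<m. adj G (p i) (p (Suc i))"
      "\<forall>i. 0 < i \<and> i \<le> m \<longrightarrow> p i \<in> R" by blast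
  then have "walk_through G R s t (p(Suc m := t)) (Suc m)"
    using v by (auto simp: walk_through_def less_Suc_eq)
  then show ?thesis by blast
qed

text \<open>
  A shortest walk from \<open>s\<close> to \<open>t\<close> through \<open>R\<close> has no chords, and \<open>c\<close> sees only its ends, so \<open>c\<close>
  closes it to an induced cycle. Unless the walk has a single inner vertex, this cycle has at least
  five vertices.
\<close>

lemma common_neighbour_or_hole:
  assumes G: "simple_graph G" and R: "connected_on G R"
    and holes: "\<forall>n\<ge>5. \<not> contains_induced G (cycle_graph n)"
    and st: "nadj G s t" and c: "adj G c s" "adj G c t" "\<And>r. r \<in> R \<Longrightarrow> \<not> adj G c r" "c \<notin> R"
    and RV: "R \<subseteq> verts G"
    and u: "u \<in> R" "adj G s u" and v: "v \<in> R" "adj G t v"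
  shows "\<exists>r\<in>R. adj G s r \<and> adj G t r"
proof -
  have irr: "\<not> adj G x x" for x using simple_graph_adjD(3)[OF G, of x x] by auto
  \<comment> \<open>The length of a shortest walk; both shortcuts below contradict its minimality.\<close>
  define m where "m = (LEAST m. \<exists>p. walk_through G R s t p m)"
  have "\<exists>m p. walk_through G R s t p m"
    using walk_through_exists[OF R u v(1), of t] v(2) by (auto simp: insert_commute)
  then have "\<exists>p. walk_through G R s t p m" unfolding m_def by (rule LeastI_ex)
  then obtain p where p: "p 0 = s" "p m = t" "\<And>i. i < m \<Longrightarrow> adj G (p i) (p (Suc i))"
    "\<And>i. 0 < i \<Longrightarrow> i < m \<Longrightarrow> p i \<in> R" unfolding walk_through_def by blast
  have minimal: "m \<le> m'" if "walk_through G R s t p' m'" for p' m'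
    unfolding m_def by (rule Least_le) (use that in blast)
  have no_chord: "j = Suc i" if ij: "i < j" "j \<le> m" "adj G (p i) (p j)" for i j
  proof (rule ccontr)
    assume "j \<noteq> Suc i"
    then have ij': "Suc i < j" using ij by simp
    define d where "d = j - Suc i"
    have d: "d > 0" "d \<le> m" "i + d < m" "j = Suc (i + d)" using ij ij' by (auto simp: d_def)
    have "walk_through G R s t (\<lambda>k. if k \<le> i then p k else p (k + d)) (m - d)"
      unfolding walk_through_def
    proof (intro conjI allI impI)
      show "(if 0 \<le> i then p 0 else p (0 + d)) = s" using p by simp
      show "(if m - d \<le> i then p (m - d) else p (m - d + d)) = t" using p d by auto
      show "adj G (if k \<le> i then p k else p (k + d)) (if Suc k \<le> i then p (Suc k) else p (Suc k + d))"
        if "k < m - d" for k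
        using that p(3)[of k] p(3)[of "k + d"] ij(3) d by (cases "k = i") auto
      show "(if k \<le> i then p k else p (k + d)) \<in> R" if "0 < k \<and> k < m - d" for k
        using that p(4)[of k] p(4)[of "k + d"] d by auto
    qed
    from minimal[OF this] d show False by simp
  qed
  have distinct: "p i \<noteq> p j" if ij: "i < j" "j \<le> m" for i j
  proof
    assume eq: "p i = p j"
    define d where "d = j - i"
    have d: "d > 0" "d \<le> m" "i + d \<le> m" "j = i + d" using ij by (auto simp: d_def)
    have "walk_through G R s t (\<lambda>k. if k \<le> i then p k else p (k + d)) (m - d)"
      unfolding walk_through_def
    proof (intro conjI allI impI)
      show "(if 0 \<le> i then p 0 else p (0 + d)) = s" using p by simp
      show "(if m - d \<le> i then p (m - d) else p (m - d + d)) = t"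
      proof (cases "m - d \<le> i")
        case True
        then have "m - d = i" "j = m" using d by auto
        then show ?thesis using p eq by simp
      qed (use p d in auto)
      show "adj G (if k \<le> i then p k else p (k + d)) (if Suc k \<le> i then p (Suc k) else p (Suc k + d))"
        if "k < m - d" for k
      proof (cases "k = i")
        case True
        then show ?thesis using p(3)[of "i + d"] d eq that by simp
      qed (use that p(3)[of k] p(3)[of "k + d"] d in auto)
      show "(if k \<le> i then p k else p (k + d)) \<in> R" if "0 < k \<and> k < m - d" for k
        using that p(4)[of k] p(4)[of "k + d"] d by auto
    qed
    from minimal[OF this] d show False by simp
  qed
  have st': "s \<noteq> t" "\<not> adj G s t" "s \<in> verts G" "t \<in> verts G" using st by (auto simp: nadj_def)
  have "m \<noteq> 0" using p(1,2) st'(1) by metis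
  moreover have "m \<noteq> 1" using p(1,2) p(3)[of 0] st'(2) by auto
  ultimately have m2: "m \<ge> 2" by simp
  show ?thesis
  proof (cases "m = 2")
    case True
    then show ?thesis using p(1,2) p(3)[of 0] p(3)[of 1] p(4)[of 1]
      by (intro bexI[of _ "p 1"]) (auto simp: insert_commute numeral_2_eq_2)
  next
    case False
    then have m: "m \<ge> 3" using m2 by simp
    define f where "f i = (if i \<le> m then p i else c)" for i
    have cp: "adj G c (p i) \<longleftrightarrow> i = 0 \<or> i = m" "p i \<noteq> c" if "i \<le> m" for i
      using that p(1,2) p(4)[of i] c irr by (cases "i = 0"; cases "i = m"; force)+
    have pV: "p i \<in> verts G" if "i \<le> m" for i
      using that p(1,2) p(4)[of i] RV st' by (cases "i = 0 \<or> i = m") auto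
    have cV: "c \<in> verts G" using simple_graph_adjD[OF G c(1)] by simp
    have padj: "adj G (p i) (p j) \<longleftrightarrow> j = Suc i" if "i < j" "j \<le> m" for i j
      using no_chord[OF that] p(3)[of i] that by auto
    have fadj: "adj G (f i) (f j) \<longleftrightarrow> adj (cycle_graph (Suc (Suc m))) i j" "f i \<noteq> f j"
      if ij: "i < j" "j < Suc (Suc m)" for i j
    proof -
      have cyc: "adj (cycle_graph (Suc (Suc m))) i j \<longleftrightarrow> j = Suc i \<or> i = 0 \<and> j = Suc m"
        using ij unfolding cycle_edge_iff by (auto simp: mod_Suc)
      have "adj G (f i) (f j) \<longleftrightarrow> j = Suc i \<or> i = 0 \<and> j = Suc m"
      proof (cases "j \<le> m")
        case True
        then show ?thesis using ij padj[of i j] by (simp add: f_def)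
      next
        case False
        then have "j = Suc m" "i \<le> m" using ij by auto
        then show ?thesis using cp(1)[of i] by (auto simp: f_def insert_commute)
      qed
      then show "adj G (f i) (f j) \<longleftrightarrow> adj (cycle_graph (Suc (Suc m))) i j"
        unfolding cyc .
      show "f i \<noteq> f j" using ij distinct[of i j] cp(2)[of i] by (auto simp: f_def)
    qed
    have "contains_induced G (cycle_graph (Suc (Suc m)))"
      unfolding contains_induced_iff pattern_verts
    proof (intro exI[of _ f] conjI ballI)
      show "inj_on f {..<Suc (Suc m)}"
        unfolding inj_on_def using fadj(2) by (metis lessThan_iff linorder_neqE_nat)
      show "f ` {..<Suc (Suc m)} \<subseteq> verts G" using pV cV by (auto simp: f_def)
      fix i j assume "i \<in> {..<Suc (Suc m)}" "j \<in> {..<Suc (Suc m)}"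
      then have ij: "i < Suc (Suc m)" "j < Suc (Suc m)" by auto
      consider "i < j" | "j < i" | "i = j" by linarith
      then show "adj (cycle_graph (Suc (Suc m))) i j = adj G (f i) (f j)"
      proof cases
        case 1
        then show ?thesis using fadj(1) ij by simp
      next
        case 2
        then show ?thesis using fadj(1)[of j i] ij by (simp add: insert_commute)
      next
        case 3
        have "\<not> adj (cycle_graph (Suc (Suc m))) i i" unfolding cycle_edge_iff by (auto simp: mod_Suc)
        then show ?thesis using irr[of "f i"] 3 by simp
      qed
    qed
    then show ?thesis using holes[rule_format, of "Suc (Suc m)"] m by simp
  qed
qed

lemma connected_on_insert:
  assumes "connected_on G B" "u \<in> B" "adj G t u"
  shows "connected_on G (insert t B)"
proof -
  have sub: "(arcs_on G B)\<^sup>* \<subseteq> (arcs_on G (insert t B))\<^sup>*"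
    by (rule rtrancl_mono) (auto simp: arcs_on_def)
  have tu: "(t, u) \<in> arcs_on G (insert t B)" "(u, t) \<in> arcs_on G (insert t B)"
    using assms by (auto simp: arcs_on_def insert_commute)
  have to: "(x, u) \<in> (arcs_on G (insert t B))\<^sup>*" and from_u: "(u, x) \<in> (arcs_on G (insert t B))\<^sup>*"
    if "x \<in> insert t B" for x
    using that tu sub assms(1,2) unfolding connected_on_def by blast+
  show ?thesis unfolding connected_on_def using to from_u by (meson rtrancl_trans)
qed

lemma component_exists:
  assumes "r \<in> R"
  shows "\<exists>C\<subseteq>R. r \<in> C \<and> connected_on G C \<and> (\<forall>x\<in>C. \<forall>y\<in>R - C. \<not> adj G x y)"
proof -
  define C where "C = {v. (r, v) \<in> (arcs_on G R)\<^sup>*}"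
  have CR: "C \<subseteq> R"
  proof
    fix v assume "v \<in> C"
    then have "(r, v) \<in> (arcs_on G R)\<^sup>*" by (simp add: C_def)
    then show "v \<in> R" by cases (use assms in \<open>auto simp: arcs_on_def\<close>)
  qed
  have sym: "sym ((arcs_on G C)\<^sup>*)"
    by (rule sym_rtrancl) (auto simp: sym_def arcs_on_def insert_commute)
  have reach: "(r, v) \<in> (arcs_on G C)\<^sup>*" if "v \<in> C" for v
  proof -
    have "(r, v) \<in> (arcs_on G R)\<^sup>*" using that by (simp add: C_def)
    then show ?thesis
    proof induction
      case (step y z)
      then have "y \<in> C" "z \<in> C" by (auto simp: C_def)
      with step(2) have "(y, z) \<in> arcs_on G C" by (auto simp: arcs_on_def)
      with step(3) show ?case by (rule rtrancl_into_rtrancl)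
    qed simp
  qed
  have "connected_on G C"
    unfolding connected_on_def using reach sym by (meson rtrancl_trans symD)
  moreover have "\<not> adj G x y" if "x \<in> C" "y \<in> R - C" for x y
  proof
    assume "adj G x y"
    then have "(x, y) \<in> arcs_on G R" using that CR by (auto simp: arcs_on_def)
    then have "y \<in> C" using that(1) by (auto simp: C_def intro: rtrancl_into_rtrancl)
    then show False using that by simp
  qed
  ultimately show ?thesis using CR by (intro exI[of _ C]) (auto simp: C_def)
qed

section \<open>The two basic classes and clique separators\<close>

definition obstruction_free :: "'a ugraph \<Rightarrow> bool" where
  "obstruction_free G \<longleftrightarrow> (\<forall>n\<ge>5. \<not> contains_induced G (cycle_graph n)) \<and>
     \<not> contains_induced G D1 \<and> \<not> contains_induced G D2 \<and> \<not> contains_induced G D3 \<and>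
     \<not> contains_induced G D4 \<and> \<not> contains_induced G D5 \<and> \<not> contains_induced G D6"

text \<open>
  Both sides have to be proper, so that an induction on the number of vertices applies to them.
  The empty clique covers disconnected graphs.
\<close>

definition clique_separable :: "'a ugraph \<Rightarrow> bool" where
  "clique_separable G \<longleftrightarrow> (\<exists>V1 V2. V1 \<union> V2 = verts G \<and> V1 \<noteq> verts G \<and> V2 \<noteq> verts G \<and>
     clique G (V1 \<inter> V2) \<and> (\<forall>u\<in>V1 - V2. \<forall>v\<in>V2 - V1. \<not> adj G u v))"

text \<open>
  The class written without the list indexing of its definition.
\<close>

lemma in_K2I:
  assumes "simple_graph G" "verts G = X1 \<union> Y1 \<union> X2 \<union> Y2 \<union> Z"
    and "X1 \<inter> Y1 = {}" "X1 \<inter> X2 = {}" "X1 \<inter> Y2 = {}" "X1 \<inter> Z = {}" "Y1 \<inter> X2 = {}"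
      "Y1 \<inter> Y2 = {}" "Y1 \<inter> Z = {}" "X2 \<inter> Y2 = {}" "X2 \<inter> Z = {}" "Y2 \<inter> Z = {}"
    and "clique G X1" "clique G Y1" "clique G X2" "clique G Y2" "clique G Z"
    and "\<forall>u\<in>X1. \<forall>v\<in>Y1. \<not> adj G u v" "\<forall>u\<in>X2. \<forall>v\<in>Y2. \<not> adj G u v"
    and "\<forall>u\<in>X1 \<union> Y1. \<forall>v\<in>X2 \<union> Y2 \<union> Z. adj G u v" "\<forall>u\<in>X2 \<union> Y2. \<forall>v\<in>Z. adj G u v"
  shows "in_K2 G"
proof -
  have five: "{..<5::nat} = {0, 1, 2, 3, 4}" "(\<forall>i<5::nat. Q i) \<longleftrightarrow> Q 0 \<and> Q 1 \<and> Q 2 \<and> Q 3 \<and> Q 4" for Q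
    by (auto simp: numeral_eq_Suc less_Suc_eq)
  show ?thesis
    unfolding in_K2_def Let_def
  proof (rule conjI[OF assms(1)], rule exI[of _ X1], rule exI[of _ Y1], rule exI[of _ X2],
      rule exI[of _ Y2], rule exI[of _ Z], intro conjI)
    show "disjoint_family_on ((!) [X1, Y1, X2, Y2, Z]) {..<5}"
      unfolding disjoint_family_on_def five using assms(3-12) by (simp add: Int_commute)
    show "verts G = (\<Union>i<5. [X1, Y1, X2, Y2, Z] ! i)" using assms(2) unfolding five by auto
    show "\<forall>i<5. clique G ([X1, Y1, X2, Y2, Z] ! i)" using assms(13-17) unfolding five by simp
    show "\<forall>i<5. \<forall>j<5. i \<noteq> j \<longrightarrow> (\<forall>u\<in>[X1, Y1, X2, Y2, Z] ! i. \<forall>v\<in>[X1, Y1, X2, Y2, Z] ! j.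
        ({u, v} \<notin> edges G) = (\<exists>(X, Y)\<in>{(X1, Y1), (X2, Y2)}. u \<in> X \<and> v \<in> Y \<or> u \<in> Y \<and> v \<in> X))"
      (is "\<forall>i<5. \<forall>j<5. i \<noteq> j \<longrightarrow> (\<forall>u\<in>?P i. \<forall>v\<in>?P j. ?Q u v)")
    proof (intro allI impI ballI)
      fix i j :: nat and u v
      assume ij: "i < 5" "j < 5" "i \<noteq> j" and uv: "u \<in> ?P i" "v \<in> ?P j"
      have ordered: "?Q u v" if "i < j" "j < 5" "u \<in> ?P i" "v \<in> ?P j" for i j u v
      proof -
        have "i = 0 \<and> j = 1 \<or> i = 0 \<and> j = 2 \<or> i = 0 \<and> j = 3 \<or> i = 0 \<and> j = 4 \<or> i = 1 \<and> j = 2 \<or>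
          i = 1 \<and> j = 3 \<or> i = 1 \<and> j = 4 \<or> i = 2 \<and> j = 3 \<or> i = 2 \<and> j = 4 \<or> i = 3 \<and> j = 4"
          using that(1,2) by presburger
        then show ?thesis
          using that(3,4) assms(18-21)
          by (elim disjE conjE; use assms(3-12,18-21) in \<open>simp add: disjoint_iff\<close>; auto)
      qed
      have swap: "?Q u v \<longleftrightarrow> ?Q v u" by (auto simp: insert_commute)
      consider "i < j" | "j < i" using ij(3) by linarith
      then show "?Q u v"
      proof cases
        case 1
        then show ?thesis by (rule ordered[OF _ ij(2) uv])
      next
        case 2
        then show ?thesis unfolding swap by (rule ordered[OF _ ij(1) uv(2,1)])
      qed
    qed
  qed
qed

section \<open>Obstruction-free graphs with a non-clique separator\<close>

locale obstruction_free_graph =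
  fixes G :: "'a ugraph"
  assumes simple: "simple_graph G" and free: "obstruction_free G"
begin

lemma no_hole: "\<forall>n\<ge>5. \<not> contains_induced G (cycle_graph n)"
  and no_D1: "\<not> contains_induced G D1" and no_D2: "\<not> contains_induced G D2"
  and no_D3: "\<not> contains_induced G D3" and no_D4: "\<not> contains_induced G D4"
  and no_D5: "\<not> contains_induced G D5" and no_D6: "\<not> contains_induced G D6"
  and no_C5: "\<not> contains_induced G (cycle_graph 5)"
  using free by (auto simp: obstruction_free_def)

lemma adj_or_nadj: "u \<in> verts G \<Longrightarrow> v \<in> verts G \<Longrightarrow> u \<noteq> v \<Longrightarrow> \<not> adj G u v \<Longrightarrow> nadj G u v"
  by (simp add: nadj_def)

end

text \<open>
  The situation after choosing \<open>B\<close> as large as possible: the vertices of \<open>T\<close> are adjacent to all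
  of \<open>A\<close>, and each of them has a neighbour in \<open>B\<close>. For a non-clique \<open>T\<close> it is shown that the graph is
  basic or has some other clique separator.
\<close>

locale full_separation = obstruction_free_graph +
  fixes A B T :: "'a set"
  assumes partition: "verts G = A \<union> B \<union> T" "A \<inter> B = {}" "A \<inter> T = {}" "B \<inter> T = {}"
    and A_nonempty: "A \<noteq> {}" and B_nonempty: "B \<noteq> {}" and B_connected: "connected_on G B"
    and AB: "\<And>a b. a \<in> A \<Longrightarrow> b \<in> B \<Longrightarrow> nadj G a b"
    and AT: "\<And>a t. a \<in> A \<Longrightarrow> t \<in> T \<Longrightarrow> adj G a t"
    and BT: "\<And>t. t \<in> T \<Longrightarrow> \<exists>b\<in>B. adj G t b"
    and T_not_clique: "\<not> clique G T"
begin

text \<open>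
  Any vertex of \<open>A\<close> serves as the tip that closes cycles through \<open>B\<close> and that is missed by
  all of \<open>B\<close>.
\<close>

definition apex where "apex = (SOME x. x \<in> A)"

lemma apex: "apex \<in> A" using A_nonempty by (auto simp: apex_def intro: someI)

lemma apex_T: "t \<in> T \<Longrightarrow> adj G apex t" and apex_B: "b \<in> B \<Longrightarrow> nadj G apex b"
  using apex AT AB by auto

lemma B_nadj: "b \<in> B \<Longrightarrow> b' \<in> B \<Longrightarrow> b \<noteq> b' \<Longrightarrow> \<not> adj G b b' \<Longrightarrow> nadj G b b'"
  and BT_nadj: "b \<in> B \<Longrightarrow> t \<in> T \<Longrightarrow> \<not> adj G b t \<Longrightarrow> nadj G b t"
  using partition by (auto simp: nadj_def)

lemmas pair_sym = nadj_commute insert_commute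

text \<open>
  Otherwise a shortest connection through \<open>B\<close> forms a long hole with a vertex of \<open>A\<close>.
\<close>

lemma common_neighbour:
  assumes "s \<in> T" "t \<in> T" "nadj G s t"
  shows "\<exists>b\<in>B. adj G b s \<and> adj G b t"
proof -
  obtain u v where uv: "u \<in> B" "adj G s u" "v \<in> B" "adj G t v" using assms BT by blast
  have "\<exists>r\<in>B. adj G s r \<and> adj G t r"
    by (rule common_neighbour_or_hole[OF simple B_connected no_hole assms(3) apex_T apex_T _ _ _ uv])
      (use assms apex apex_B partition in \<open>auto simp: nadj_def\<close>)
  then show ?thesis by (simp add: insert_commute)
qed

lemma co_edge_with_common_neighbour: "\<exists>s t b. s \<in> T \<and> t \<in> T \<and> nadj G s t \<and> b \<in> B \<and> adj G b s \<and> adj G b t"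
proof -
  obtain s t where "s \<in> T" "t \<in> T" "nadj G s t"
    using T_not_clique partition(1) by (auto simp: clique_def nadj_def)
  then show ?thesis using common_neighbour by blast
qed

text \<open>
  Two non-adjacent vertices of \<open>A\<close> together with a common neighbour in \<open>B\<close> form a co-triangle
  that is completely joined to a co-edge of \<open>T\<close>.
\<close>

lemma clique_A: "clique G A"
proof -
  obtain s t b where st: "s \<in> T" "t \<in> T" "nadj G s t" "b \<in> B" "adj G b s" "adj G b t"
    using co_edge_with_common_neighbour by blast
  have "adj G u v" if "u \<in> A" "v \<in> A" "u \<noteq> v" for u v
  proof (rule ccontr)
    assume "\<not> adj G u v"
    then have "nadj G u v" using that partition by (intro adj_or_nadj) auto
    then show False
      using contains_D4I[OF simple, of u v b s t] no_D4 st AT AB that by simp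
  qed
  then show ?thesis using partition by (auto simp: clique_def)
qed

text \<open>
  A common neighbour of two vertices of a co-triangle misses the third, for otherwise it
  forms with the apex a co-edge beside the triangle. Three such neighbours yield a hole of length 5
  through the apex if two of them are adjacent, and a hole of length 6 otherwise.
\<close>

lemma co_triangle_free:
  assumes T: "s \<in> T" "t \<in> T" "u \<in> T" and n: "nadj G s t" "nadj G t u" "nadj G s u"
  shows False
proof -
  have key: "\<exists>b\<in>B. adj G b s \<and> adj G b t \<and> nadj G b u"
    if stu: "s \<in> T" "t \<in> T" "u \<in> T" "nadj G s t" "nadj G t u" "nadj G s u" for s t u
  proof -
    obtain b where b: "b \<in> B" "adj G b s" "adj G b t" using common_neighbour[OF stu(1,2,4)] by blast
    have "\<not> adj G b u"
      using contains_D4I[OF simple, of s t u apex b] no_D4 stu apex_T apex_B b by (auto simp: pair_sym)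
    moreover have "b \<noteq> u" using b stu partition by auto
    ultimately show ?thesis using b stu partition adj_or_nadj[of b u] by auto
  qed
  obtain b1 where b1: "b1 \<in> B" "adj G b1 s" "adj G b1 t" "nadj G b1 u" using key[OF T n] by blast
  obtain b2 where b2: "b2 \<in> B" "adj G b2 t" "adj G b2 u" "nadj G b2 s"
    using key[of t u s] T n by (auto simp: pair_sym)
  obtain b3 where b3: "b3 \<in> B" "adj G b3 s" "adj G b3 u" "nadj G b3 t"
    using key[of s u t] T n by (auto simp: pair_sym)
  have ne: "b1 \<noteq> b2" "b2 \<noteq> b3" "b1 \<noteq> b3" using b1 b2 b3 by (auto simp: nadj_def)
  have c5: False if "b \<in> B" "b' \<in> B" "x \<in> T" "y \<in> T" "adj G b x" "adj G b' y" "nadj G b y" "nadj G b' x"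
    "nadj G x y" "adj G b b'" for b b' x y
    using contains_C5I[OF simple, of x b b' y apex] no_C5 that apex_T apex_B by (simp add: pair_sym)
  have n12: "nadj G b1 b2"
    using c5[of b1 b2 s u] b1 b2 T n ne partition adj_or_nadj[of b1 b2] by auto
  have n23: "nadj G b2 b3"
    using c5[of b2 b3 t s] b2 b3 T n ne partition adj_or_nadj[of b2 b3] by (auto simp: pair_sym)
  have n13: "nadj G b1 b3"
    using c5[of b1 b3 t u] b1 b3 T n ne partition adj_or_nadj[of b1 b3] by (auto simp: pair_sym)
  have "contains_induced G (cycle_graph 6)"
    using contains_C6I[OF simple, of s b1 t b2 u b3] b1 b2 b3 n12 n23 n13 n by (simp add: pair_sym)
  then show False using no_hole by simp
qed

text \<open>
  Let \<open>b\<close> be adjacent to \<open>s\<close> and \<open>t\<close> only and \<open>b'\<close> to \<open>t\<close> and \<open>u\<close> only. If \<open>b\<close> and \<open>b'\<close> are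
  adjacent, the apex closes a co-cycle of length 6, otherwise there is a hole of length 5.
\<close>

lemma co_P3_common_neighbour:
  assumes T: "s \<in> T" "t \<in> T" "u \<in> T" and n: "nadj G s t" "nadj G t u" "s \<noteq> u"
  shows "adj G s u" "\<exists>b\<in>B. adj G b s \<and> adj G b t \<and> adj G b u"
proof -
  show su: "adj G s u"
    using co_triangle_free[OF T n(1,2)] n(3) T partition(1) adj_or_nadj[of s u] by auto
  show "\<exists>b\<in>B. adj G b s \<and> adj G b t \<and> adj G b u"
  proof (rule ccontr)
    assume no: "\<not> ?thesis"
    obtain b where b: "b \<in> B" "adj G b s" "adj G b t" using common_neighbour[OF T(1,2) n(1)] by blast
    obtain b' where b': "b' \<in> B" "adj G b' t" "adj G b' u" using common_neighbour[OF T(2,3) n(2)] by blast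
    have nb: "nadj G b u" "nadj G b' s"
      using no b b' T BT_nadj by blast+
    show False
    proof (cases "adj G b b'")
      case True
      then show False
        using contains_D2I[OF simple, of t s b' apex b u] no_D2 b b' nb apex_T apex_B T n su by (simp add: pair_sym)
    next
      case False
      then have "nadj G b b'" using B_nadj[OF b(1) b'(1)] b b' nb by (auto simp: nadj_def)
      then show False
        using contains_C5I[OF simple, of s b t b' u] no_C5 b b' nb T n su by (simp add: pair_sym)
    qed
  qed
qed

text \<open>
  Common neighbours of the first three and of the last three vertices cannot be adjacent to
  the fourth one because of \<open>D3\<close>. They lie on a co-path on six vertices if they are adjacent, and on a
  co-triangle with the apex if not.
\<close>

lemma co_P4_free:
  assumes T: "p \<in> T" "q \<in> T" "r \<in> T" "s \<in> T"
    and n: "nadj G p q" "nadj G q r" "nadj G r s" and e: "adj G p r" "adj G q s" "adj G p s"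
  shows False
proof -
  have ne: "p \<noteq> r" "q \<noteq> s" using e simple_graph_adjD(3)[OF simple] by auto
  obtain b where b: "b \<in> B" "adj G b p" "adj G b q" "adj G b r"
    using co_P3_common_neighbour(2)[OF T(1-3) n(1,2) ne(1)] by blast
  obtain b' where b': "b' \<in> B" "adj G b' q" "adj G b' r" "adj G b' s"
    using co_P3_common_neighbour(2)[OF T(2-4) n(2,3) ne(2)] by blast
  have "\<not> adj G b s"
    using contains_D3I[OF simple, of p q r s apex b] no_D3 b apex_T apex_B T n e by (auto simp: pair_sym)
  moreover have "\<not> adj G b' p"
    using contains_D3I[OF simple, of p q r s apex b'] no_D3 b' apex_T apex_B T n e by (auto simp: pair_sym)
  ultimately have nb: "nadj G b s" "nadj G b' p"
    using b b' T BT_nadj by blast+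
  show False
  proof (cases "adj G b b'")
    case True
    then show False
      using contains_D1I[OF simple, of b s r q p b'] no_D1 b b' nb T n e by (simp add: pair_sym)
  next
    case False
    then have "nadj G b b'" using B_nadj[OF b(1) b'(1)] b b' nb by (auto simp: nadj_def)
    then show False
      using contains_D4I[OF simple, of apex b b' q r] no_D4 b b' apex_T apex_B T n by (simp add: pair_sym)
  qed
qed

text \<open>
  If \<open>b\<close> misses \<open>p\<close>, then the co-path from the apex over \<open>b\<close> and \<open>p\<close> to \<open>q\<close>, or the
  co-triangle \<open>b, p, q\<close>, lies beside the co-edge of \<open>s\<close> and \<open>t\<close>.
\<close>

lemma neighbour_of_other_co_edge:
  assumes T: "s \<in> T" "t \<in> T" "p \<in> T" "q \<in> T" and n: "nadj G s t" "nadj G p q"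
    and e: "adj G s p" "adj G s q" "adj G t p" "adj G t q"
    and b: "b \<in> B" "adj G b s" "adj G b t"
  shows "adj G b p"
proof (rule ccontr)
  assume "\<not> adj G b p"
  then have bp: "nadj G b p" using b T partition by (intro adj_or_nadj) auto
  show False
  proof (cases "adj G b q")
    case True
    then show False
      using contains_D3I[OF simple, of apex b p q s t] no_D3 b bp apex_T apex_B T n e by (simp add: pair_sym)
  next
    case False
    then have "nadj G b q" using b T partition by (intro adj_or_nadj) auto
    then show False
      using contains_D4I[OF simple, of b p q s t] no_D4 b bp T n e by (simp add: pair_sym)
  qed
qed

text \<open>
  Compare \<open>b\<close> with a vertex \<open>b'\<close> that is adjacent to all of \<open>s, t, u\<close>. With the apex
  they give the co-path \<open>s, t, u, b, apex, b'\<close> or the co-triangle \<open>apex, b, b'\<close> beside a co-edge.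
\<close>

lemma neighbour_of_incident_co_edge:
  assumes T: "s \<in> T" "t \<in> T" "u \<in> T" and n: "nadj G s t" "nadj G t u"
    and b: "b \<in> B" "adj G b s" "adj G b t"
  shows "adj G b u"
proof (rule ccontr)
  assume bu: "\<not> adj G b u"
  then have su: "s \<noteq> u" using b by auto
  have bu: "nadj G b u" using bu b T partition by (intro adj_or_nadj) auto
  note P3 = co_P3_common_neighbour[OF T n su]
  obtain b' where b': "b' \<in> B" "adj G b' s" "adj G b' t" "adj G b' u" using P3(2) by blast
  show False
  proof (cases "adj G b b'")
    case True
    then show False
      using contains_D1I[OF simple, of s t u b apex b'] no_D1 b b' bu apex_T apex_B T n P3(1) by (simp add: pair_sym)
  next
    case False
    then have "nadj G b b'" using B_nadj[OF b(1) b'(1)] b b' bu by (auto simp: nadj_def)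
    then show False
      using contains_D4I[OF simple, of apex b b' s t] no_D4 b b' apex_T apex_B T n by (simp add: pair_sym)
  qed
qed

text \<open>
  The core is the union of the non-trivial components of the complement of the graph on \<open>T\<close>.
  The hub turns out to be the part of \<open>B\<close> that is joined to all of it.
\<close>

definition core where "core = {s \<in> T. \<exists>t\<in>T. nadj G s t}"
definition hub where "hub = {b \<in> B. \<exists>s\<in>T. \<exists>t\<in>T. nadj G s t \<and> adj G b s \<and> adj G b t}"

text \<open>
  Any two co-edges of \<open>T\<close> share a vertex, are linked by a third co-edge, or are completely joined
  to each other, so adjacency to both ends of one co-edge spreads to the whole core by the two
  preceding lemmas.
\<close>

lemma hub_core:
  assumes "b \<in> hub" "p \<in> core"
  shows "adj G b p"
proof -
  obtain s t where b: "b \<in> B" "adj G b s" "adj G b t" and st: "s \<in> T" "t \<in> T" "nadj G s t"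
    using assms(1) by (auto simp: hub_def)
  obtain q where pq: "p \<in> T" "q \<in> T" "nadj G p q" using assms(2) by (auto simp: core_def)
  have st': "nadj G t s" "nadj G q p" using st pq by (auto simp: pair_sym)
  have V: "T \<subseteq> verts G" using partition by auto
  have far: "adj G b x" if "x \<in> T" "nadj G s x \<or> nadj G t x" for x
    using neighbour_of_incident_co_edge[OF st(2,1) that(1) st'(1) _ b(1,3,2)]
      neighbour_of_incident_co_edge[OF st(1,2) that(1) st(3) _ b] that(2) by blast
  have far2: "adj G b p" if "x \<in> T" "nadj G x q" "adj G b x" "adj G b q" for x
    using neighbour_of_incident_co_edge[OF that(1) pq(2,1) that(2) st'(2) b(1) that(3,4)] .
  show ?thesis
  proof (cases "nadj G s p \<or> nadj G t p \<or> p = s \<or> p = t")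
    case True
    then show ?thesis using far pq b by auto
  next
    case False
    then have e: "adj G s p" "adj G t p" using V st pq by (auto simp: nadj_def)
    show ?thesis
    proof (cases "nadj G s q \<or> nadj G t q \<or> q = s \<or> q = t")
      case True
      then have "nadj G s q \<or> nadj G t q" using e pq(3) by (auto simp: nadj_def insert_commute)
      then show ?thesis using far2[of s] far2[of t] far[OF pq(2)] st b by blast
    next
      case False
      then have "adj G s q" "adj G t q" using V st pq by (auto simp: nadj_def)
      then show ?thesis using neighbour_of_other_co_edge[OF st(1,2) pq(1,2) st(3) pq(3)] e b by blast
    qed
  qed
qed

lemma hub_clique: "clique G hub"
proof -
  have "adj G b b'" if b: "b \<in> hub" "b' \<in> hub" "b \<noteq> b'" for b b'
  proof (rule ccontr)
    assume "\<not> adj G b b'"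
    then have n: "nadj G b b'" using b partition by (intro adj_or_nadj) (auto simp: hub_def)
    obtain s t where st: "s \<in> T" "t \<in> T" "nadj G s t" using co_edge_with_common_neighbour by blast
    then have "s \<in> core" "t \<in> core" by (auto simp: core_def nadj_commute)
    then have "adj G b s" "adj G b t" "adj G b' s" "adj G b' t" using hub_core b by auto
    moreover have "b \<in> B" "b' \<in> B" using b by (auto simp: hub_def)
    ultimately show False
      using contains_D4I[OF simple, of apex b b' s t] no_D4 n apex_T apex_B st by simp
  qed
  then show ?thesis using partition by (auto simp: clique_def hub_def)
qed

text \<open>
  The separator is the neighbourhood \<open>K\<close> of a component \<open>C\<close> of \<open>B - hub\<close>. Inside \<open>T\<close> it is a clique
  since a common neighbour in \<open>C\<close> of a co-edge would belong to the hub; a vertex of \<open>T\<close> outside the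
  core that misses a hub vertex leads to a hole, to \<open>D1\<close> or to \<open>D4\<close>.
\<close>

lemma separable_if_not_hub:
  assumes "r0 \<in> B - hub"
  shows "clique_separable G"
proof -
  obtain C where C: "C \<subseteq> B - hub" "r0 \<in> C" "connected_on G C"
    "\<And>x y. x \<in> C \<Longrightarrow> y \<in> B - hub - C \<Longrightarrow> \<not> adj G x y"
    using component_exists[OF assms, of G] by blast
  define K where "K = {u \<in> verts G - C. \<exists>r\<in>C. adj G u r}"
  have CV: "C \<subseteq> verts G" using C(1) partition by auto
  have K: "K \<subseteq> T \<union> hub"
  proof
    fix u assume "u \<in> K"
    then obtain r where u: "u \<in> verts G" "u \<notin> C" "r \<in> C" "adj G u r" by (auto simp: K_def)
    have "u \<notin> A" using AB[of u r] u C(1) by (auto simp: nadj_def)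
    moreover have "u \<notin> B - hub" using C(4)[of r u] u by (auto simp: insert_commute)
    ultimately show "u \<in> T \<union> hub" using u partition by auto
  qed
  have KT: "adj G u v" if uv: "u \<in> K" "v \<in> K" "u \<in> T" "v \<in> T" "u \<noteq> v" for u v
  proof (rule ccontr)
    assume "\<not> adj G u v"
    then have n: "nadj G u v" using uv partition by (intro adj_or_nadj) auto
    obtain x y where xy: "x \<in> C" "adj G u x" "y \<in> C" "adj G v y" using uv by (auto simp: K_def)
    have "\<exists>r\<in>C. adj G u r \<and> adj G v r"
      by (rule common_neighbour_or_hole[OF simple C(3) no_hole n apex_T[OF uv(3)] apex_T[OF uv(4)] _ _ CV xy])
        (use apex apex_B C(1) partition in \<open>auto simp: nadj_def\<close>)
    then obtain r where "r \<in> C" "adj G u r" "adj G v r" by blast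
    then have "adj G r u" "adj G r v" by (simp_all add: insert_commute)
    then have "r \<in> hub" unfolding hub_def using \<open>r \<in> C\<close> n uv(3,4) C(1) by blast
    then show False using \<open>r \<in> C\<close> C(1) by auto
  qed
  have KTh: "adj G z b" if z: "z \<in> K" "z \<in> T" and b: "b \<in> K" "b \<in> hub" for z b
  proof (rule ccontr)
    assume "\<not> adj G z b"
    have bB: "b \<in> B" using b by (auto simp: hub_def)
    then have zb: "nadj G z b" using \<open>\<not> adj G z b\<close> z b partition by (intro adj_or_nadj) auto
    have zcore: "z \<notin> core" using hub_core b zb by (auto simp: nadj_def insert_commute)
    \<comment> \<open>\<open>x\<close> takes the part of the apex: it is adjacent to \<open>z\<close> and \<open>b\<close> and has no neighbour in \<open>C\<close>.\<close>
    obtain x y where xy: "x \<in> T" "y \<in> T" "nadj G x y" "x \<notin> K"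
    proof -
      obtain s t where st: "s \<in> T" "t \<in> T" "nadj G s t" using co_edge_with_common_neighbour by blast
      then have "s \<notin> K \<or> t \<notin> K" using KT[of s t] by (auto simp: nadj_def)
      then show thesis using that[of s t] that[of t s] st by (auto simp: nadj_commute)
    qed
    have xycore: "x \<in> core" "y \<in> core" using xy by (auto simp: core_def nadj_commute)
    have zxy: "adj G x z" "adj G y z"
      using zcore xycore xy z partition adj_or_nadj[of z x] adj_or_nadj[of z y]
      by (auto simp: core_def insert_commute)
    have bxy: "adj G b x" "adj G b y" using hub_core b xycore by auto
    obtain p q where pq: "p \<in> C" "adj G z p" "q \<in> C" "adj G b q" using z b by (auto simp: K_def)
    have xC: "x \<notin> C" using xy C(1) partition by auto
    have "\<exists>r\<in>C. adj G z r \<and> adj G b r"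
      by (rule common_neighbour_or_hole[OF simple C(3) no_hole zb zxy(1) _ _ xC CV pq])
        (use xy xC partition bxy in \<open>auto simp: K_def insert_commute\<close>)
    then obtain r where r: "r \<in> C" "adj G z r" "adj G b r" by blast
    have rB: "r \<in> B" using r C(1) by auto
    have rx: "nadj G r x"
      using xy(1,4) r(1) rB xC partition by (intro adj_or_nadj) (auto simp: K_def insert_commute)
    show False
    proof (cases "adj G r y")
      case True
      then show False
        using contains_D1I[OF simple, of y x r apex b z] no_D1 rx r zxy bxy xy zb rB bB apex_T apex_B z
        by (simp add: pair_sym)
    next
      case False
      then have "nadj G r y" using rB xy partition by (intro adj_or_nadj) auto
      then show False
        using contains_D4I[OF simple, of r x y z b] no_D4 rx r zxy bxy xy zb by (simp add: pair_sym)
    qed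
  qed
  have "adj G u v" if "u \<in> K" "v \<in> K" "u \<noteq> v" for u v
  proof -
    have "u \<in> T \<or> u \<in> hub" "v \<in> T \<or> v \<in> hub" using that K by auto
    then show ?thesis
      using KT[of u v] KTh[of u v] KTh[of v u] hub_clique that by (auto simp: clique_def insert_commute)
  qed
  then have "clique G K" by (auto simp: clique_def K_def)
  moreover have "(C \<union> K) \<inter> (verts G - C) = K" by (auto simp: K_def)
  moreover have "C \<union> K \<union> (verts G - C) = verts G" using CV by (auto simp: K_def)
  moreover have "C \<union> K \<noteq> verts G"
  proof -
    have "apex \<notin> C \<union> K" using apex C(1) K partition by (auto simp: hub_def)
    then show ?thesis using apex partition by auto
  qed
  moreover have "verts G - C \<noteq> verts G" using CV C(2) by auto
  moreover have "\<forall>u\<in>C \<union> K - (verts G - C). \<forall>v\<in>verts G - C - (C \<union> K). \<not> adj G u v"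
  proof (intro ballI)
    fix u v assume "u \<in> C \<union> K - (verts G - C)" "v \<in> verts G - C - (C \<union> K)"
    then have "u \<in> C" "v \<in> verts G" "v \<notin> C" "v \<notin> K" using CV by (auto simp: K_def)
    then have "\<not> adj G v u" by (auto simp: K_def)
    then show "\<not> adj G u v" by (simp add: insert_commute)
  qed
  ultimately show ?thesis unfolding clique_separable_def by metis
qed

lemma T_nadj: "s \<in> T \<Longrightarrow> t \<in> T \<Longrightarrow> s \<noteq> t \<Longrightarrow> \<not> adj G s t \<Longrightarrow> nadj G s t"
  using partition by (auto simp: nadj_def)

lemma noncore_adj:
  assumes "z \<in> T - core" "t \<in> T" "z \<noteq> t"
  shows "adj G z t"
  using assms T_nadj[of z t] by (auto simp: core_def)

text \<open>
  With the apex and a vertex of the hub as a third component this is \<open>D5\<close>; the additional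
  vertex \<open>u\<close> is joined to the second co-edge because \<open>T\<close> contains no co-path on four vertices.
\<close>

lemma no_co_P3_beside_co_edge:
  assumes hub: "B \<subseteq> hub" and T: "s \<in> T" "t \<in> T" "p \<in> T" "q \<in> T" "u \<in> T"
    and n: "nadj G s t" "nadj G p q" "nadj G s u" and ut: "u \<noteq> t"
    and e: "adj G s p" "adj G s q" "adj G t p" "adj G t q"
  shows False
proof -
  obtain b where b: "b \<in> B" using B_nonempty by auto
  have core: "s \<in> core" "t \<in> core" "p \<in> core" "q \<in> core" "u \<in> core"
    using T n by (auto simp: core_def nadj_commute)
  then have bc: "adj G b s" "adj G b t" "adj G b p" "adj G b q" "adj G b u"
    using hub_core hub b by auto
  have n': "nadj G t s" "nadj G u s" using n by (auto simp: nadj_commute)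
  have tu: "adj G t u" using co_P3_common_neighbour(1)[OF T(2,1,5) n'(1) n(3)] ut by simp
  have up: "adj G u p"
  proof (rule ccontr)
    assume "\<not> adj G u p"
    moreover have "u \<noteq> p" using n(3) e(1) by (auto simp: nadj_def)
    ultimately have "nadj G u p" using T T_nadj by auto
    then show False using co_P4_free[OF T(2,1,5,3) n'(1) n(3)] tu e by auto
  qed
  have uq: "adj G u q"
  proof (rule ccontr)
    assume "\<not> adj G u q"
    moreover have "u \<noteq> q" using n(3) e(2) by (auto simp: nadj_def)
    ultimately have "nadj G u q" using T T_nadj by auto
    then show False using co_P4_free[OF T(2,1,5,4) n'(1) n(3)] tu e by auto
  qed
  show False
    using contains_D5I[OF simple, of t s u p q apex b] no_D5 n e tu up uq bc apex_T apex_B b T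
    by (simp add: pair_sym)
qed

text \<open>
  A further co-edge in \<open>T\<close> would be disjoint from the two given ones and joined to them, and
  the apex and a hub vertex form the fourth pair of \<open>D6\<close>.
\<close>

lemma core_eq_if_two_co_edges:
  assumes hub: "B \<subseteq> hub" and T: "s \<in> T" "t \<in> T" "p \<in> T" "q \<in> T"
    and n: "nadj G s t" "nadj G p q"
    and e: "adj G s p" "adj G s q" "adj G t p" "adj G t q"
  shows "core = {s, t, p, q}"
proof
  show "{s, t, p, q} \<subseteq> core" using T n by (auto simp: core_def nadj_commute)
  have away: "adj G u s \<and> adj G u t \<and> adj G u p \<and> adj G u q"
    if "u \<in> T" "u \<notin> {s, t, p, q}" for u
    using no_co_P3_beside_co_edge[OF hub T that(1) n]
      no_co_P3_beside_co_edge[OF hub T(2,1,3,4) that(1), of]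
      no_co_P3_beside_co_edge[OF hub T(3,4,1,2) that(1), of]
      no_co_P3_beside_co_edge[OF hub T(4,3,1,2) that(1), of]
      T_nadj[of u s] T_nadj[of u t] T_nadj[of u p] T_nadj[of u q] that T n e
    by (simp add: pair_sym) blast
  show "core \<subseteq> {s, t, p, q}"
  proof
    fix u assume "u \<in> core"
    then obtain v where uv: "u \<in> T" "v \<in> T" "nadj G u v" by (auto simp: core_def)
    show "u \<in> {s, t, p, q}"
    proof (rule ccontr)
      assume u: "u \<notin> {s, t, p, q}"
      note au = away[OF uv(1) u]
      then have v: "v \<notin> {s, t, p, q}" using uv(3) by (auto simp: nadj_def)
      note av = away[OF uv(2) v]
      obtain b where b: "b \<in> B" using B_nonempty by auto
      have core: "x \<in> core" if "x \<in> {s, t, p, q, u, v}" for x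
        using that T n uv by (auto simp: core_def nadj_commute)
      have "adj G b s" "adj G b t" "adj G b p" "adj G b q" "adj G b u" "adj G b v"
        using hub_core core hub b by auto
      then show False
        using contains_D6I[OF simple, of s t p q u v apex b] no_D6 n e uv au av apex_T apex_B b T
        by (simp add: pair_sym)
    qed
  qed
qed

text \<open>
  The two co-edges leave no room for a co-path on three vertices beside them, by \<open>D5\<close>. This
  reduces \<open>A\<close> and \<open>B\<close> to single vertices and joins \<open>B\<close> to the rest of \<open>T\<close>.
\<close>

lemma in_K3_if_two_co_edges:
  assumes hub: "B \<subseteq> hub" and T: "s \<in> T" "t \<in> T" "p \<in> T" "q \<in> T"
    and n: "nadj G s t" "nadj G p q"
    and e: "adj G s p" "adj G s q" "adj G t p" "adj G t q"
  shows "in_K3 G"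
proof -
  note core = core_eq_if_two_co_edges[OF assms]
  have bc: "adj G b x" if "b \<in> B" "x \<in> {s, t, p, q}" for b x
    using hub_core hub that core by auto
  have no_P3: False if "x \<in> A \<union> B \<union> (T - core)" "y \<in> A \<union> B" "z \<in> A \<union> B" "nadj G x y" "nadj G y z"
    "adj G x z" for x y z
  proof -
    have "adj G x w" "adj G y w" "adj G z w" if "w \<in> {s, t, p, q}" for w
      using that \<open>x \<in> _\<close> \<open>y \<in> _\<close> \<open>z \<in> _\<close> bc AT[of _ w] T noncore_adj[of x w] core by auto
    then show False
      using contains_D5I[OF simple, of x y z s t p q] no_D5 n e that by (simp add: pair_sym)
  qed
  obtain b where b: "b \<in> B" using B_nonempty by auto
  have A1: "A = {apex}"
  proof -
    have "a' = apex" if a': "a' \<in> A" for a'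
    proof (rule ccontr)
      assume "a' \<noteq> apex"
      then have "adj G a' apex" using clique_A a' apex by (auto simp: clique_def)
      then show False using no_P3[of a' b apex] AB[OF a' b] AB[OF apex b] apex a' b by (simp add: nadj_commute)
    qed
    then show ?thesis using apex by blast
  qed
  have clB: "clique G B" using hub_clique hub by (auto simp: clique_def)
  have B1: "B = {b}"
  proof -
    have "b' = b" if b': "b' \<in> B" for b'
    proof (rule ccontr)
      assume "b' \<noteq> b"
      then have "adj G b' b" using clB b' b by (auto simp: clique_def)
      then show False using no_P3[of b' apex b] AB[OF apex b] AB[OF apex b'] apex b' b by (simp add: nadj_commute)
    qed
    then show ?thesis using b by blast
  qed
  define Z where "Z = T - core"
  have bZ: "adj G z b" if "z \<in> Z" for z
  proof (rule ccontr)
    assume "\<not> adj G z b"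
    then have "nadj G z b" using BT_nadj[OF b, of z] that by (auto simp: Z_def pair_sym)
    then show False
      using no_P3[of z b apex] that apex_B[OF b] apex b apex_T[of z] by (auto simp: Z_def pair_sym)
  qed
  have clZ: "clique G Z" using noncore_adj partition by (auto simp: clique_def Z_def)
  have Zc: "adj G z w" if "z \<in> Z" "w \<in> {s, t, p, q}" for z w
    using noncore_adj[of z w] that core T by (auto simp: Z_def)
  have V: "verts G = {apex, b, s, t, p, q} \<union> Z" using partition(1) A1 B1 core T by (auto simp: Z_def)
  have ab: "nadj G apex b" using apex_B b by auto
  have dist: "distinct [apex, b, s, t, p, q]" "{apex, b, s, t, p, q} \<inter> Z = {}"
    using ab n e simple_graph_adjD(3)[OF simple] partition(2-4) A1 B1 T core
    by (auto simp: Z_def nadj_def)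
  have "{u, v} \<notin> edges G \<longleftrightarrow> {u, v} \<in> {{apex, b}, {s, t}, {p, q}}"
    if uv: "u \<in> verts G" "v \<in> verts G" "u \<noteq> v" for u v
  proof -
    have aw: "adj G apex w" "adj G w apex" if "w \<in> {s, t, p, q} \<union> Z" for w
      using that apex_T[of w] T by (auto simp: Z_def insert_commute)
    have bw: "adj G b w" "adj G w b" if "w \<in> {s, t, p, q} \<union> Z" for w
      using that bc[OF b, of w] bZ[of w] by (auto simp: insert_commute)
    have Zw: "adj G w z" "adj G z w" if "z \<in> Z" "w \<in> {s, t, p, q}" for z w
      using Zc[OF that] by (auto simp: insert_commute)
    have ZZ: "adj G z w" if "z \<in> Z" "w \<in> Z" "z \<noteq> w" for z w
      using clZ that by (auto simp: clique_def)
    have e': "adj G p s" "adj G q s" "adj G p t" "adj G q t" using e by (auto simp: insert_commute)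
    have n': "{apex, b} \<notin> edges G" "{b, apex} \<notin> edges G" "{s, t} \<notin> edges G" "{t, s} \<notin> edges G"
      "{p, q} \<notin> edges G" "{q, p} \<notin> edges G"
      using n ab by (auto simp: nadj_def insert_commute)
    have toZ: "{u, v} \<notin> edges G \<longleftrightarrow> {u, v} \<in> {{apex, b}, {s, t}, {p, q}}"
      if "u \<in> verts G" "v \<in> Z" "u \<noteq> v" for u v
    proof -
      have "adj G u v" using that V ZZ[of u v] Zw[of v u] aw[of v] bw[of v] by auto
      moreover have "{u, v} \<notin> {{apex, b}, {s, t}, {p, q}}"
        using dist(2) that(2) by (auto simp: doubleton_eq_iff)
      ultimately show ?thesis by simp
    qed
    consider "v \<in> Z" | "u \<in> Z" | "u \<in> {apex, b, s, t, p, q}" "v \<in> {apex, b, s, t, p, q}"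
      using uv V by blast
    then show ?thesis
    proof cases
      case 1
      then show ?thesis using toZ uv by blast
    next
      case 2
      then show ?thesis using toZ[of v u] uv by (simp add: insert_commute)
    next
      case 3
      have ab_st: "adj G apex s" "adj G apex t" "adj G apex p" "adj G apex q" "adj G s apex" "adj G t apex" "adj G p apex"
        "adj G q apex" "adj G b s" "adj G b t" "adj G b p" "adj G b q" "adj G s b" "adj G t b" "adj G p b"
        "adj G q b"
        using aw bw by auto
      have ne: "apex \<noteq> b" "apex \<noteq> s" "apex \<noteq> t" "apex \<noteq> p" "apex \<noteq> q" "b \<noteq> s" "b \<noteq> t" "b \<noteq> p" "b \<noteq> q"
        "s \<noteq> t" "s \<noteq> p" "s \<noteq> q" "t \<noteq> p" "t \<noteq> q" "p \<noteq> q"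
        using dist(1) by auto
      note facts = ab_st e e' n' ne ne[symmetric]
      from 3(1) show ?thesis
        unfolding insert_iff empty_iff
        by (elim disjE; insert 3(2) uv(3); unfold insert_iff empty_iff; elim disjE;
            simp add: facts doubleton_eq_iff)
    qed
  qed
  then have nonedges: "\<forall>u\<in>verts G. \<forall>v\<in>verts G. u \<noteq> v \<longrightarrow>
      ({u, v} \<notin> edges G \<longleftrightarrow> {u, v} \<in> {{apex, b}, {s, t}, {p, q}})" by blast
  show ?thesis
    unfolding in_K3_def
    by (rule conjI[OF simple], rule exI[of _ apex], rule exI[of _ b], rule exI[of _ s],
        rule exI[of _ t], rule exI[of _ p], rule exI[of _ q], rule exI[of _ Z]) (intro conjI dist V clZ nonedges)
qed

text \<open>
  The complement of the graph on \<open>T\<close> has no triangle and no induced path on four vertices, so its only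
  non-trivial component is complete bipartite. If \<open>z\<close> in \<open>T\<close> misses some but not all of \<open>B\<close>, then the apex
  lies on a co-path on four vertices beside a co-edge, which is \<open>D3\<close>.
\<close>

lemma in_K2_if_one_co_component:
  assumes hub: "B \<subseteq> hub"
    and one: "\<And>s t p q. s \<in> T \<Longrightarrow> t \<in> T \<Longrightarrow> p \<in> T \<Longrightarrow> q \<in> T \<Longrightarrow> nadj G s t \<Longrightarrow> nadj G p q \<Longrightarrow>
      adj G s p \<Longrightarrow> adj G s q \<Longrightarrow> adj G t p \<Longrightarrow> adj G t q \<Longrightarrow> False"
  shows "in_K2 G"
proof -
  obtain s t where st: "s \<in> T" "t \<in> T" "nadj G s t" using co_edge_with_common_neighbour by blast
  have ts: "nadj G t s" using st by (simp add: nadj_commute)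
  define X where "X = {u \<in> T. nadj G u t}"
  define Y where "Y = {u \<in> T. nadj G u s}"
  define Z where "Z = T - core"
  have clB: "clique G B" using hub_clique hub by (auto simp: clique_def)
  have share: "adj G u v" if "u \<in> T" "v \<in> T" "w \<in> T" "nadj G u w" "nadj G v w" "u \<noteq> v" for u v w
    using co_P3_common_neighbour(1)[of u w v] that by (simp add: nadj_commute)
  have clX: "clique G X" and clY: "clique G Y"
    using share st partition by (auto simp: X_def Y_def clique_def)
  have sX: "s \<in> X" and tY: "t \<in> Y" using st ts by (auto simp: X_def Y_def)
  have XY: "X \<inter> Y = {}"
  proof -
    have False if "x \<in> X" "x \<in> Y" for x
      using co_triangle_free[OF st(1,2) _ st(3), of x] that by (auto simp: X_def Y_def nadj_commute)
    then show ?thesis by auto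
  qed
  have XYn: "nadj G x y" if xy: "x \<in> X" "y \<in> Y" for x y
  proof (rule ccontr)
    assume "\<not> nadj G x y"
    moreover have "x \<noteq> y" using xy XY by auto
    ultimately have "adj G x y" using T_nadj[of x y] xy by (auto simp: X_def Y_def)
    moreover have "x \<noteq> s" "y \<noteq> t"
      using xy \<open>\<not> nadj G x y\<close> by (auto simp: X_def Y_def nadj_commute)
    moreover have "adj G x s" "adj G t y"
      using clX clY sX tY xy \<open>x \<noteq> s\<close> \<open>y \<noteq> t\<close> by (auto simp: clique_def)
    ultimately show False
      using co_P4_free[of x t s y] xy st ts by (auto simp: X_def Y_def nadj_commute)
  qed
  have core: "core = X \<union> Y"
  proof
    show "X \<union> Y \<subseteq> core" using st by (auto simp: X_def Y_def core_def)
    show "core \<subseteq> X \<union> Y"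
    proof
      fix u assume "u \<in> core"
      then obtain v where uv: "u \<in> T" "v \<in> T" "nadj G u v" by (auto simp: core_def)
      show "u \<in> X \<union> Y"
      proof (rule ccontr)
        assume u: "u \<notin> X \<union> Y"
        have us: "adj G u s" "adj G u t"
          using u uv st sX tY T_nadj[of u s] T_nadj[of u t] by (auto simp: X_def Y_def)
        then have v: "v \<noteq> s" "v \<noteq> t" using uv(3) by (auto simp: nadj_def)
        have "\<not> nadj G v s"
        proof
          assume "nadj G v s"
          moreover have "adj G v t" using share[of v t s] uv st ts v \<open>nadj G v s\<close> by auto
          ultimately show False using co_P4_free[of u v s t] uv st us by auto
        qed
        moreover have "\<not> nadj G v t"
        proof
          assume "nadj G v t"
          moreover have "adj G v s" using share[of v s t] uv st v \<open>nadj G v t\<close> by auto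
          ultimately show False using co_P4_free[of u v t s] uv st ts us by auto
        qed
        ultimately have "adj G v s" "adj G v t" using T_nadj[of v s] T_nadj[of v t] uv st v by auto
        then show False using one[of u v s t] uv st us by auto
      qed
    qed
  qed
  have bZ: "adj G b z" if z: "z \<in> Z" and b: "b \<in> B" for b z
  proof (rule ccontr)
    assume nb: "\<not> adj G b z"
    have zT: "z \<in> T" using z by (simp add: Z_def)
    obtain b' where b': "b' \<in> B" "adj G z b'" using BT[OF zT] by auto
    have bb: "adj G b b'" using clB b b' nb by (auto simp: clique_def insert_commute)
    have core: "s \<in> core" "t \<in> core" using core sX tY by auto
    have "nadj G b z" using BT_nadj[OF b zT nb] .
    moreover have "adj G b s" "adj G b t" "adj G b' s" "adj G b' t" using hub_core hub b b' core by auto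
    moreover have "adj G z s" "adj G z t"
      using noncore_adj[of z s] noncore_adj[of z t] z core st by (auto simp: Z_def)
    ultimately show False
      using contains_D3I[OF simple, of z b apex b' s t] no_D3 b b' bb st zT apex_T apex_B by (simp add: pair_sym)
  qed
  show ?thesis
  proof (rule in_K2I[of G A B X Y Z])
    show "verts G = A \<union> B \<union> X \<union> Y \<union> Z" using partition core by (auto simp: Z_def core_def)
    have sub: "X \<subseteq> T" "Y \<subseteq> T" "Z \<subseteq> T" by (auto simp: X_def Y_def Z_def)
    show "A \<inter> B = {}" "A \<inter> X = {}" "A \<inter> Y = {}" "A \<inter> Z = {}" "B \<inter> X = {}"
      "B \<inter> Y = {}" "B \<inter> Z = {}" "X \<inter> Y = {}" "X \<inter> Z = {}" "Y \<inter> Z = {}"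
      using partition sub XY core by (auto simp: Z_def)
    show "clique G Z" using noncore_adj partition by (auto simp: clique_def Z_def)
    show "\<forall>u\<in>A. \<forall>v\<in>B. \<not> adj G u v" "\<forall>u\<in>X. \<forall>v\<in>Y. \<not> adj G u v"
      using AB XYn by (auto simp: nadj_def)
    have "adj G b v" if "b \<in> B" "v \<in> X \<union> Y \<union> Z" for b v
      using that bZ hub_core hub core by auto
    then show "\<forall>u\<in>A \<union> B. \<forall>v\<in>X \<union> Y \<union> Z. adj G u v" using AT sub by auto
    show "\<forall>u\<in>X \<union> Y. \<forall>v\<in>Z. adj G u v"
    proof (intro ballI)
      fix u v assume "u \<in> X \<union> Y" "v \<in> Z"
      then have "adj G v u" using noncore_adj[of v u] core sub by (auto simp: Z_def)
      then show "adj G u v" by (simp add: insert_commute)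
    qed
  qed (use simple clique_A clB clX clY in auto)
qed

theorem basic_or_separable: "clique_separable G \<or> in_K2 G \<or> in_K3 G"
proof (cases "B \<subseteq> hub")
  case True
  show ?thesis using in_K2_if_one_co_component[OF True] in_K3_if_two_co_edges[OF True] by blast
next
  case False
  then show ?thesis using separable_if_not_hub by blast
qed

end

section \<open>Decomposition into clique-sums\<close>

lemma simple_graph_edgeE:
  assumes "simple_graph G" "e \<in> edges G"
  obtains u v where "e = {u, v}" "u \<in> verts G" "v \<in> verts G" "u \<noteq> v"
proof -
  have "e \<in> {{u, v} |u v. u \<in> verts G \<and> v \<in> verts G \<and> u \<noteq> v}"
    using assms by (auto simp: simple_graph_def)
  then show thesis using that by blast
qed

lemma simple_induced_subgraph:
  assumes "simple_graph G" "S \<subseteq> verts G"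
  shows "simple_graph (induced_subgraph G S)"
proof -
  have "\<exists>u v. e = {u, v} \<and> u \<in> S \<and> v \<in> S \<and> u \<noteq> v" if e: "e \<in> edges G" "e \<subseteq> S" for e
    by (rule simple_graph_edgeE[OF assms(1) e(1)]) (use e(2) in blast)
  moreover have "finite S" using assms by (auto simp: simple_graph_def intro: finite_subset)
  ultimately show ?thesis unfolding simple_graph_def induced_subgraph_def by auto
qed

lemma induced_subgraph_simps [simp]:
  "verts (induced_subgraph G S) = S" "edges (induced_subgraph G S) = {e \<in> edges G. e \<subseteq> S}"
  by (auto simp: induced_subgraph_def)

lemma contains_induced_mono:
  assumes "contains_induced (induced_subgraph G S) H" "S \<subseteq> verts G"
  shows "contains_induced G H"
proof -
  obtain S' where "S' \<subseteq> S" "graph_iso H (induced_subgraph (induced_subgraph G S) S')"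
    using assms(1) by (auto simp: contains_induced_def)
  moreover from \<open>S' \<subseteq> S\<close> have "induced_subgraph (induced_subgraph G S) S' = induced_subgraph G S'"
    by (auto simp: induced_subgraph_def)
  ultimately show ?thesis using assms(2) by (auto simp: contains_induced_def)
qed

lemma obstruction_free_induced_subgraph:
  "obstruction_free G \<Longrightarrow> S \<subseteq> verts G \<Longrightarrow> obstruction_free (induced_subgraph G S)"
  unfolding obstruction_free_def by (auto dest: contains_induced_mono)

lemma clique_sum_of_induced_subgraphs:
  assumes G: "simple_graph G" and V: "V1 \<union> V2 = verts G" and K: "clique G (V1 \<inter> V2)"
    and sep: "\<forall>u\<in>V1 - V2. \<forall>v\<in>V2 - V1. \<not> adj G u v"
  shows "clique_sum (induced_subgraph G V1) (induced_subgraph G V2) G"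
proof -
  have "e \<subseteq> V1 \<or> e \<subseteq> V2" if e': "e \<in> edges G" for e
  proof -
    obtain u v where e: "e = {u, v}" "u \<in> verts G" "v \<in> verts G"
      by (rule simple_graph_edgeE[OF G e'])
    have "\<not> (u \<in> V1 - V2 \<and> v \<in> V2 - V1)" "\<not> (v \<in> V1 - V2 \<and> u \<in> V2 - V1)"
      using sep e' adj_commute[of u v G] unfolding e by blast+
    then show ?thesis using e V by blast
  qed
  then show ?thesis
    using V K by (auto simp: clique_sum_def clique_def intro!: prod_eqI)
qed

text \<open>
  If a vertex \<open>x\<close> of \<open>A\<close> missed a vertex \<open>t\<close> of the neighbourhood \<open>T\<close> of \<open>B\<close>, then \<open>B\<close> enlarged
  by \<open>t\<close> would still be connected and unseen by \<open>x\<close>, against the choice of \<open>B\<close>.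
\<close>

lemma full_separation_exists:
  assumes G: "simple_graph G" and nc: "\<not> clique G (verts G)"
  shows "\<exists>A B T. verts G = A \<union> B \<union> T \<and> A \<inter> B = {} \<and> A \<inter> T = {} \<and> B \<inter> T = {} \<and> A \<noteq> {} \<and> B \<noteq> {} \<and>
    connected_on G B \<and> (\<forall>a\<in>A. \<forall>b\<in>B. nadj G a b) \<and> (\<forall>a\<in>A. \<forall>t\<in>T. adj G a t) \<and>
    (\<forall>t\<in>T. \<exists>b\<in>B. adj G t b)"
proof -
  have fin: "finite (verts G)" using G by (simp add: simple_graph_def)
  \<comment> \<open>The pairs among which \<open>B\<close> is maximized.\<close>
  define far where "far a B \<longleftrightarrow> a \<in> verts G \<and> B \<subseteq> verts G \<and> B \<noteq> {} \<and> connected_on G B \<and>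
    (\<forall>b\<in>B. nadj G a b)" for a B
  define N where "N = {card B |a B. far a B}"
  have "N \<subseteq> {..card (verts G)}" unfolding N_def far_def using fin by (auto intro: card_mono)
  then have finN: "finite N" by (rule finite_subset) simp
  obtain u v where "u \<in> verts G" "v \<in> verts G" "nadj G u v"
    using nc by (auto simp: clique_def nadj_def)
  then have "far u {v}" by (auto simp: far_def connected_on_def)
  then have "N \<noteq> {}" unfolding N_def by blast
  then have "Max N \<in> N" using finN by (rule Max_in[rotated])
  then obtain a B where aB: "far a B" "card B = Max N" unfolding N_def by auto
  have maximal: "card B' \<le> card B" if "far a' B'" for a' B'
    using that aB(2) finN unfolding N_def by (auto intro!: Max_ge)
  have B: "B \<subseteq> verts G" "B \<noteq> {}" "connected_on G B" "finite B"
    using aB(1) fin by (auto simp: far_def intro: finite_subset)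
  define T where "T = {t \<in> verts G - B. \<exists>b\<in>B. adj G t b}"
  define A where "A = verts G - B - T"
  have AB: "nadj G x b" if "x \<in> A" "b \<in> B" for x b
    using that B(1) by (auto simp: A_def T_def nadj_def)
  have "a \<notin> B" using aB(1) by (auto simp: far_def nadj_def)
  then have "a \<in> A" using aB(1) by (auto simp: A_def T_def far_def nadj_def)
  have AT: "adj G x t" if x: "x \<in> A" and t: "t \<in> T" for x t
  proof (rule ccontr)
    assume "\<not> adj G x t"
    then have "nadj G x t" using x t by (auto simp: A_def T_def nadj_def)
    moreover obtain b where "b \<in> B" "adj G t b" using t by (auto simp: T_def)
    ultimately have "far x (insert t B)"
      unfolding far_def using AB[OF x] connected_on_insert[OF B(3)] B t x
      by (auto simp: A_def T_def)
    then have "card (insert t B) \<le> card B" by (rule maximal)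
    then show False using t B(4) by (simp add: T_def)
  qed
  have "verts G = A \<union> B \<union> T" "A \<inter> B = {}" "A \<inter> T = {}" "B \<inter> T = {}" "\<forall>t\<in>T. \<exists>b\<in>B. adj G t b"
    using B(1) by (auto simp: A_def T_def)
  moreover have "A \<noteq> {}" using \<open>a \<in> A\<close> by blast
  ultimately show ?thesis
    by (intro exI conjI) (assumption | rule B AB AT ballI)+
qed

lemma in_K2_complete: "simple_graph G \<Longrightarrow> clique G (verts G) \<Longrightarrow> in_K2 G"
  by (rule in_K2I[of G "{}" "{}" "{}" "{}" "verts G"]) (auto simp: clique_def)

lemma obstruction_free_basic_or_separable:
  assumes "simple_graph G" "obstruction_free G"
  shows "clique_separable G \<or> in_K2 G \<or> in_K3 G"
proof (cases "clique G (verts G)")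
  case True
  then show ?thesis using in_K2_complete assms by blast
next
  case False
  obtain A B T where ABT: "verts G = A \<union> B \<union> T" "A \<inter> B = {}" "A \<inter> T = {}" "B \<inter> T = {}"
    "A \<noteq> {}" "B \<noteq> {}" "connected_on G B" "\<And>a b. a \<in> A \<Longrightarrow> b \<in> B \<Longrightarrow> nadj G a b"
    "\<And>a t. a \<in> A \<Longrightarrow> t \<in> T \<Longrightarrow> adj G a t" "\<And>t. t \<in> T \<Longrightarrow> \<exists>b\<in>B. adj G t b"
    using full_separation_exists[OF assms(1) False] by metis
  show ?thesis
  proof (cases "clique G T")
    case True
    have "(A \<union> T) \<inter> (B \<union> T) = T" "A \<union> T \<noteq> verts G" "B \<union> T \<noteq> verts G" using ABT by auto
    moreover have "\<forall>u\<in>A \<union> T - (B \<union> T). \<forall>v\<in>B \<union> T - (A \<union> T). \<not> adj G u v"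
      using ABT(8) by (auto simp: nadj_def)
    ultimately have "clique_separable G"
      unfolding clique_separable_def using True ABT(1)
      by (intro exI[of _ "A \<union> T"] exI[of _ "B \<union> T"]) auto
    then show ?thesis ..
  next
    case False
    interpret full_separation G A B T
      using assms ABT False by unfold_locales auto
    show ?thesis by (rule basic_or_separable)
  qed
qed

theorem clique_sum_of_if_obstruction_free:
  assumes "simple_graph G" "verts G \<noteq> {}" "obstruction_free G"
  shows "clique_sum_of (\<lambda>H. in_K2 H \<or> in_K3 H) G"
  using assms
proof (induction "card (verts G)" arbitrary: G rule: less_induct)
  case less
  have fin: "finite (verts G)" using less.prems(1) by (simp add: simple_graph_def)
  from obstruction_free_basic_or_separable[OF less.prems(1,3)] show ?case
  proof
    assume "clique_separable G"
    then obtain V1 V2 where V: "V1 \<union> V2 = verts G" "V1 \<noteq> verts G" "V2 \<noteq> verts G"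
      "clique G (V1 \<inter> V2)" "\<forall>u\<in>V1 - V2. \<forall>v\<in>V2 - V1. \<not> adj G u v"
      unfolding clique_separable_def by blast
    have "clique_sum_of (\<lambda>H. in_K2 H \<or> in_K3 H) (induced_subgraph G W)"
      if "W \<subset> verts G" "W \<noteq> {}" for W
      using that less.prems fin
      by (intro less.hyps) (auto intro: psubset_card_mono simple_induced_subgraph obstruction_free_induced_subgraph)
    then have "clique_sum_of (\<lambda>H. in_K2 H \<or> in_K3 H) (induced_subgraph G V1)"
      "clique_sum_of (\<lambda>H. in_K2 H \<or> in_K3 H) (induced_subgraph G V2)"
      using V by blast+
    then show ?thesis
      by (rule clique_sum_of.sum) (rule clique_sum_of_induced_subgraphs[OF less.prems(1) V(1,4,5)])
  qed (rule clique_sum_of.single)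
qed

section \<open>Positive semidefinite Hermitian matrices\<close>

definition cinner :: "complex^'n \<Rightarrow> complex^'n \<Rightarrow> complex" where
  "cinner x y = (\<Sum>i\<in>UNIV. cnj (x $ i) * y $ i)"

lemma cinner_add_right: "cinner x (y + z) = cinner x y + cinner x z"
  and cinner_add_left: "cinner (x + y) z = cinner x z + cinner y z"
  and cinner_diff_right: "cinner x (y - z) = cinner x y - cinner x z"
  and cinner_diff_left: "cinner (x - y) z = cinner x z - cinner y z"
  and cinner_scale_right: "cinner x (c *s y) = c * cinner x y"
  and cinner_scale_left: "cinner (c *s x) y = cnj c * cinner x y"
  and cinner_zero_right [simp]: "cinner x 0 = 0"
  and cinner_zero_left [simp]: "cinner 0 x = 0"
  by (simp_all add: cinner_def algebra_simps sum.distrib sum_subtractf sum_distrib_left)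

lemma cinner_commute: "cinner y x = cnj (cinner x y)"
  by (simp add: cinner_def mult.commute)

lemma cinner_sum_right: "cinner x (\<Sum>i\<in>I. f i) = (\<Sum>i\<in>I. cinner x (f i))"
  by (induction I rule: infinite_finite_induct) (simp_all add: cinner_add_right)

lemma cinner_sum_left: "cinner (\<Sum>i\<in>I. f i) x = (\<Sum>i\<in>I. cinner (f i) x)"
  by (induction I rule: infinite_finite_induct) (simp_all add: cinner_add_left)

lemma cinner_axis_left: "cinner (axis i 1) x = x $ i"
proof -
  have "cinner (axis i 1) x = (\<Sum>j\<in>UNIV. if i = j then x $ j else 0)"
    unfolding cinner_def by (rule sum.cong) (auto simp: axis_def)
  then show ?thesis by simp
qed

lemma cinner_self: "cinner x x = of_real (\<Sum>i\<in>UNIV. (cmod (x $ i))\<^sup>2)"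
  unfolding cinner_def of_real_sum
  by (intro sum.cong refl) (simp only: complex_norm_square mult.commute)

lemma cinner_self_ge_0: "0 \<le> Re (cinner x x)"
  by (simp add: cinner_self sum_nonneg)

lemma cinner_self_eq_0 [simp]: "cinner x x = 0 \<longleftrightarrow> x = 0"
  unfolding cinner_self of_real_eq_0_iff by (simp add: sum_nonneg_eq_0_iff vec_eq_iff)

lemma pos_semidef_iff: "pos_semidef A \<longleftrightarrow> (\<forall>x. 0 \<le> Re (cinner x (A *v x)))"
proof -
  have "(\<Sum>i\<in>UNIV. \<Sum>j\<in>UNIV. cnj (x $ i) * A $ i $ j * x $ j) = cinner x (A *v x)" for x
    by (simp add: cinner_def matrix_vector_mult_def sum_distrib_left mult.assoc)
  then show ?thesis by (simp add: pos_semidef_def)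
qed

definition hermitian :: "complex^'n^'n \<Rightarrow> bool" where
  "hermitian A \<longleftrightarrow> (\<forall>i j. A $ i $ j = cnj (A $ j $ i))"

lemma hermitian_cnj: "hermitian A \<Longrightarrow> cnj (A $ i $ j) = A $ j $ i"
  unfolding hermitian_def by metis

lemma hermitian_cinner:
  assumes "hermitian A"
  shows "cinner x (A *v y) = cinner (A *v x) y"
proof -
  have "cinner x (A *v y) = (\<Sum>i\<in>UNIV. \<Sum>j\<in>UNIV. cnj (x $ i) * A $ i $ j * y $ j)"
    by (simp add: cinner_def matrix_vector_mult_def sum_distrib_left mult.assoc)
  also have "\<dots> = (\<Sum>j\<in>UNIV. \<Sum>i\<in>UNIV. cnj (A $ j $ i * x $ i) * y $ j)"
    unfolding sum.swap[of "\<lambda>i j. cnj (x $ i) * A $ i $ j * y $ j"]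
    by (intro sum.cong refl) (simp add: hermitian_cnj[OF assms] mult_ac)
  also have "\<dots> = cinner (A *v x) y"
    by (simp add: cinner_def matrix_vector_mult_def sum_distrib_right)
  finally show ?thesis .
qed

definition hermitian_psd :: "complex^'n^'n \<Rightarrow> bool" where
  "hermitian_psd A \<longleftrightarrow> hermitian A \<and> pos_semidef A"

lemma hermitian_psd_ge_0: "hermitian_psd A \<Longrightarrow> 0 \<le> Re (cinner x (A *v x))"
  by (simp add: hermitian_psd_def pos_semidef_iff)

text \<open>
  The quadratic form is non-negative on the real line through \<open>x\<close> in the direction \<open>y\<close>, with a
  phase chosen so that the mixed term is real; the minimum over the line is the claim.
\<close>

lemma psd_cauchy_schwarz:
  assumes A: "hermitian_psd A"
  shows "(cmod (cinner x (A *v y)))\<^sup>2 \<le> Re (cinner x (A *v x)) * Re (cinner y (A *v y))"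
proof -
  define \<beta> where "\<beta> = cinner x (A *v y)"
  define p where "p = Re (cinner x (A *v x))"
  define q where "q = Re (cinner y (A *v y))"
  have yx: "cinner y (A *v x) = cnj \<beta>"
    using A hermitian_cinner[of A y x] cinner_commute[of "A *v y" x] by (simp add: \<beta>_def hermitian_psd_def)
  have line: "0 \<le> p - 2 * t * (cmod \<beta>)\<^sup>2 + t\<^sup>2 * (cmod \<beta>)\<^sup>2 * q" for t :: real
  proof -
    \<comment> \<open>This phase makes \<open>c * \<beta>\<close> real.\<close>
    define c where "c = of_real t * cnj \<beta>"
    have "cinner (x - c *s y) (A *v (x - c *s y)) =
        cinner x (A *v x) - c * \<beta> - cnj (c * \<beta>) + c * cnj c * cinner y (A *v y)"
      by (simp add: matrix_vector_mult_diff_distrib vector_scalar_commute cinner_diff_left cinner_diff_right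
          cinner_scale_left cinner_scale_right yx algebra_simps flip: \<beta>_def)
    moreover have "c * \<beta> = of_real (t * (cmod \<beta>)\<^sup>2)"
      unfolding c_def of_real_mult complex_norm_square by (simp add: mult_ac)
    moreover have "c * cnj c = of_real ((cmod c)\<^sup>2)" by (simp only: complex_norm_square)
    ultimately have "Re (cinner (x - c *s y) (A *v (x - c *s y))) = p - 2 * (t * (cmod \<beta>)\<^sup>2) + (cmod c)\<^sup>2 * q"
      by (simp add: p_def q_def flip: of_real_mult of_real_power)
    moreover have "(cmod c)\<^sup>2 = t\<^sup>2 * (cmod \<beta>)\<^sup>2" by (simp add: c_def norm_mult power_mult_distrib)
    ultimately show ?thesis using hermitian_psd_ge_0[OF A, of "x - c *s y"] by simp
  qed
  have q: "0 \<le> q" unfolding q_def by (rule hermitian_psd_ge_0[OF A])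
  have "(cmod \<beta>)\<^sup>2 \<le> p * q"
  proof (cases "q = 0")
    case True
    have "(cmod \<beta>)\<^sup>2 = 0"
    proof (rule ccontr)
      assume nz: "(cmod \<beta>)\<^sup>2 \<noteq> 0"
      from line[of "(p + 1) / (2 * (cmod \<beta>)\<^sup>2)"] nz True show False by simp
    qed
    then show ?thesis using True by simp
  next
    case False
    then have "q > 0" using q by simp
    with line[of "1 / q"] show ?thesis by (simp add: field_simps power2_eq_square)
  qed
  then show ?thesis by (simp add: \<beta>_def p_def q_def)
qed

text \<open>
  By the Cauchy-Schwarz inequality a vector on which the form vanishes is orthogonal to everything.
  Hence the kernel of a sum of two semidefinite matrices lies in the kernel of each of them.
\<close>

lemma psd_null_vector:
  assumes A: "hermitian_psd A" and "Re (cinner w (A *v w)) = 0"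
  shows "A *v w = 0"
proof -
  have "cinner x (A *v w) = 0" for x
    using psd_cauchy_schwarz[OF A, of x w] assms(2) by simp
  then show ?thesis by (metis cinner_self_eq_0)
qed

lemma axis_mult: "(A *v axis a 1) $ i = A $ i $ a" for A :: "complex^'n^'n"
  by (simp add: matrix_vector_mult_def axis_def if_distrib cong: if_cong)

lemma psd_entry_bound:
  assumes A: "hermitian_psd A"
  shows "(cmod ((A *v v) $ a))\<^sup>2 \<le> Re (A $ a $ a) * Re (cinner v (A *v v))"
  using psd_cauchy_schwarz[OF A, of "axis a 1" v] by (simp add: cinner_axis_left axis_mult)

lemma psd_diag_ge_0: "hermitian_psd A \<Longrightarrow> 0 \<le> Re (A $ a $ a)"
  using hermitian_psd_ge_0[of A "axis a 1"] by (simp add: cinner_axis_left axis_mult)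

lemma hermitian_diag_real: "hermitian A \<Longrightarrow> A $ a $ a = of_real (Re (A $ a $ a))"
  using arg_cong[OF hermitian_cnj[of A a a], of Im] by (simp add: complex_eq_iff)

lemma psd_zero_row:
  assumes A: "hermitian_psd A" and "A $ a $ a = 0"
  shows "A $ a $ j = 0"
  using psd_entry_bound[OF A, of "axis j 1" a] assms(2) by (simp add: axis_mult)

text \<open>
  One step of Cholesky elimination. The row of \<open>a\<close> is removed by subtracting a matrix of rank one;
  the remainder is semidefinite by \<open>psd_entry_bound\<close>. A column in which row \<open>a\<close> has a zero is not
  touched.
\<close>

lemma schur_step:
  fixes X :: "complex^'n::finite^'n"
  assumes X: "hermitian_psd X"
  shows "\<exists>y X'. hermitian_psd X' \<and> (\<forall>i j. X $ i $ j = cnj (y $ i) * y $ j + X' $ i $ j) \<and>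
    (\<forall>j. X' $ a $ j = 0) \<and> (\<forall>b. X $ a $ b = 0 \<longrightarrow> y $ b = 0)"
proof (cases "X $ a $ a = 0")
  case True
  then show ?thesis using X psd_zero_row[OF X True] by (rule_tac exI[of _ 0], rule_tac exI[of _ X]) simp
next
  case False
  have H: "hermitian X" using X by (simp add: hermitian_psd_def)
  define d where "d = Re (X $ a $ a)"
  have Xaa: "X $ a $ a = of_real d" using hermitian_diag_real[OF H] by (simp add: d_def)
  have "d \<ge> 0" unfolding d_def by (rule psd_diag_ge_0[OF X])
  moreover have "d \<noteq> 0" using Xaa False by auto
  ultimately have d: "d > 0" by simp
  define y :: "complex^'n" where "y = (\<chi> j. X $ a $ j / of_real (sqrt d))"
  define X' :: "complex^'n^'n" where "X' = (\<chi> i j. X $ i $ j - cnj (y $ i) * y $ j)"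
  have sqd: "complex_of_real (sqrt d) * of_real (sqrt d) = of_real d"
    using d by (simp flip: of_real_mult)
  have yy: "cnj (y $ i) * y $ j = X $ i $ a * X $ a $ j / of_real d" for i j
    using hermitian_cnj[OF H, of a i] sqd by (simp add: y_def)
  have "hermitian X'"
    unfolding hermitian_def X'_def by (simp add: hermitian_cnj[OF H] mult.commute)
  moreover have "pos_semidef X'"
    unfolding pos_semidef_iff
  proof
    fix v
    have s: "(\<Sum>j\<in>UNIV. y $ j * v $ j) = (X *v v) $ a / of_real (sqrt d)"
      by (simp add: y_def matrix_vector_mult_def sum_divide_distrib)
    have "cinner v (X' *v v) = cinner v (X *v v) - (\<Sum>i\<in>UNIV. cnj (v $ i) * (cnj (y $ i) * (\<Sum>j\<in>UNIV. y $ j * v $ j)))"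
      by (simp add: cinner_def matrix_vector_mult_def X'_def algebra_simps sum_subtractf sum_distrib_left)
    also have "(\<Sum>i\<in>UNIV. cnj (v $ i) * (cnj (y $ i) * (\<Sum>j\<in>UNIV. y $ j * v $ j))) =
        cnj (\<Sum>j\<in>UNIV. y $ j * v $ j) * (\<Sum>j\<in>UNIV. y $ j * v $ j)"
      unfolding cnj_sum sum_distrib_right by (intro sum.cong refl) (simp add: mult_ac)
    also have "\<dots> = of_real ((cmod (\<Sum>j\<in>UNIV. y $ j * v $ j))\<^sup>2)"
      by (simp only: complex_norm_square mult.commute)
    finally have "Re (cinner v (X' *v v)) = Re (cinner v (X *v v)) - (cmod ((X *v v) $ a))\<^sup>2 / d"
      using d by (simp add: s norm_divide power_divide)
    then show "0 \<le> Re (cinner v (X' *v v))"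
      using psd_entry_bound[OF X, of v a] d unfolding Xaa by (simp add: divide_le_eq mult.commute)
  qed
  ultimately have "hermitian_psd X'" by (simp add: hermitian_psd_def)
  moreover have "X' $ a $ j = 0" for j using d by (simp add: X'_def yy Xaa)
  ultimately show ?thesis
    by (intro exI[of _ y] exI[of _ X']) (auto simp: X'_def y_def)
qed

text \<open>
  The statement about zeros says that the eliminated part is supported on \<open>S\<close> and its neighbours,
  although it may fill in arbitrarily among these. This is what keeps the two summands of a clique-sum
  apart.
\<close>

lemma schur_elimination:
  fixes X :: "complex^'n::finite^'n"
  assumes "finite S" "hermitian_psd X"
  shows "\<exists>y X'. hermitian_psd X' \<and> (\<forall>i j. X $ i $ j = (\<Sum>s\<in>S. cnj (y s $ i) * y s $ j) + X' $ i $ j) \<and>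
    (\<forall>s\<in>S. \<forall>j. X' $ s $ j = 0) \<and> (\<forall>b. (\<forall>s\<in>S. X $ s $ b = 0) \<longrightarrow> (\<forall>s\<in>S. y s $ b = (0::complex))) \<and>
    (\<forall>c. (\<forall>j. X $ c $ j = 0) \<longrightarrow> (\<forall>j. X' $ c $ j = 0))"
  using assms
proof (induction S arbitrary: X rule: finite_induct)
  case empty
  then show ?case by auto
next
  case (insert a S)
  obtain z X1 where X1: "hermitian_psd X1" "\<And>i j. X $ i $ j = cnj (z $ i) * z $ j + X1 $ i $ j"
    "\<And>j. X1 $ a $ j = 0" "\<And>b. X $ a $ b = 0 \<Longrightarrow> z $ b = 0"
    using schur_step[OF insert.prems, of a] by blast
  obtain y X2 where X2: "hermitian_psd X2"
    "\<And>i j. X1 $ i $ j = (\<Sum>s\<in>S. cnj (y s $ i) * y s $ j) + X2 $ i $ j"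
    "\<And>s j. s \<in> S \<Longrightarrow> X2 $ s $ j = 0" "\<And>b s. \<forall>s\<in>S. X1 $ s $ b = 0 \<Longrightarrow> s \<in> S \<Longrightarrow> y s $ b = (0::complex)"
    "\<And>c j. \<forall>j. X1 $ c $ j = 0 \<Longrightarrow> X2 $ c $ j = 0"
    using insert.IH[OF X1(1)] by blast
  have H: "hermitian X" using insert.prems by (simp add: hermitian_psd_def)
  define y' where "y' = y(a := z)"
  have sum: "(\<Sum>s\<in>insert a S. cnj (y' s $ i) * y' s $ j) = cnj (z $ i) * z $ j + (\<Sum>s\<in>S. cnj (y s $ i) * y s $ j)" for i j
  proof -
    have "(\<Sum>s\<in>S. cnj (y' s $ i) * y' s $ j) = (\<Sum>s\<in>S. cnj (y s $ i) * y s $ j)"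
      using insert.hyps(2) by (intro sum.cong) (auto simp: y'_def)
    then show ?thesis using insert.hyps by (simp add: y'_def)
  qed
  show ?case
  proof (intro exI[of _ y'] exI[of _ X2] conjI allI ballI impI)
    show "hermitian_psd X2" by fact
    show "X $ i $ j = (\<Sum>s\<in>insert a S. cnj (y' s $ i) * y' s $ j) + X2 $ i $ j" for i j
      unfolding sum X1(2) X2(2) by simp
    show "X2 $ s $ j = 0" if "s \<in> insert a S" for s j
      using that X2(3) X2(5)[of a] X1(3) by auto
    show "y' s $ b = 0" if "\<forall>s\<in>insert a S. X $ s $ b = 0" "s \<in> insert a S" for b s
    proof -
      have z: "z $ b = 0" using X1(4) that by auto
      then have "\<forall>s\<in>S. X1 $ s $ b = 0" using that X1(2)[of _ b] by simp
      then show ?thesis using X2(4) z that(2) by (auto simp: y'_def)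
    qed
    show "X2 $ c $ j = 0" if "\<forall>j. X $ c $ j = 0" for c j
    proof (rule X2(5), rule allI)
      fix j
      have "X $ a $ c = 0" using that hermitian_cnj[OF H, of c a] by simp
      then have "z $ c = 0" by (rule X1(4))
      then show "X1 $ c $ j = 0" using that X1(2)[of c j] by simp
    qed
  qed
qed

corollary gram_factorization:
  fixes X :: "complex^'n::finite^'n"
  assumes "hermitian_psd X"
  shows "\<exists>a :: 'n \<Rightarrow> complex^'n. \<forall>i j. X $ i $ j = cinner (a i) (a j)"
proof -
  obtain y X' where *: "\<And>i j. X $ i $ j = (\<Sum>s\<in>(UNIV :: 'n set). cnj (y s $ i) * y s $ j) + X' $ i $ j"
    "\<And>s j. X' $ s $ j = 0"
    using schur_elimination[OF finite_class.finite_UNIV assms] by blast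
  show ?thesis
    by (rule exI[of _ "\<lambda>i. \<chi> s. y s $ i"]) (simp add: cinner_def *)
qed

lemma hermitian_space_iff:
  "A \<in> hermitian_space G \<longleftrightarrow> hermitian A \<and>
     (\<forall>i j. i \<notin> verts G \<or> j \<notin> verts G \<or> (i \<noteq> j \<and> {i, j} \<notin> edges G) \<longrightarrow> A $ i $ j = 0)"
  unfolding hermitian_space_def hermitian_def mem_Collect_eq
  by (rule arg_cong2[where f = "(\<and>)", OF refl]) blast

lemma psd_cone_iff: "A \<in> psd_cone G \<longleftrightarrow> A \<in> hermitian_space G \<and> hermitian_psd A"
  unfolding psd_cone_def hermitian_psd_def mem_Collect_eq
  using hermitian_space_iff[of A G] by blast

lemma scaleR_mult_vec: "(c *\<^sub>R A) *v x = of_real c *s (A *v x)" for A :: "complex^'n^'m"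
  by (simp add: vec_eq_iff matrix_vector_mult_def scaleR_conv_of_real[where 'a = complex] sum_distrib_left mult.assoc)

lemma hermitian_space_add:
  assumes "A \<in> hermitian_space G" "B \<in> hermitian_space G"
  shows "A + B \<in> hermitian_space G"
proof -
  have "hermitian A" "hermitian B" using assms by (auto simp: hermitian_space_iff)
  then have "hermitian (A + B)"
    unfolding hermitian_def[of "A + B"] by (simp add: hermitian_cnj)
  then show ?thesis using assms by (simp add: hermitian_space_iff)
qed

lemma hermitian_space_scaleR:
  assumes "A \<in> hermitian_space G"
  shows "c *\<^sub>R A \<in> hermitian_space G"
proof -
  have "hermitian A" using assms by (auto simp: hermitian_space_iff)
  then have "hermitian (c *\<^sub>R A)"
    unfolding hermitian_def[of "c *\<^sub>R A"] by (simp add: hermitian_cnj)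
  then show ?thesis using assms by (simp add: hermitian_space_iff)
qed

text \<open>
  The bound makes \<open>X + Y / m\<close> and \<open>X - Y / m\<close> semidefinite for some \<open>m > 0\<close>, and \<open>X\<close> is their mean.
\<close>

lemma extremal_perturbation:
  assumes X: "extremal G X" and Y: "Y \<in> hermitian_space G"
    and bound: "\<And>x. \<bar>Re (cinner x (Y *v x))\<bar> \<le> M * Re (cinner x (X *v x))"
  shows "\<exists>c::real. Y = c *\<^sub>R X"
proof -
  define m where "m = max M 1"
  have m: "m > 0" "M \<le> m" unfolding m_def by linarith+
  have Xp: "X \<in> psd_cone G" using X unfolding extremal_def by blast
  then have XH: "X \<in> hermitian_space G" "hermitian_psd X" unfolding psd_cone_iff by blast+
  have half: "(1/2) *\<^sub>R (X + c *\<^sub>R Y) \<in> psd_cone G" if "c = 1 / m \<or> c = - (1 / m)" for c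
  proof -
    have H: "(1/2) *\<^sub>R (X + c *\<^sub>R Y) \<in> hermitian_space G"
      by (intro hermitian_space_scaleR hermitian_space_add XH Y)
    have "0 \<le> Re (cinner x (((1/2) *\<^sub>R (X + c *\<^sub>R Y)) *v x))" for x
    proof -
      have "\<bar>Re (cinner x (Y *v x))\<bar> \<le> m * Re (cinner x (X *v x))"
        using bound[of x] hermitian_psd_ge_0[OF XH(2), of x] m by (meson mult_right_mono order_trans)
      moreover have "\<bar>c\<bar> = 1 / m" using that m by auto
      ultimately have "\<bar>c * Re (cinner x (Y *v x))\<bar> \<le> Re (cinner x (X *v x))"
        using m(1) by (simp add: abs_mult divide_le_eq mult.commute)
      then show ?thesis
        by (simp add: scaleR_mult_vec matrix_vector_mult_add_rdistrib cinner_scale_right cinner_add_right)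
    qed
    then show ?thesis using H by (auto simp: psd_cone_iff hermitian_psd_def pos_semidef_iff hermitian_space_iff)
  qed
  define X1 where "X1 = (1/2) *\<^sub>R (X + (1/m) *\<^sub>R Y)"
  define X2 where "X2 = (1/2) *\<^sub>R (X + (- (1/m)) *\<^sub>R Y)"
  have Y_eq: "Y = m *\<^sub>R (2 *\<^sub>R X1 - X)" "Y = m *\<^sub>R (X - 2 *\<^sub>R X2)"
    using m by (simp_all add: X1_def X2_def)
  have "X = X1 + X2" by (simp add: X1_def X2_def flip: scaleR_add_left scaleR_add_right)
  moreover have "X1 \<in> psd_cone G" "X2 \<in> psd_cone G" unfolding X1_def X2_def by (rule half; simp)+
  ultimately consider "X1 = 0" | "X2 = 0" | a where "X1 = a *\<^sub>R X"
    using X unfolding extremal_def by blast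
  then show ?thesis
  proof cases
    case 1
    then have "Y = (- m) *\<^sub>R X" using Y_eq(1) by simp
    then show ?thesis ..
  next
    case 2
    then have "Y = m *\<^sub>R X" using Y_eq(2) by simp
    then show ?thesis ..
  next
    case 3
    then have "Y = (m * (2 * a - 1)) *\<^sub>R X" using Y_eq(1) by (simp add: algebra_simps)
    then show ?thesis ..
  qed
qed

section \<open>Extremal matrices of clique-sums\<close>

lemma rank_le_2I:
  fixes X :: "complex^'n::finite^'n"
  assumes "\<And>i j. X $ i $ j = f i * u $ j + g i * w $ j"
  shows "rank X \<le> 2"
proof -
  have "row i X \<in> vec.span {u, w}" for i
  proof -
    have "row i X = f i *s u + g i *s w" using assms by (simp add: row_def vec_eq_iff)
    then show ?thesis by (simp add: vec.span_add vec.span_base vec.span_scale)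
  qed
  then have "rows X \<subseteq> vec.span {u, w}" by (auto simp: rows_def)
  then have "rank X \<le> card {u, w}" unfolding row_rank_def_gen by (rule vec.dim_le_card) simp
  also have "card {u, w} \<le> 2" by (simp add: card_insert_if)
  finally show ?thesis .
qed

text \<open>
  Stated for all extremal matrices instead of the maximal rank, since the maximum is not meaningful
  for the graph without vertices.
\<close>

definition order_le_2 :: "'n::finite ugraph \<Rightarrow> bool" where
  "order_le_2 G \<longleftrightarrow> (\<forall>X. extremal G X \<longrightarrow> rank X \<le> 2)"

text \<open>
  Extremality passes to any smaller cone that still contains the matrix.
\<close>

lemma extremal_in_subcone:
  assumes X: "extremal G X" and sub: "psd_cone H \<subseteq> psd_cone G" and Y: "Y \<in> psd_cone H" "X = c *\<^sub>R Y" "c > 0"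
  shows "extremal H X"
proof -
  have "c *\<^sub>R Y \<in> psd_cone H"
    using Y(1,3) hermitian_space_scaleR[of Y H c]
    by (simp add: psd_cone_def pos_semidef_iff scaleR_mult_vec cinner_scale_right)
  then show ?thesis using X sub unfolding extremal_def Y(2) by blast
qed

lemma decomposition_extremal:
  assumes X: "extremal G X" and dec: "X = X1 + X2" "X1 \<in> psd_cone G1" "X2 \<in> psd_cone G2"
    and sub: "psd_cone G1 \<subseteq> psd_cone G" "psd_cone G2 \<subseteq> psd_cone G"
  shows "extremal G1 X \<or> extremal G2 X"
proof -
  consider "X1 = 0" | "X2 = 0" | a where "a > 0" "X1 = a *\<^sub>R X"
    using X dec sub unfolding extremal_def by blast
  then show ?thesis
  proof cases
    case 1
    then show ?thesis using extremal_in_subcone[OF X sub(2) dec(3), of 1] dec(1) by simp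
  next
    case 2
    then show ?thesis using extremal_in_subcone[OF X sub(1) dec(2), of 1] dec(1) by simp
  next
    case 3
    then have "X = (1 / a) *\<^sub>R X1" by simp
    then show ?thesis using extremal_in_subcone[OF X sub(1) dec(2), of "1 / a"] 3 by simp
  qed
qed

lemma psd_sum_outer:
  fixes y :: "'s \<Rightarrow> complex^'n::finite"
  assumes "finite S"
  shows "hermitian_psd (\<chi> i j. \<Sum>s\<in>S. cnj (y s $ i) * y s $ j)"
proof -
  let ?X = "(\<chi> i j. \<Sum>s\<in>S. cnj (y s $ i) * y s $ j) :: complex^'n^'n"
  have "hermitian ?X" unfolding hermitian_def by (simp add: mult.commute)
  moreover have "Re (cinner x (?X *v x)) \<ge> 0" for x
  proof -
    have "cinner x (?X *v x) = (\<Sum>i\<in>UNIV. \<Sum>j\<in>UNIV. \<Sum>s\<in>S. cnj (y s $ i * x $ i) * (y s $ j * x $ j))"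
      by (simp add: cinner_def matrix_vector_mult_def sum_distrib_left sum_distrib_right mult_ac)
    also have "\<dots> = (\<Sum>s\<in>S. \<Sum>i\<in>UNIV. \<Sum>j\<in>UNIV. cnj (y s $ i * x $ i) * (y s $ j * x $ j))"
      by (subst sum.swap, subst (2) sum.swap) (rule refl)
    also have "\<dots> = (\<Sum>s\<in>S. cnj (\<Sum>i\<in>UNIV. y s $ i * x $ i) * (\<Sum>j\<in>UNIV. y s $ j * x $ j))"
      by (simp only: cnj_sum sum_product)
    also have "Re \<dots> \<ge> 0"
    proof -
      have "0 \<le> Re (cnj z * z)" for z by simp
      then show ?thesis unfolding Re_sum by (intro sum_nonneg)
    qed
    finally show ?thesis .
  qed
  ultimately show ?thesis by (simp add: hermitian_psd_def pos_semidef_iff)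
qed

text \<open>
  Eliminate the vertices \<open>S\<close> of the first graph outside the common clique. The eliminated part
  reaches at most the neighbours of \<open>S\<close>, and the remainder vanishes on \<open>S\<close>. On a pair that
  meets \<open>S\<close> the first part therefore agrees with \<open>X\<close>, and the pairs in the clique are not constrained.
  So both parts belong to the cones of the summands.
\<close>

lemma order_le_2_clique_sum:
  fixes G G1 G2 :: "'n::finite ugraph"
  assumes G1: "simple_graph G1" and G2: "simple_graph G2" and sum: "clique_sum G1 G2 G"
    and ord: "order_le_2 G1" "order_le_2 G2"
  shows "order_le_2 G"
  unfolding order_le_2_def
proof (intro allI impI)
  fix X assume X: "extremal G X"
  define C where "C = verts G1 \<inter> verts G2"
  define S where "S = verts G1 - verts G2"
  have V: "verts G = verts G1 \<union> verts G2" and E: "edges G = edges G1 \<union> edges G2"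
    and C1: "\<And>u v. u \<in> C \<Longrightarrow> v \<in> C \<Longrightarrow> u \<noteq> v \<Longrightarrow> {u, v} \<in> edges G1"
    and C2: "\<And>u v. u \<in> C \<Longrightarrow> v \<in> C \<Longrightarrow> u \<noteq> v \<Longrightarrow> {u, v} \<in> edges G2"
    using sum by (auto simp: clique_sum_def clique_def C_def)
  have in1: "u \<in> verts G1 \<and> v \<in> verts G1" if "{u, v} \<in> edges G1" for u v
    using G1 that by (auto simp: simple_graph_def doubleton_eq_iff)
  have in2: "u \<in> verts G2 \<and> v \<in> verts G2" if "{u, v} \<in> edges G2" for u v
    using G2 that by (auto simp: simple_graph_def doubleton_eq_iff)
  have "X \<in> psd_cone G" using X unfolding extremal_def by blast
  then have XG: "X \<in> hermitian_space G" "hermitian_psd X" unfolding psd_cone_iff by blast+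
  have X0: "X $ i $ j = 0" if "i \<notin> verts G \<or> j \<notin> verts G \<or> (i \<noteq> j \<and> {i, j} \<notin> edges G)" for i j
    using XG(1) that unfolding hermitian_space_iff by blast
  obtain y X2 where X2: "hermitian_psd X2"
    "\<And>i j. X $ i $ j = (\<Sum>s\<in>S. cnj (y s $ i) * y s $ j) + X2 $ i $ j"
    "\<And>s j. s \<in> S \<Longrightarrow> X2 $ s $ j = 0" "\<And>b s. \<forall>s\<in>S. X $ s $ b = 0 \<Longrightarrow> s \<in> S \<Longrightarrow> y s $ b = (0::complex)"
    "\<And>c j. \<forall>j. X $ c $ j = 0 \<Longrightarrow> X2 $ c $ j = 0"
    using schur_elimination[of S, OF finite XG(2)] by blast
  define X1 :: "complex^'n^'n" where "X1 = (\<chi> i j. \<Sum>s\<in>S. cnj (y s $ i) * y s $ j)"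
  have X1: "hermitian_psd X1" unfolding X1_def by (rule psd_sum_outer) simp
  have dec: "X = X1 + X2" unfolding X1_def by (simp add: vec_eq_iff X2(2))
  then have dec': "X $ i $ j = X1 $ i $ j + X2 $ i $ j" for i j by simp
  have H1: "hermitian X1" and H2: "hermitian X2" using X1 X2(1) by (auto simp: hermitian_psd_def)
  have X2S: "X2 $ i $ s = 0" if "s \<in> S" for i s
    using X2(3)[OF that, of i] hermitian_cnj[OF H2, of s i] by simp
  have y0: "y s $ b = 0" if "s \<in> S" "b \<notin> verts G1" for s b
  proof (rule X2(4)[OF _ that(1)], rule ballI)
    fix t assume "t \<in> S"
    then have "t \<noteq> b" "{t, b} \<notin> edges G" using that in1[of t b] in2[of t b] E by (auto simp: S_def)
    then show "X $ t $ b = 0" by (intro X0) auto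
  qed
  have X1_0: "X1 $ i $ j = 0" "X1 $ j $ i = 0" if "j \<notin> verts G1" for i j
    using y0[OF _ that] by (simp_all add: X1_def)
  have X1G: "X1 \<in> psd_cone G1"
    unfolding psd_cone_iff hermitian_space_iff
  proof (intro conjI allI impI H1 X1)
    fix i j assume ij: "i \<notin> verts G1 \<or> j \<notin> verts G1 \<or> (i \<noteq> j \<and> {i, j} \<notin> edges G1)"
    show "X1 $ i $ j = 0"
    proof (cases "i \<notin> verts G1 \<or> j \<notin> verts G1")
      case True
      then show ?thesis using X1_0 by blast
    next
      case False
      then have ij: "i \<in> verts G1" "j \<in> verts G1" "i \<noteq> j" "{i, j} \<notin> edges G1" using ij by auto
      then have "i \<in> S \<or> j \<in> S" using C1 by (auto simp: S_def C_def)
      then have "X2 $ i $ j = 0" "{i, j} \<notin> edges G"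
        using X2(3) X2S ij E in2[of i j] by (auto simp: S_def)
      then show ?thesis using dec'[of i j] X0[of i j] ij(3) by simp
    qed
  qed
  have X2G: "X2 \<in> psd_cone G2"
    unfolding psd_cone_iff hermitian_space_iff
  proof (intro conjI allI impI H2 X2(1))
    fix i j assume ij: "i \<notin> verts G2 \<or> j \<notin> verts G2 \<or> (i \<noteq> j \<and> {i, j} \<notin> edges G2)"
    have out: "X2 $ k $ l = 0" if "k \<notin> verts G2" for k l
    proof (cases "k \<in> S")
      case True
      then show ?thesis by (rule X2(3))
    next
      case False
      then have "k \<notin> verts G" using that V by (auto simp: S_def)
      then show ?thesis using X2(5)[of k l] X0 by blast
    qed
    show "X2 $ i $ j = 0"
    proof (cases "i \<notin> verts G2 \<or> j \<notin> verts G2")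
      case True
      then show ?thesis using out[of i j] out[of j i] hermitian_cnj[OF H2, of j i] by auto
    next
      case False
      then have ij: "i \<in> verts G2" "j \<in> verts G2" "i \<noteq> j" "{i, j} \<notin> edges G2" using ij by auto
      then have "i \<notin> verts G1 \<or> j \<notin> verts G1" using C2 by (auto simp: C_def)
      then have "X1 $ i $ j = 0" "{i, j} \<notin> edges G"
        using X1_0 ij E in1[of i j] by auto
      then show ?thesis using dec'[of i j] X0[of i j] ij(3) by simp
    qed
  qed
  have sub: "psd_cone G1 \<subseteq> psd_cone G" "psd_cone G2 \<subseteq> psd_cone G"
  proof -
    have "{i, j} \<notin> edges G2 \<or> {i, j} \<in> edges G1" if "i \<in> verts G1" "j \<in> verts G1" "i \<noteq> j" for i j
      using that in2[of i j] C1[of i j] by (auto simp: C_def)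
    then show "psd_cone G1 \<subseteq> psd_cone G"
      unfolding psd_cone_iff hermitian_space_iff subset_iff V E by blast
    have "{i, j} \<notin> edges G1 \<or> {i, j} \<in> edges G2" if "i \<in> verts G2" "j \<in> verts G2" "i \<noteq> j" for i j
      using that in1[of i j] C2[of i j] by (auto simp: C_def)
    then show "psd_cone G2 \<subseteq> psd_cone G"
      unfolding psd_cone_iff hermitian_space_iff subset_iff V E by blast
  qed
  show "rank X \<le> 2"
    using decomposition_extremal[OF X dec X1G X2G sub] ord by (auto simp: order_le_2_def)
qed

section \<open>Orthogonal projections\<close>

text \<open>
  The orthogonal projection onto the span of \<open>F\<close>; linearity, idempotence and self-adjointness
  follow.
\<close>

definition orth_proj :: "(complex^'n) set \<Rightarrow> (complex^'n \<Rightarrow> complex^'n) \<Rightarrow> bool" where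
  "orth_proj F P \<longleftrightarrow> (\<forall>x. P x \<in> vec.span F \<and> (\<forall>v\<in>F. cinner v (x - P x) = 0))"

lemma cinner_span_eq_0:
  assumes "v \<in> vec.span F" "\<And>v. v \<in> F \<Longrightarrow> cinner v w = 0"
  shows "cinner v w = 0"
  using assms(1)
proof (induction rule: vec.span_induct_alt)
  case base
  then show ?case by simp
next
  case (step c x y)
  then show ?case using assms(2) by (simp add: cinner_add_left cinner_scale_left)
qed

lemma orth_projD:
  assumes "orth_proj F P"
  shows "P x \<in> vec.span F" "v \<in> vec.span F \<Longrightarrow> cinner v (x - P x) = 0"
  using assms cinner_span_eq_0 unfolding orth_proj_def by blast+

text \<open>
  One step of the Gram-Schmidt process for each vector of \<open>F\<close>.
\<close>

lemma orth_proj_exists: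
  assumes "finite F"
  shows "\<exists>P. orth_proj F P"
  using assms
proof (induction F rule: finite_induct)
  case empty
  show ?case by (rule exI[of _ "\<lambda>x. 0"]) (simp add: orth_proj_def)
next
  case (insert v F)
  then obtain P where P: "orth_proj F P" by blast
  \<comment> \<open>If \<open>v\<close> depends on \<open>F\<close>, then \<open>u = 0\<close>, and division by zero leaves \<open>P\<close> unchanged.\<close>
  define u where "u = v - P v"
  define P' where "P' x = P x + (cinner u x / cinner u u) *s u" for x
  have sub: "vec.span F \<subseteq> vec.span (insert v F)" by (rule vec.span_mono) auto
  have PF: "P x \<in> vec.span (insert v F)" for x using orth_projD(1)[OF P, of x] sub by blast
  have "u \<in> vec.span (insert v F)"
    unfolding u_def by (intro vec.span_diff PF vec.span_base) simp
  then have "P' x \<in> vec.span (insert v F)" for x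
    unfolding P'_def by (intro vec.span_add vec.span_scale PF)
  moreover have fu: "cinner f u = 0" if "f \<in> vec.span F" for f
    unfolding u_def by (rule orth_projD(2)[OF P that])
  have uf: "cinner u f = 0" if "f \<in> vec.span F" for f
    using fu[OF that] cinner_commute[of u f] by simp
  have "cinner f (x - P' x) = 0" if "f \<in> insert v F" for f x
  proof (cases "f \<in> F")
    case True
    then have "f \<in> vec.span F" by (rule vec.span_base)
    then show ?thesis
      using fu[of f] orth_projD(2)[OF P, of f x]
      by (simp add: P'_def cinner_diff_right cinner_add_right cinner_scale_right)
  next
    case False
    then have f: "f = u + P v" using that by (simp add: u_def)
    have a: "cinner u (P x) = 0" "cinner (P v) u = 0" "cinner (P v) (x - P x) = 0"
      using uf fu orth_projD[OF P] by blast+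
    have "cinner u u \<noteq> 0 \<or> u = 0" by auto
    then show ?thesis using a
      by (auto simp: P'_def f cinner_add_left cinner_add_right cinner_diff_right cinner_scale_right)
  qed
  ultimately show ?case unfolding orth_proj_def by blast
qed

context
  fixes F :: "(complex^'n) set" and P
  assumes P: "orth_proj F P"
begin

lemma orth_proj_idem: "v \<in> vec.span F \<Longrightarrow> P v = v"
proof -
  assume v: "v \<in> vec.span F"
  have "v - P v \<in> vec.span F" using v orth_projD(1)[OF P] by (intro vec.span_diff)
  then have "cinner (v - P v) (v - P v) = 0" by (rule orth_projD(2)[OF P])
  then show "P v = v" by simp
qed

lemma orth_proj_eq_0:
  assumes "\<And>v. v \<in> F \<Longrightarrow> cinner v x = 0"
  shows "P x = 0"
proof -
  have "cinner (P x) x = 0" by (rule cinner_span_eq_0[OF orth_projD(1)[OF P] assms])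
  moreover have "cinner (P x) (x - P x) = 0" by (rule orth_projD(2)[OF P orth_projD(1)[OF P]])
  ultimately show ?thesis by (simp add: cinner_diff_right)
qed

lemma orth_proj_self_adjoint: "cinner x (P y) = cinner (P x) y"
proof -
  have "cinner (P x) (y - P y) = 0" "cinner (P y) (x - P x) = 0"
    using orth_projD[OF P] by blast+
  then have "cinner (P x) y = cinner (P x) (P y)" "cinner (P y) x = cinner (P y) (P x)"
    by (simp_all add: cinner_diff_right)
  then show ?thesis using cinner_commute[of x "P y"] cinner_commute[of "P x" "P y"] by simp
qed

lemma orth_proj_eqI:
  assumes "\<And>x. cinner x (P y) = cinner x z"
  shows "P y = z"
proof -
  have "cinner (P y - z) (P y - z) = 0" using assms by (simp add: cinner_diff_right)
  then show ?thesis by simp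
qed

lemma orth_proj_add: "P (x + y) = P x + P y"
  by (rule orth_proj_eqI) (simp add: cinner_add_right orth_proj_self_adjoint)

lemma orth_proj_scale: "P (c *s x) = c *s P x"
  by (rule orth_proj_eqI) (simp add: cinner_scale_right orth_proj_self_adjoint)

lemma orth_proj_diff: "P (x - y) = P x - P y"
  by (rule orth_proj_eqI) (simp add: cinner_diff_right orth_proj_self_adjoint)

lemma orth_proj_norm_le: "Re (cinner (P x) (P x)) \<le> Re (cinner x x)"
proof -
  have "cinner (P x) (x - P x) = 0" by (rule orth_projD(2)[OF P orth_projD(1)[OF P]])
  moreover from this have "cinner (x - P x) (P x) = 0" using cinner_commute[of "x - P x" "P x"] by simp
  ultimately have "cinner x x = cinner (P x) (P x) + cinner (x - P x) (x - P x)"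
    by (simp add: cinner_diff_left cinner_diff_right)
  then show ?thesis using cinner_self_ge_0[of "x - P x"] by simp
qed

end

section \<open>Rank bound for two complete bipartite graphs in the complement\<close>

lemma span_pairE:
  assumes "x \<in> vec.span {v, w :: complex^'n}"
  obtains \<alpha> \<beta> where "x = \<alpha> *s v + \<beta> *s w"
proof -
  obtain k where "x - k *s v \<in> vec.span {w}" using assms unfolding vec.span_breakdown_eq[of x v] by blast
  then obtain l where "x - k *s v = l *s w" unfolding vec.span_singleton by blast
  then have "x = k *s v + l *s w" by (simp add: algebra_simps)
  then show thesis by (rule that)
qed

text \<open>
  The columns \<open>a\<close> of a Gram factorization of an extremal matrix whose constraints are those of two
  complete bipartite graphs. The constraints of the first one hold for every Hermitian form that
  commutes with the projection onto the span of the vectors of \<open>A1\<close>, since those of \<open>B1\<close> lie in its kernel.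
\<close>

locale two_projections =
  fixes G :: "'n::finite ugraph" and X :: "complex^'n^'n" and a :: "'n \<Rightarrow> complex^'n"
    and A1 B1 A2 B2 :: "'n set" and P1 P2 :: "complex^'n \<Rightarrow> complex^'n"
  assumes extr: "extremal G X" and gram: "\<And>i j. X $ i $ j = cinner (a i) (a j)"
    and P1: "orth_proj (a ` A1) P1" and P2: "orth_proj (a ` A2) P2"
    and orth1: "\<And>i j. i \<in> A1 \<Longrightarrow> j \<in> B1 \<Longrightarrow> X $ i $ j = 0"
    and orth2: "\<And>i j. i \<in> A2 \<Longrightarrow> j \<in> B2 \<Longrightarrow> X $ i $ j = 0"
    and nonedges: "\<And>i j. i \<in> verts G \<Longrightarrow> j \<in> verts G \<Longrightarrow> i \<noteq> j \<Longrightarrow> {i, j} \<notin> edges G \<Longrightarrow>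
      i \<in> A1 \<and> j \<in> B1 \<or> i \<in> B1 \<and> j \<in> A1 \<or> i \<in> A2 \<and> j \<in> B2 \<or> i \<in> B2 \<and> j \<in> A2"
begin

lemma outside: "i \<notin> verts G \<Longrightarrow> a i = 0"
proof -
  assume i: "i \<notin> verts G"
  have "X \<in> psd_cone G" using extr unfolding extremal_def by blast
  then have "X $ i $ i = 0" using i unfolding psd_cone_iff hermitian_space_iff by blast
  then show "a i = 0" by (simp add: gram)
qed

text \<open>
  A self-adjoint \<open>T\<close> that commutes with both projections perturbs \<open>X\<close> inside its face, so on
  the columns it acts as a real scalar.
\<close>

lemma commuting_form_proportional:
  assumes adj: "\<And>x y. cinner x (T y) = cinner (T x) y"
    and comm: "\<And>x. P1 (T x) = T (P1 x)" "\<And>x. P2 (T x) = T (P2 x)"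
    and bound: "\<And>x. \<bar>Re (cinner (T x) x)\<bar> \<le> M * Re (cinner x x)"
  shows "\<exists>c::real. \<forall>i j. cinner (a i) (T (a j)) = of_real c * X $ i $ j"
proof -
  define Y :: "complex^'n^'n" where "Y = (\<chi> i j. cinner (a i) (T (a j)))"
  have form: "cinner v ((\<chi> i j. cinner (a i) (S (a j))) *v v) = cinner (S (\<Sum>i\<in>UNIV. v $ i *s a i)) (\<Sum>i\<in>UNIV. v $ i *s a i)"
    if S: "\<And>x y. cinner x (S y) = cinner (S x) y" for S v
  proof -
    have "cinner v ((\<chi> i j. cinner (a i) (S (a j))) *v v) =
        (\<Sum>i\<in>UNIV. \<Sum>j\<in>UNIV. cnj (v $ i) * cinner (a i) (S (a j)) * v $ j)"
      by (simp add: cinner_def[of v] matrix_vector_mult_def sum_distrib_left mult.assoc)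
    also have "\<dots> = (\<Sum>j\<in>UNIV. cinner (\<Sum>i\<in>UNIV. v $ i *s a i) (S (a j)) * v $ j)"
      by (subst sum.swap) (simp add: cinner_sum_left cinner_scale_left sum_distrib_right)
    also have "\<dots> = cinner (S (\<Sum>i\<in>UNIV. v $ i *s a i)) (\<Sum>i\<in>UNIV. v $ i *s a i)"
      by (simp add: S cinner_sum_right[of "S _"] cinner_scale_right mult.commute)
    finally show ?thesis .
  qed
  have X: "X = (\<chi> i j. cinner (a i) (a j))" by (simp add: vec_eq_iff gram)
  have T0: "cinner x (T 0) = 0" for x by (simp add: adj)
  have "cinner (a i) (T (a j)) = cnj (cinner (a j) (T (a i)))" for i j
    by (rule trans[OF adj cinner_commute])
  then have "hermitian Y" unfolding hermitian_def Y_def vec_lambda_beta by blast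
  moreover have "Y $ i $ j = 0" if "i \<notin> verts G \<or> j \<notin> verts G \<or> (i \<noteq> j \<and> {i, j} \<notin> edges G)" for i j
  proof (cases "i \<notin> verts G \<or> j \<notin> verts G")
    case True
    then show ?thesis using outside[of i] outside[of j] T0 by (auto simp: Y_def)
  next
    case False
    have block: "cinner (a k) (T (a l)) = 0 \<and> cinner (a l) (T (a k)) = 0"
      if P: "orth_proj (a ` A) P" "\<And>x. P (T x) = T (P x)" and kl: "k \<in> A" "l \<in> B"
        and orth: "\<And>i j. i \<in> A \<Longrightarrow> j \<in> B \<Longrightarrow> X $ i $ j = 0" for A B P k l
    proof -
      have "P (a k) = a k" by (rule orth_proj_idem[OF P(1) vec.span_base]) (use kl in auto)
      moreover have "P (a l) = 0"
        by (rule orth_proj_eq_0[OF P(1)]) (use orth kl(2) gram in auto)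
      ultimately have "cinner (a k) (T (a l)) = 0"
        using orth_proj_self_adjoint[OF P(1), of "a k" "T (a l)"] P(2)[of "a l"] T0 by simp
      moreover from this have "cinner (T (a k)) (a l) = 0" using adj[of "a k" "a l"] by simp
      then have "cinner (a l) (T (a k)) = 0" by (subst cinner_commute) simp
      ultimately show ?thesis by blast
    qed
    from False that have "i \<in> A1 \<and> j \<in> B1 \<or> i \<in> B1 \<and> j \<in> A1 \<or> i \<in> A2 \<and> j \<in> B2 \<or> i \<in> B2 \<and> j \<in> A2"
      using nonedges[of i j] by blast
    then show ?thesis
      unfolding Y_def using block[OF P1 comm(1) _ _ orth1] block[OF P2 comm(2) _ _ orth2] by auto
  qed
  ultimately have "Y \<in> hermitian_space G" unfolding hermitian_space_iff by blast
  moreover have "\<bar>Re (cinner x (Y *v x))\<bar> \<le> M * Re (cinner x (X *v x))" for x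
    using bound[of "\<Sum>i\<in>UNIV. x $ i *s a i"] form[of T x, OF adj] form[of "\<lambda>x. x" x] by (simp add: Y_def X)
  ultimately obtain c where "Y = c *\<^sub>R X" using extremal_perturbation[OF extr] by blast
  then have "cinner (a i) (T (a j)) = of_real c * X $ i $ j" for i j
    by (simp add: Y_def vec_eq_iff scaleR_conv_of_real[where 'a = complex])
  then show ?thesis by blast
qed

text \<open>
  A subspace that is invariant under both projections has a projection \<open>Q\<close> that commutes with
  them. Extremality makes \<open>Q\<close> a scalar on the columns, and the scalar is 1 because one column lies in
  the subspace.
\<close>

lemma rank_le_2_if_invariant:
  assumes i: "a i \<noteq> 0" and inv: "P1 (a i) \<in> vec.span {a i, w}" "P1 w \<in> vec.span {a i, w}"
    "P2 (a i) \<in> vec.span {a i, w}" "P2 w \<in> vec.span {a i, w}"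
  shows "rank X \<le> 2"
proof -
  define v where "v = a i"
  obtain Q where Q: "orth_proj {v, w} Q" using orth_proj_exists[of "{v, w}"] by auto
  have commute: "P (Q x) = Q (P x)"
    if P: "orth_proj F P" and inv: "P v \<in> vec.span {v, w}" "P w \<in> vec.span {v, w}" for P F x
  proof -
    have *: "Q (P (Q x)) = P (Q x)" for x
    proof (rule orth_proj_idem[OF Q])
      obtain \<alpha> \<beta> where "Q x = \<alpha> *s v + \<beta> *s w" using orth_projD(1)[OF Q, of x] by (rule span_pairE)
      then have "P (Q x) = \<alpha> *s P v + \<beta> *s P w" by (simp add: orth_proj_add[OF P] orth_proj_scale[OF P])
      then show "P (Q x) \<in> vec.span {v, w}" using inv by (simp add: vec.span_add vec.span_scale)
    qed
    show ?thesis
    proof (rule orth_proj_eqI[OF P])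
      fix y
      have "cinner y (P (Q x)) = cinner y (Q (P (Q x)))" by (simp add: *)
      also have "\<dots> = cinner (Q (P (Q y))) x"
        by (simp add: orth_proj_self_adjoint[OF P] orth_proj_self_adjoint[OF Q])
      also have "\<dots> = cinner (P (Q y)) x" by (simp add: *)
      also have "\<dots> = cinner y (Q (P x))"
        by (simp add: orth_proj_self_adjoint[OF P] orth_proj_self_adjoint[OF Q])
      finally show "cinner y (P (Q x)) = cinner y (Q (P x))" .
    qed
  qed
  have "cinner (Q x) x = cinner (Q x) (Q x)" for x
    using orth_projD(2)[OF Q orth_projD(1)[OF Q], of x x] by (simp add: cinner_diff_right)
  then have "\<bar>Re (cinner (Q x) x)\<bar> \<le> 1 * Re (cinner x x)" for x
    using cinner_self_ge_0[of "Q x"] orth_proj_norm_le[OF Q, of x] by simp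
  then obtain c :: real where c: "\<And>i j. cinner (a i) (Q (a j)) = of_real c * X $ i $ j"
    using commuting_form_proportional[of Q, OF orth_proj_self_adjoint[OF Q]]
      commute[OF P1] commute[OF P2] inv unfolding v_def[symmetric] by blast
  have "Q v = v" by (rule orth_proj_idem[OF Q vec.span_base]) simp
  then have "cinner v v = of_real c * cinner v v" using c[of i i] by (simp add: gram v_def)
  then have "c = 1" using i by (simp add: v_def)
  then have XQ: "X $ k $ j = cinner (Q (a k)) (a j)" for k j
    using c[of k j] by (simp add: orth_proj_self_adjoint[OF Q])
  have "\<exists>\<alpha> \<beta>. Q x = \<alpha> *s v + \<beta> *s w" for x
    using orth_projD(1)[OF Q, of x] by (rule span_pairE) blast
  then obtain \<alpha> \<beta> where "\<And>x. Q x = \<alpha> x *s v + \<beta> x *s w" by metis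
  then have "X $ k $ j = cnj (\<alpha> (a k)) * (\<chi> j. cinner v (a j)) $ j + cnj (\<beta> (a k)) * (\<chi> j. cinner w (a j)) $ j" for k j
    unfolding XQ by (simp add: cinner_add_left cinner_scale_left)
  then show ?thesis by (rule rank_le_2I)
qed

text \<open>
  The square \<open>(P1 - P2)\<^sup>2\<close> commutes with both projections. Where it acts as the scalar \<open>c\<close>, a
  vector \<open>v\<close> fixed by \<open>P1\<close> satisfies \<open>P1 (P2 v) = (1 - c) v\<close>, so \<open>v\<close> and \<open>P2 v\<close> span an invariant
  subspace.
\<close>

lemma rank_le_2: "rank X \<le> 2"
proof -
  have trivial: "P x = 0" if "orth_proj (a ` A) P" "\<forall>i\<in>A. a i = 0" for P A x
    by (rule orth_proj_eq_0[OF that(1)]) (use that(2) in auto)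
  consider i where "i \<in> A1" "a i \<noteq> 0" | i where "\<forall>i\<in>A1. a i = 0" "i \<in> A2" "a i \<noteq> 0"
    | "\<forall>i\<in>A1. a i = 0" "\<forall>i\<in>A2. a i = 0" by blast
  then show ?thesis
  proof cases
    case (1 i)
    define v where "v = a i"
    \<comment> \<open>This is \<open>(P1 - P2)\<^sup>2\<close>.\<close>
    define T where "T x = P1 (P1 x - P2 x) - P2 (P1 x - P2 x)" for x
    note lin1 = orth_proj_diff[OF P1] and lin2 = orth_proj_diff[OF P2]
    have idem: "P1 (P1 x) = P1 x" "P2 (P2 x) = P2 x" for x
      using orth_proj_idem[OF P1 orth_projD(1)[OF P1]] orth_proj_idem[OF P2 orth_projD(1)[OF P2]] by auto
    have adj: "cinner x (T y) = cinner (T x) y" for x y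
      unfolding T_def cinner_diff_right cinner_diff_left
        orth_proj_self_adjoint[OF P1, symmetric] orth_proj_self_adjoint[OF P2, symmetric]
      by (simp add: lin1 lin2 cinner_diff_right)
    have comm: "P1 (T x) = T (P1 x)" "P2 (T x) = T (P2 x)" for x
      by (simp_all add: T_def lin1 lin2 idem)
    have "\<bar>Re (cinner (T x) x)\<bar> \<le> 4 * Re (cinner x x)" for x
    proof -
      define p where "p = P1 x" define q where "q = P2 x"
      have "cinner (T x) x = cinner (P1 (p - q)) x - cinner (P2 (p - q)) x"
        by (simp add: T_def p_def q_def cinner_diff_left)
      also have "\<dots> = cinner (p - q) (P1 x) - cinner (p - q) (P2 x)"
        by (simp only: orth_proj_self_adjoint[OF P1] orth_proj_self_adjoint[OF P2])
      also have "\<dots> = cinner (p - q) (p - q)" by (simp add: p_def q_def cinner_diff_right)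
      finally have "cinner (T x) x = cinner (p - q) (p - q)" .
      moreover have "Re (cinner (p - q) (p - q)) + Re (cinner (p + q) (p + q)) = 2 * Re (cinner p p) + 2 * Re (cinner q q)"
        by (simp add: cinner_diff_right cinner_diff_left cinner_add_right cinner_add_left)
      moreover have "Re (cinner p p) \<le> Re (cinner x x)" "Re (cinner q q) \<le> Re (cinner x x)"
        unfolding p_def q_def by (rule orth_proj_norm_le[OF P1], rule orth_proj_norm_le[OF P2])
      ultimately show ?thesis
        using cinner_self_ge_0[of "p - q"] cinner_self_ge_0[of "p + q"] by simp
    qed
    then obtain c :: real where c: "\<And>k j. cinner (a k) (T (a j)) = of_real c * X $ k $ j"
      using commuting_form_proportional[of T, OF adj comm] by blast
    have vF: "v \<in> vec.span (a ` A1)" unfolding v_def by (rule vec.span_base) (use 1 in auto)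
    have P1v: "P1 v = v" by (rule orth_proj_idem[OF P1 vF])
    \<comment> \<open>The scalar action is known only after pairing with the columns; as \<open>z\<close> lies in their span, it vanishes.\<close>
    define z where "z = v - P1 (P2 v) - of_real c *s v"
    have Tv: "T v = v - P1 (P2 v)" by (simp add: T_def lin1 lin2 idem P1v)
    have "cinner (a k) z = 0" for k
    proof -
      have "cinner (a k) (T v) = of_real c * cinner (a k) v" using c[of k i] by (simp add: gram v_def)
      then show ?thesis by (simp add: z_def Tv cinner_diff_right cinner_scale_right)
    qed
    moreover have "z \<in> vec.span (a ` A1)"
      unfolding z_def using vF orth_projD(1)[OF P1] by (intro vec.span_diff vec.span_scale)
    ultimately have "cinner z z = 0" by (intro cinner_span_eq_0[of z]) auto
    then have "z = 0" by simp
    then have "P1 (P2 v) = v - of_real c *s v" by (simp add: z_def algebra_simps)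
    moreover have "v \<in> vec.span {v, P2 v}" "P2 v \<in> vec.span {v, P2 v}" by (simp_all add: vec.span_base)
    ultimately show ?thesis
      using rank_le_2_if_invariant[of i "P2 v"] 1 P1v idem
      by (simp add: v_def[symmetric] vec.span_diff vec.span_scale)
  next
    case (2 i)
    have "P2 (a i) = a i" by (rule orth_proj_idem[OF P2 vec.span_base]) (use 2 in auto)
    then show ?thesis
      using rank_le_2_if_invariant[of i "a i"] 2 trivial[OF P1 2(1)] by (simp add: vec.span_base vec.span_zero)
  next
    case 3
    have "X \<noteq> 0" using extr unfolding extremal_def by blast
    moreover have "X = 0" if "\<forall>i. a i = 0"
      unfolding vec_eq_iff gram using that by simp
    ultimately obtain i where "a i \<noteq> 0" by blast
    then show ?thesis
      using rank_le_2_if_invariant[of i "a i"] trivial[OF P1 3(1)] trivial[OF P2 3(2)]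
      by (simp add: vec.span_zero)
  qed
qed

end

lemma order_le_2_two_biclique_complement:
  fixes G :: "'n::finite ugraph"
  assumes clq: "\<And>i j. i \<in> A1 \<Longrightarrow> j \<in> B1 \<Longrightarrow> i \<noteq> j \<and> {i, j} \<notin> edges G"
      "\<And>i j. i \<in> A2 \<Longrightarrow> j \<in> B2 \<Longrightarrow> i \<noteq> j \<and> {i, j} \<notin> edges G"
    and nonedges: "\<And>i j. i \<in> verts G \<Longrightarrow> j \<in> verts G \<Longrightarrow> i \<noteq> j \<Longrightarrow> {i, j} \<notin> edges G \<Longrightarrow>
      i \<in> A1 \<and> j \<in> B1 \<or> i \<in> B1 \<and> j \<in> A1 \<or> i \<in> A2 \<and> j \<in> B2 \<or> i \<in> B2 \<and> j \<in> A2"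
  shows "order_le_2 G"
  unfolding order_le_2_def
proof (intro allI impI)
  fix X assume X: "extremal G X"
  then have "X \<in> psd_cone G" unfolding extremal_def by blast
  then have XG: "X \<in> hermitian_space G" "hermitian_psd X" unfolding psd_cone_iff by blast+
  obtain a :: "'n \<Rightarrow> complex^'n" where gram: "\<And>i j. X $ i $ j = cinner (a i) (a j)" using gram_factorization[OF XG(2)] by blast
  obtain P1 P2 where "orth_proj (a ` A1) P1" "orth_proj (a ` A2) P2"
    using orth_proj_exists[of "a ` A1"] orth_proj_exists[of "a ` A2"] by auto
  then interpret two_projections G X a A1 B1 A2 B2 P1 P2
    using X gram nonedges clq XG(1) unfolding hermitian_space_iff by unfold_locales blast+
  show "rank X \<le> 2" by (rule rank_le_2)
qed

lemma order_le_2_K2: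
  assumes "in_K2 G"
  shows "order_le_2 G"
proof -
  obtain A1 B1 A2 B2 Z where V: "verts G = (\<Union>i<5. [A1, B1, A2, B2, Z] ! i)"
    and disj: "disjoint_family_on ((!) [A1, B1, A2, B2, Z]) {..<5}"
    and cl: "\<forall>i<5. clique G ([A1, B1, A2, B2, Z] ! i)"
    and ne': "\<forall>i<5. \<forall>j<5. i \<noteq> j \<longrightarrow> (\<forall>u\<in>[A1, B1, A2, B2, Z] ! i. \<forall>v\<in>[A1, B1, A2, B2, Z] ! j.
      {u, v} \<notin> edges G \<longleftrightarrow> (\<exists>(X, Y)\<in>{(A1, B1), (A2, B2)}. u \<in> X \<and> v \<in> Y \<or> u \<in> Y \<and> v \<in> X))"
    using assms unfolding in_K2_def Let_def by (elim conjE exE) (rule that)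
  have ne: "{u, v} \<notin> edges G \<longleftrightarrow> u \<in> A1 \<and> v \<in> B1 \<or> u \<in> B1 \<and> v \<in> A1 \<or> u \<in> A2 \<and> v \<in> B2 \<or> u \<in> B2 \<and> v \<in> A2"
    if "i < 5" "j < 5" "i \<noteq> j" "u \<in> [A1, B1, A2, B2, Z] ! i" "v \<in> [A1, B1, A2, B2, Z] ! j" for i j u v
    using ne'[rule_format, OF that] by simp
  have disj2: "A1 \<inter> B1 = {}" "A2 \<inter> B2 = {}"
    using disjoint_family_onD[OF disj, of 0 1] disjoint_family_onD[OF disj, of 2 3] by simp_all
  show ?thesis
  proof (rule order_le_2_two_biclique_complement[of A1 B1 G A2 B2])
    show "i \<noteq> j \<and> {i, j} \<notin> edges G" if "i \<in> A1" "j \<in> B1" for i j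
      using that disj2 ne[of 0 1 i j] by auto
    show "i \<noteq> j \<and> {i, j} \<notin> edges G" if "i \<in> A2" "j \<in> B2" for i j
      using that disj2 ne[of 2 3 i j] by auto
    fix i j assume ij: "i \<in> verts G" "j \<in> verts G" "i \<noteq> j" "{i, j} \<notin> edges G"
    then obtain k l where kl: "k < 5" "l < 5" "i \<in> [A1, B1, A2, B2, Z] ! k" "j \<in> [A1, B1, A2, B2, Z] ! l"
      unfolding V by blast
    have "k \<noteq> l" using cl[rule_format, OF kl(1)] kl ij(3,4) by (auto simp: clique_def)
    then show "i \<in> A1 \<and> j \<in> B1 \<or> i \<in> B1 \<and> j \<in> A1 \<or> i \<in> A2 \<and> j \<in> B2 \<or> i \<in> B2 \<and> j \<in> A2"
      using ne[OF kl(1,2) _ kl(3,4)] ij(4) by auto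
  qed
qed

section \<open>Rank bound for three disjoint edges in the complement\<close>

lemma independent_rows_exist:
  fixes X :: "complex^'n::finite^'n"
  assumes "k \<le> rank X"
  shows "\<exists>p :: nat \<Rightarrow> 'n. \<forall>c. (\<forall>j. (\<Sum>l<k. c l * X $ p l $ j) = 0) \<longrightarrow> (\<forall>l<k. c l = 0)"
proof -
  obtain B where B: "B \<subseteq> rows X" "vec.independent B" "card B = vec.dim (rows X)"
    using vec.basis_exists by metis
  have "k \<le> card B" using assms B(3) by (simp add: row_rank_def_gen)
  then obtain B' where B': "B' \<subseteq> B" "card B' = k" "finite B'"
    using obtain_subset_with_card_n by metis
  obtain e where e: "bij_betw e {..<k} B'" using B'(2,3) ex_bij_betw_nat_finite[of B'] by (auto simp: lessThan_atLeast0)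
  have ind: "vec.independent B'" using B(2) B'(1) by (rule vec.independent_mono)
  have "\<forall>l\<in>{..<k}. \<exists>p. e l = row p X"
    using e B'(1) B(1) by (auto simp: bij_betw_def rows_def)
  then obtain p where p: "\<And>l. l < k \<Longrightarrow> e l = row (p l) X" by (metis lessThan_iff)
  have "c l = 0" if c: "\<forall>j. (\<Sum>l<k. c l * X $ p l $ j) = 0" and l: "l < k" for c l
  proof -
    define u where "u = c \<circ> the_inv_into {..<k} e"
    have inj: "inj_on e {..<k}" and im: "e ` {..<k} = B'" using e by (auto simp: bij_betw_def)
    have ue: "u (e l) = c l" if "l < k" for l
      using that the_inv_into_f_f[OF inj, of l] by (simp add: u_def)
    have "(\<Sum>b\<in>B'. u b *s b) = (\<Sum>l<k. u (e l) *s e l)"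
      unfolding im[symmetric] by (rule sum.reindex_cong[OF inj refl]) simp
    also have "\<dots> = (\<Sum>l<k. c l *s row (p l) X)" by (rule sum.cong[OF refl]) (metis lessThan_iff ue p)
    also have "\<dots> = 0" using c by (simp add: vec_eq_iff row_def)
    finally have "u (e l) = 0"
      using im l by (intro vec.independentD[OF ind B'(3) subset_refl]) auto
    then show ?thesis using ue[OF l] by simp
  qed
  then show ?thesis by blast
qed

type_synonym herm3 = "real \<times> real \<times> real \<times> complex \<times> complex \<times> complex"

text \<open>
  The Hermitian matrix of size 3 with diagonal \<open>a, b, c\<close> and entries \<open>u, v, w\<close> above it.
  The product type makes its nine real parameters visible to \<open>DIM\<close>.
\<close>

definition herm3 :: "herm3 \<Rightarrow> nat \<Rightarrow> nat \<Rightarrow> complex" where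
  "herm3 = (\<lambda>(a, b, c, u, v, w) k l. [[of_real a, u, v], [cnj u, of_real b, w], [cnj v, cnj w, of_real c]] ! k ! l)"

lemma lt3: "(k::nat) < 3 \<longleftrightarrow> k = 0 \<or> k = 1 \<or> k = 2"
  by auto

lemma herm3_cnj: "k < 3 \<Longrightarrow> l < 3 \<Longrightarrow> cnj (herm3 z k l) = herm3 z l k"
  by (cases z) (auto simp: herm3_def lt3)

lemma herm3_add: "k < 3 \<Longrightarrow> l < 3 \<Longrightarrow> herm3 (z + z') k l = herm3 z k l + herm3 z' k l"
  by (cases z; cases z') (auto simp: herm3_def lt3)

lemma herm3_scaleR: "k < 3 \<Longrightarrow> l < 3 \<Longrightarrow> herm3 (r *\<^sub>R z) k l = of_real r * herm3 z k l"
  by (cases z) (auto simp: herm3_def lt3 scaleR_conv_of_real)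

lemma herm3_eq_0: "(\<And>k l. k < 3 \<Longrightarrow> l < 3 \<Longrightarrow> herm3 z k l = 0) \<Longrightarrow> z = 0"
proof (cases z)
  fix a b c u v w
  assume h: "\<And>k l. k < 3 \<Longrightarrow> l < 3 \<Longrightarrow> herm3 z k l = 0" and z: "z = (a, b, c, u, v, w)"
  show "z = 0"
    using h[of 0 0] h[of 1 1] h[of 2 2] h[of 0 1] h[of 0 2] h[of 1 2] by (simp add: z herm3_def zero_prod_def)
qed

text \<open>
  Suppose that three rows of \<open>X\<close> are independent. The Hermitian combinations of their outer products
  form a space of real dimension 9 inside the face of \<open>X\<close>. Three complex equations for the constraints
  and one real equation that makes a diagonal entry vanish at a place where \<open>X\<close> has a positive entry
  leave a non-zero solution. Being a multiple of \<open>X\<close>, it is the zero matrix, which contradicts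
  independence.
\<close>

lemma order_le_2_three_co_edges:
  fixes G :: "'n::finite ugraph"
  assumes nonedges: "\<And>i j. i \<in> verts G \<Longrightarrow> j \<in> verts G \<Longrightarrow> i \<noteq> j \<Longrightarrow> {i, j} \<notin> edges G \<Longrightarrow>
      {i, j} \<in> {{x1, y1}, {x2, y2}, {x3, y3}}"
  shows "order_le_2 G"
  unfolding order_le_2_def
proof (intro allI impI)
  fix X assume X: "extremal G X"
  show "rank X \<le> 2"
  proof (rule ccontr)
    assume "\<not> rank X \<le> 2"
    then have "3 \<le> rank X" by simp
    then obtain p where p: "\<And>c l. \<forall>j. (\<Sum>l<3. c l * X $ p l $ j) = 0 \<Longrightarrow> l < (3::nat) \<Longrightarrow> c l = 0"
      using independent_rows_exist[of 3 X] by blast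
    have "X \<in> psd_cone G" using X unfolding extremal_def by blast
    then have XG: "X \<in> hermitian_space G" "hermitian_psd X" unfolding psd_cone_iff by blast+
    have XH: "hermitian X" using XG by (simp add: hermitian_psd_def)
    have X0: "X $ i $ j = 0" if "i \<notin> verts G \<or> j \<notin> verts G" for i j
      using XG(1) that unfolding hermitian_space_iff by blast
    obtain d where d: "X $ d $ d \<noteq> 0"
    proof -
      have "X \<noteq> 0" using X unfolding extremal_def by blast
      then obtain i j where "X $ i $ j \<noteq> 0" by (auto simp: vec_eq_iff)
      then show thesis using that psd_zero_row[OF XG(2)] by blast
    qed
    define Y :: "herm3 \<Rightarrow> 'n \<Rightarrow> 'n \<Rightarrow> complex" where
      "Y z i j = (\<Sum>k<3. \<Sum>l<3. herm3 z k l * (cnj (X $ p k $ i) * X $ p l $ j))" for z i j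
    have Y_add: "Y (z + z') i j = Y z i j + Y z' i j" for z z' i j
      unfolding Y_def sum.distrib[symmetric] by (intro sum.cong refl) (simp add: herm3_add algebra_simps)
    have Y_scale: "Y (r *\<^sub>R z) i j = of_real r * Y z i j" for r z i j
      unfolding Y_def sum_distrib_left by (intro sum.cong refl) (simp add: herm3_scaleR algebra_simps)
    have Y_cnj: "cnj (Y z i j) = Y z j i" for z i j
    proof -
      have "cnj (Y z i j) = (\<Sum>k<3. \<Sum>l<3. herm3 z l k * (cnj (X $ p l $ j) * X $ p k $ i))"
        unfolding Y_def cnj_sum by (intro sum.cong refl) (simp add: herm3_cnj mult_ac)
      also have "\<dots> = Y z j i" unfolding Y_def by (rule sum.swap)
      finally show ?thesis .
    qed
    \<comment> \<open>The last coordinate forces the multiple of \<open>X\<close> to be zero.\<close>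
    define L :: "herm3 \<Rightarrow> complex \<times> complex \<times> complex \<times> real" where
      "L z = (Y z x1 y1, Y z x2 y2, Y z x3 y3, Re (Y z d d))" for z
    have L: "linear L"
      by (rule linearI) (simp_all add: L_def Y_add Y_scale scaleR_conv_of_real[where 'a = complex])
    have "\<not> inj L"
    proof
      assume "inj L"
      then have "dim (range L) = dim (UNIV :: herm3 set)"
        by (intro dim_image_eq[OF L]) (simp add: inj_on_subset)
      moreover have "dim (range L) \<le> DIM(complex \<times> complex \<times> complex \<times> real)" by (rule dim_subset_UNIV)
      ultimately show False by simp
    qed
    then obtain z where z: "z \<noteq> 0" "L z = 0" using linear_injective_0[OF L] by blast
    define M :: "complex^'n^'n" where "M = (\<chi> i j. Y z i j)"
    have MH: "hermitian M" unfolding hermitian_def M_def by (simp add: Y_cnj)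
    have "M \<in> hermitian_space G"
      unfolding hermitian_space_iff
    proof (intro conjI MH allI impI)
      fix i j assume ij: "i \<notin> verts G \<or> j \<notin> verts G \<or> (i \<noteq> j \<and> {i, j} \<notin> edges G)"
      show "M $ i $ j = 0"
      proof (cases "i \<notin> verts G \<or> j \<notin> verts G")
        case True
        then have "(\<forall>k. X $ p k $ i = 0) \<or> (\<forall>k. X $ p k $ j = 0)" using X0 by blast
        then show ?thesis by (auto simp: M_def Y_def)
      next
        case False
        then have "{i, j} \<in> {{x1, y1}, {x2, y2}, {x3, y3}}" using ij nonedges by blast
        moreover have "Y z x1 y1 = 0" "Y z x2 y2 = 0" "Y z x3 y3 = 0"
          using z(2) by (auto simp: L_def zero_prod_def)
        moreover from this have "Y z y1 x1 = 0" "Y z y2 x2 = 0" "Y z y3 x3 = 0"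
          using Y_cnj by (metis complex_cnj_zero)+
        ultimately show ?thesis by (auto simp: M_def doubleton_eq_iff)
      qed
    qed
    moreover have "\<exists>K. \<forall>x. \<bar>Re (cinner x (M *v x))\<bar> \<le> K * Re (cinner x (X *v x))"
    proof -
      define D where "D = (\<Sum>k<3. Re (X $ p k $ p k))"
      have Dk: "Re (X $ p k $ p k) \<le> D" "0 \<le> D" if "k < 3" for k
        unfolding D_def using that psd_diag_ge_0[OF XG(2)] by (auto intro: member_le_sum sum_nonneg)
      have "\<bar>Re (cinner x (M *v x))\<bar> \<le> (\<Sum>k<3. \<Sum>l<3. cmod (herm3 z k l) * D) * Re (cinner x (X *v x))" for x
      proof -
        define q where "q = Re (cinner x (X *v x))"
        have q: "0 \<le> q" unfolding q_def by (rule hermitian_psd_ge_0[OF XG(2)])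
        define s where "s k = (X *v x) $ p k" for k
        have s: "(\<Sum>j\<in>UNIV. X $ p k $ j * x $ j) = s k" for k by (simp add: s_def matrix_vector_mult_def)
        have s2: "cmod (s k) \<le> sqrt (D * q)" if "k < 3" for k
        proof (rule real_le_rsqrt)
          have "(cmod (s k))\<^sup>2 \<le> Re (X $ p k $ p k) * q" unfolding s_def q_def by (rule psd_entry_bound[OF XG(2)])
          also have "\<dots> \<le> D * q" by (rule mult_right_mono[OF Dk(1)[OF that] q])
          finally show "(cmod (s k))\<^sup>2 \<le> D * q" .
        qed
        have "cinner x (M *v x) = (\<Sum>i\<in>UNIV. \<Sum>j\<in>UNIV. \<Sum>k<3. \<Sum>l<3.
            herm3 z k l * (cnj (X $ p k $ i * x $ i) * (X $ p l $ j * x $ j)))"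
          by (simp add: cinner_def matrix_vector_mult_def M_def Y_def sum_distrib_left sum_distrib_right mult_ac)
        also have "\<dots> = (\<Sum>k<3. \<Sum>l<3. \<Sum>i\<in>UNIV. \<Sum>j\<in>UNIV.
            herm3 z k l * (cnj (X $ p k $ i * x $ i) * (X $ p l $ j * x $ j)))"
          by (simp only: sum.swap[of _ "{..<3}" UNIV])
        also have "\<dots> = (\<Sum>k<3. \<Sum>l<3. herm3 z k l * (cnj (s k) * s l))"
        proof -
          have "cnj (s k) * s l = (\<Sum>i\<in>UNIV. \<Sum>j\<in>UNIV. cnj (X $ p k $ i * x $ i) * (X $ p l $ j * x $ j))" for k l
            unfolding s[symmetric] cnj_sum by (rule sum_product)
          then show ?thesis by (simp only: sum_distrib_left)
        qed
        finally have "\<bar>Re (cinner x (M *v x))\<bar> \<le> cmod (\<Sum>k<3. \<Sum>l<3. herm3 z k l * (cnj (s k) * s l))"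
          by (simp only: abs_Re_le_cmod)
        also have "\<dots> \<le> (\<Sum>k<3. \<Sum>l<3. cmod (herm3 z k l * (cnj (s k) * s l)))"
          by (intro order_trans[OF norm_sum] sum_mono norm_sum)
        also have "\<dots> \<le> (\<Sum>k<3. \<Sum>l<3. cmod (herm3 z k l) * (D * q))"
        proof (intro sum_mono)
          fix k l assume "k \<in> {..<3::nat}" "l \<in> {..<3::nat}"
          then have "cmod (s k) * cmod (s l) \<le> sqrt (D * q) * sqrt (D * q)"
            by (intro mult_mono s2) (use q Dk(2)[of 0] in auto)
          also have "\<dots> = D * q" using q Dk(2)[of 0] by simp
          finally show "cmod (herm3 z k l * (cnj (s k) * s l)) \<le> cmod (herm3 z k l) * (D * q)"
            by (simp add: norm_mult mult_left_mono)
        qed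
        finally show ?thesis by (simp add: q_def sum_distrib_right mult.assoc)
      qed
      then show ?thesis by blast
    qed
    ultimately obtain c where c: "M = c *\<^sub>R X" using extremal_perturbation[OF X] by blast
    have "Re (M $ d $ d) = 0" using z(2) by (simp add: M_def L_def zero_prod_def)
    then have "c * Re (X $ d $ d) = 0" by (simp add: c)
    moreover have "Re (X $ d $ d) \<noteq> 0" using d hermitian_diag_real[OF XH, of d] by (metis of_real_0)
    ultimately have "M = 0" using c by simp
    then have Y0: "Y z i j = 0" for i j by (simp add: M_def vec_eq_iff)
    have "herm3 z k l = 0" if kl: "k < 3" "l < 3" for k l
    proof -
      have row: "(\<Sum>k<3. herm3 z k l * cnj (X $ p k $ i)) = 0" if "l < 3" for l i
      proof (rule p[OF _ that, of "\<lambda>l. \<Sum>k<3. herm3 z k l * cnj (X $ p k $ i)"], rule allI)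
        fix j
        have "(\<Sum>l<3. (\<Sum>k<3. herm3 z k l * cnj (X $ p k $ i)) * X $ p l $ j) = Y z i j"
          unfolding Y_def by (subst sum.swap) (simp add: sum_distrib_right mult.assoc)
        then show "(\<Sum>l<3. (\<Sum>k<3. herm3 z k l * cnj (X $ p k $ i)) * X $ p l $ j) = 0"
          using Y0 by simp
      qed
      have "cnj (herm3 z k l) = 0"
      proof (rule p[OF _ kl(1), of "\<lambda>k. cnj (herm3 z k l)"], rule allI)
        fix i
        have "(\<Sum>k<3. cnj (herm3 z k l) * X $ p k $ i) = cnj (\<Sum>k<3. herm3 z k l * cnj (X $ p k $ i))"
          by (simp add: cnj_sum)
        then show "(\<Sum>k<3. cnj (herm3 z k l) * X $ p k $ i) = 0" using row[OF kl(2)] by simp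
      qed
      then show ?thesis by simp
    qed
    then have "z = 0" by (rule herm3_eq_0)
    then show False using z(1) by simp
  qed
qed

lemma order_le_2_K3:
  assumes "in_K3 G"
  shows "order_le_2 G"
proof -
  obtain x1 y1 x2 y2 x3 y3 where "\<forall>u\<in>verts G. \<forall>v\<in>verts G. u \<noteq> v \<longrightarrow>
     ({u, v} \<notin> edges G \<longleftrightarrow> {u, v} \<in> {{x1, y1}, {x2, y2}, {x3, y3}})"
    using assms unfolding in_K3_def by (elim conjE exE) (rule that)
  then show ?thesis by (intro order_le_2_three_co_edges[of G x1 y1 x2 y2 x3 y3]) blast
qed

lemma simple_graph_clique_sum:
  assumes G1: "simple_graph G1" and G2: "simple_graph G2" and sum: "clique_sum G1 G2 G"
  shows "simple_graph G"
proof -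
  have V: "verts G = verts G1 \<union> verts G2" and E: "edges G = edges G1 \<union> edges G2"
    using sum by (simp_all add: clique_sum_def)
  have "\<exists>u v. e = {u, v} \<and> u \<in> verts G \<and> v \<in> verts G \<and> u \<noteq> v" if "e \<in> edges G" for e
  proof -
    have "e \<in> edges G1 \<or> e \<in> edges G2" using that E by simp
    then show ?thesis
    proof
      assume "e \<in> edges G1"
      then show ?thesis by (rule simple_graph_edgeE[OF G1]) (use V in blast)
    next
      assume "e \<in> edges G2"
      then show ?thesis by (rule simple_graph_edgeE[OF G2]) (use V in blast)
    qed
  qed
  moreover have "finite (verts G)" using G1 G2 V by (simp add: simple_graph_def)
  ultimately show ?thesis unfolding simple_graph_def by blast
qed

lemma simple_if_basic: "in_K2 G \<or> in_K3 G \<Longrightarrow> simple_graph G"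
  unfolding in_K2_def in_K3_def by (elim disjE; rule conjunct1)

theorem order_le_2_if_clique_sum_of:
  assumes "clique_sum_of (\<lambda>H. in_K2 H \<or> in_K3 H) G"
  shows "order_le_2 G"
proof -
  have "simple_graph G \<and> order_le_2 G"
    using assms
  proof induction
    case (single G)
    then show ?case using order_le_2_K2 order_le_2_K3 simple_if_basic by blast
  next
    case (sum G1 G2 G)
    then show ?case using simple_graph_clique_sum order_le_2_clique_sum by blast
  qed
  then show ?thesis ..
qed

section \<open>Extremal matrices from rigid frames\<close>

text \<open>
  Write \<open>X\<close> for the Gram matrix of the vectors \<open>a i\<close>. A summand of \<open>X\<close> in the cone vanishes on the
  kernel of \<open>X\<close>; as the vectors span, it has the form \<open>cnj (a i) U (a j)\<close> for a Hermitian \<open>U\<close>, and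
  rigidity turns \<open>U\<close> into a scalar.
\<close>

lemma rigid_frame_extremal:
  fixes G :: "'n::finite ugraph" and a :: "'n \<Rightarrow> nat \<Rightarrow> complex"
  assumes k: "0 < k"
    and outside: "\<And>i l. i \<notin> verts G \<Longrightarrow> l < k \<Longrightarrow> a i l = 0"
    and orth: "\<And>i j. i \<in> verts G \<Longrightarrow> j \<in> verts G \<Longrightarrow> i \<noteq> j \<Longrightarrow> {i, j} \<notin> edges G \<Longrightarrow>
      (\<Sum>l<k. cnj (a i l) * a j l) = 0"
    and spans: "\<And>p. p < k \<Longrightarrow> \<exists>b :: 'n \<Rightarrow> complex. \<forall>q<k. (\<Sum>v\<in>UNIV. b v * a v q) = (if q = p then 1 else 0)"
    and rigid: "\<And>U. (\<And>p q. p < k \<Longrightarrow> q < k \<Longrightarrow> cnj (U p q) = U q p) \<Longrightarrow>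
      (\<And>i j. i \<in> verts G \<Longrightarrow> j \<in> verts G \<Longrightarrow> i \<noteq> j \<Longrightarrow> {i, j} \<notin> edges G \<Longrightarrow>
        (\<Sum>p<k. \<Sum>q<k. cnj (a i p) * U p q * a j q) = 0) \<Longrightarrow>
      \<exists>c. \<forall>p<k. \<forall>q<k. U p q = (if p = q then c else 0)"
  shows "\<exists>X. extremal G X \<and> k \<le> rank X"
proof -
  define X :: "complex^'n^'n" where "X = (\<chi> i j. \<Sum>l<k. cnj (a i l) * a j l)"
  have "hermitian_psd (\<chi> i j. \<Sum>l\<in>{..<k}. cnj ((\<chi> i. a i l) $ i) * (\<chi> i. a i l) $ j)"
    by (rule psd_sum_outer) simp
  then have Xpsd: "hermitian_psd X" by (simp add: X_def)
  have X0: "X $ i $ j = 0" if "i \<notin> verts G \<or> j \<notin> verts G \<or> (i \<noteq> j \<and> {i, j} \<notin> edges G)" for i j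
  proof (cases "i \<notin> verts G \<or> j \<notin> verts G")
    case True
    then show ?thesis using outside[of i] outside[of j] by (auto simp: X_def)
  next
    case False
    then show ?thesis using that orth[of i j] by (simp add: X_def)
  qed
  have "hermitian X" using Xpsd by (simp add: hermitian_psd_def)
  then have XG: "X \<in> psd_cone G" unfolding psd_cone_iff hermitian_space_iff using Xpsd X0 by blast
  obtain b :: "nat \<Rightarrow> 'n \<Rightarrow> complex" where b: "\<And>p q. p < k \<Longrightarrow> q < k \<Longrightarrow> (\<Sum>v\<in>UNIV. b p v * a v q) = (if q = p then 1 else 0)"
    using spans by metis
  define f where "f p = (\<chi> v. a v p)" for p :: nat
  have row_comb: "f p = (\<Sum>u\<in>UNIV. cnj (b p u) *s row u X)" if "p < k" for p
  proof -
    have "(\<Sum>u\<in>UNIV. cnj (b p u) * X $ u $ v) = a v p" for v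
    proof -
      have "(\<Sum>u\<in>UNIV. cnj (b p u) * X $ u $ v) = (\<Sum>l<k. \<Sum>u\<in>UNIV. cnj (b p u * a u l) * a v l)"
        by (subst sum.swap) (simp add: X_def sum_distrib_left mult.assoc)
      also have "\<dots> = (\<Sum>l<k. cnj (\<Sum>u\<in>UNIV. b p u * a u l) * a v l)"
        unfolding cnj_sum sum_distrib_right ..
      also have "\<dots> = (\<Sum>l<k. if l = p then a v l else 0)"
        by (intro sum.cong refl) (simp add: b[OF that])
      also have "\<dots> = a v p" using that by simp
      finally show ?thesis .
    qed
    then show ?thesis by (simp add: vec_eq_iff f_def row_def)
  qed
  have span: "f p \<in> vec.span (rows X)" if "p < k" for p
    unfolding row_comb[OF that]
    by (intro vec.span_sum vec.span_scale vec.span_base) (auto simp: rows_def)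
  have b_comb: "(\<Sum>v\<in>UNIV. b q v * (\<Sum>p<k. c p *s f p) $ v) = c q" if "q < k" for c q
  proof -
    have "(\<Sum>v\<in>UNIV. b q v * (\<Sum>p<k. c p *s f p) $ v) = (\<Sum>p<k. c p * (\<Sum>v\<in>UNIV. b q v * a v p))"
      unfolding sum_distrib_left
      by (subst sum.swap) (simp add: f_def sum_distrib_left mult_ac)
    also have "\<dots> = (\<Sum>p<k. if p = q then c p else 0)" by (intro sum.cong refl) (simp add: b[OF that])
    also have "\<dots> = c q" using that by simp
    finally show ?thesis .
  qed
  have inj: "inj_on f {..<k}"
  proof (rule inj_onI)
    fix p q assume pq: "p \<in> {..<k}" "q \<in> {..<k}" "f p = f q"
    have "a v p = a v q" for v using pq(3) by (simp add: f_def vec_eq_iff)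
    then have "(\<Sum>v\<in>UNIV. b q v * a v p) = (\<Sum>v\<in>UNIV. b q v * a v q)" by simp
    then show "p = q" using b pq(1,2) by (simp split: if_splits)
  qed
  have "vec.independent (f ` {..<k})"
  proof (rule vec.independent_if_scalars_zero)
    fix c x assume c: "(\<Sum>x\<in>f ` {..<k}. c x *s x) = 0" and x: "x \<in> f ` {..<k}"
    then obtain q where q: "q < k" "x = f q" by auto
    have "(\<Sum>p<k. c (f p) *s f p) = 0" using c by (simp add: sum.reindex[OF inj])
    then show "c x = 0" using b_comb[OF q(1), of "\<lambda>p. c (f p)"] q by simp
  qed simp
  then have "card (f ` {..<k}) \<le> vec.dim (vec.span (rows X))"
    by (rule vec.independent_card_le_dim[rotated]) (use span in auto)
  then have rank: "k \<le> rank X" by (simp add: row_rank_def_gen card_image[OF inj])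
  have key: "\<exists>c>0. X' = c *\<^sub>R X" if X': "X' \<in> psd_cone G" "X' \<noteq> 0" and X'': "X'' \<in> psd_cone G"
    and sum: "X = X' + X''" for X' X''
  proof -
    have psd: "hermitian_psd X'" "hermitian_psd X''" using X' X'' unfolding psd_cone_iff by blast+
    have H: "hermitian X'" using psd by (simp add: hermitian_psd_def)
    have kernel: "X' *v w = 0" if w: "\<And>p. p < k \<Longrightarrow> (\<Sum>v\<in>UNIV. a v p * w $ v) = 0" for w
    proof (rule psd_null_vector[OF psd(1)])
      have "(X *v w) $ i = 0" for i
      proof -
        have "(X *v w) $ i = (\<Sum>l<k. cnj (a i l) * (\<Sum>v\<in>UNIV. a v l * w $ v))"
          unfolding sum_distrib_left by (subst sum.swap)
            (simp add: X_def matrix_vector_mult_def sum_distrib_left sum_distrib_right mult_ac)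
        then show ?thesis using w by simp
      qed
      then have "X *v w = 0" by (simp add: vec_eq_iff)
      then have "Re (cinner w (X' *v w)) + Re (cinner w (X'' *v w)) = 0"
        by (simp add: sum matrix_vector_mult_add_rdistrib flip: cinner_add_right plus_complex.sel(1))
      then show "Re (cinner w (X' *v w)) = 0"
        using hermitian_psd_ge_0[OF psd(1), of w] hermitian_psd_ge_0[OF psd(2), of w] by simp
    qed
    define B where "B p = (\<chi> v. b p v)" for p
    define U where "U p q = cinner (B p) (X' *v B q)" for p q
    have U_herm: "cnj (U p q) = U q p" for p q
      unfolding U_def hermitian_cinner[OF H, of "B q"] by (rule cinner_commute[symmetric])
    have column: "cinner y (X' *v axis v 1) = (\<Sum>p<k. a v p * cinner y (X' *v B p))" for y v
    proof -
      \<comment> \<open>Up to the kernel of \<open>X\<close>, a basis vector is a combination of the dual vectors \<open>B\<close>.\<close>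
      define w where "w = axis v 1 - (\<Sum>p<k. a v p *s B p)"
      have "X' *v w = 0"
      proof (rule kernel)
        fix q assume q: "q < k"
        have "(\<Sum>u\<in>UNIV. a u q * w $ u) =
            (\<Sum>u\<in>UNIV. a u q * axis v 1 $ u) - (\<Sum>p<k. a v p * (\<Sum>u\<in>UNIV. b p u * a u q))"
          unfolding sum_distrib_left
          unfolding sum.swap[of _ UNIV "{..<k}"]
          by (simp add: w_def B_def right_diff_distrib sum_subtractf sum_distrib_left mult_ac)
        also have "(\<Sum>p<k. a v p * (\<Sum>u\<in>UNIV. b p u * a u q)) = (\<Sum>p<k. if p = q then a v p else 0)"
          by (intro sum.cong refl) (use b q in simp)
        also have "(\<Sum>u\<in>UNIV. a u q * axis v 1 $ u) = (\<Sum>u\<in>UNIV. if u = v then a u q else 0)"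
          by (intro sum.cong refl) (simp add: axis_def)
        finally show "(\<Sum>u\<in>UNIV. a u q * w $ u) = 0" using q by simp
      qed
      then have "X' *v axis v 1 = X' *v (\<Sum>p<k. a v p *s B p)"
        by (simp add: w_def matrix_vector_mult_diff_distrib)
      also have "\<dots> = (\<Sum>p<k. a v p *s (X' *v B p))"
        by (induction k) (simp_all add: matrix_vector_right_distrib vector_scalar_commute)
      finally show ?thesis by (simp add: cinner_sum_right cinner_scale_right)
    qed
    have X'_eq: "X' $ i $ j = (\<Sum>p<k. \<Sum>q<k. cnj (a i p) * U p q * a j q)" for i j
    proof -
      have "X' $ i $ j = (\<Sum>q<k. a j q * cinner (axis i 1) (X' *v B q))"
        using column[of "axis i 1" j] by (simp add: cinner_axis_left axis_mult)
      also have "\<dots> = (\<Sum>q<k. a j q * (\<Sum>p<k. cnj (a i p) * U p q))"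
      proof (intro sum.cong refl)
        fix q
        have "cinner (axis i 1) (X' *v B q) = cnj (cinner (B q) (X' *v axis i 1))"
          unfolding hermitian_cinner[OF H, of "B q"] by (rule cinner_commute)
        also have "\<dots> = (\<Sum>p<k. cnj (a i p) * U p q)"
          unfolding column cnj_sum by (intro sum.cong refl) (simp add: U_herm flip: U_def)
        finally show "a j q * cinner (axis i 1) (X' *v B q) = a j q * (\<Sum>p<k. cnj (a i p) * U p q)" by simp
      qed
      also have "\<dots> = (\<Sum>p<k. \<Sum>q<k. cnj (a i p) * U p q * a j q)"
        by (subst sum.swap) (simp add: sum_distrib_left mult_ac)
      finally show ?thesis .
    qed
    have "\<exists>c. \<forall>p<k. \<forall>q<k. U p q = (if p = q then c else 0)"
    proof (rule rigid)
      show "cnj (U p q) = U q p" for p q by (rule U_herm)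
      fix i j assume "i \<in> verts G" "j \<in> verts G" "i \<noteq> j" "{i, j} \<notin> edges G"
      then have "X' $ i $ j = 0" using X'(1) unfolding psd_cone_iff hermitian_space_iff by blast
      then show "(\<Sum>p<k. \<Sum>q<k. cnj (a i p) * U p q * a j q) = 0" by (simp add: X'_eq)
    qed
    then obtain c where c: "\<And>p q. p < k \<Longrightarrow> q < k \<Longrightarrow> U p q = (if p = q then c else 0)" by blast
    have "c = cnj c" using c[OF k k] U_herm[of 0 0] by simp
    then have c_real: "c = of_real (Re c)" by (simp add: complex_eq_iff)
    have "Re c \<ge> 0" using c[OF k k] hermitian_psd_ge_0[OF psd(1), of "B 0"] by (simp add: U_def)
    have eq: "X' = Re c *\<^sub>R X"
    proof -
      have "X' $ i $ j = c * X $ i $ j" for i j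
      proof -
        have "X' $ i $ j = (\<Sum>p<k. \<Sum>q<k. if p = q then c * (cnj (a i p) * a j q) else 0)"
          unfolding X'_eq by (intro sum.cong refl) (simp add: c)
        also have "\<dots> = c * X $ i $ j" by (simp add: X_def sum_distrib_left)
        finally show ?thesis .
      qed
      then show ?thesis using c_real by (simp add: vec_eq_iff scaleR_conv_of_real[where 'a = complex])
    qed
    then have "Re c \<noteq> 0" using X'(2) by auto
    then show ?thesis using eq \<open>Re c \<ge> 0\<close> by (intro exI[of _ "Re c"]) simp
  qed
  have "X \<noteq> 0"
  proof
    assume "X = 0"
    then have "f 0 = 0" using row_comb[OF k] by (simp add: row_def zero_vec_def[symmetric])
    then show False using b[OF k k] by (simp add: f_def vec_eq_iff)
  qed
  then have "extremal G X"
    unfolding extremal_def using XG key by (metis add.commute)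
  then show ?thesis using rank by blast
qed

text \<open>
  The frame of the pattern is transported to its copy, and the vertices outside of it receive
  the zero vector, which adds no constraints.
\<close>

lemma extremal_if_contains_induced:
  fixes G :: "'n::finite ugraph" and H :: "'b ugraph" and A :: "'b \<Rightarrow> nat \<Rightarrow> complex"
  assumes H: "contains_induced G H" and k: "0 < k"
    and orth: "\<And>u v. u \<in> verts H \<Longrightarrow> v \<in> verts H \<Longrightarrow> u \<noteq> v \<Longrightarrow> {u, v} \<notin> edges H \<Longrightarrow>
      (\<Sum>l<k. cnj (A u l) * A v l) = 0"
    and spans: "\<And>p. p < k \<Longrightarrow> \<exists>b. \<forall>q<k. (\<Sum>v\<in>verts H. b v * A v q) = (if q = p then 1 else 0)"
    and rigid: "\<And>U. (\<And>p q. p < k \<Longrightarrow> q < k \<Longrightarrow> cnj (U p q) = U q p) \<Longrightarrow>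
      (\<And>u v. u \<in> verts H \<Longrightarrow> v \<in> verts H \<Longrightarrow> u \<noteq> v \<Longrightarrow> {u, v} \<notin> edges H \<Longrightarrow>
        (\<Sum>p<k. \<Sum>q<k. cnj (A u p) * U p q * A v q) = 0) \<Longrightarrow>
      \<exists>c. \<forall>p<k. \<forall>q<k. U p q = (if p = q then c else 0)"
  shows "\<exists>X. extremal G X \<and> k \<le> rank X"
proof -
  obtain f where f: "inj_on f (verts H)" "f ` verts H \<subseteq> verts G"
    "\<And>u v. u \<in> verts H \<Longrightarrow> v \<in> verts H \<Longrightarrow> {u, v} \<in> edges H \<longleftrightarrow> {f u, f v} \<in> edges G"
    using H unfolding contains_induced_iff by blast
  define g where "g = the_inv_into (verts H) f"
  have gf: "g (f u) = u" if "u \<in> verts H" for u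
    unfolding g_def by (rule the_inv_into_f_f[OF f(1) that])
  define a where "a i l = (if i \<in> f ` verts H then A (g i) l else 0)" for i l
  have af: "a (f u) l = A u l" if "u \<in> verts H" for u l using that gf by (simp add: a_def)
  have out: "a i l = 0" if "i \<notin> f ` verts H" for i l using that by (simp add: a_def)
  show ?thesis
  proof (rule rigid_frame_extremal[OF k])
    show "a i l = 0" if "i \<notin> verts G" for i l using that f(2) out by blast
    show "(\<Sum>l<k. cnj (a i l) * a j l) = 0" if "i \<noteq> j" "{i, j} \<notin> edges G" for i j
    proof (cases "i \<in> f ` verts H \<and> j \<in> f ` verts H")
      case True
      then obtain u v where "i = f u" "j = f v" "u \<in> verts H" "v \<in> verts H" by blast
      then show ?thesis using orth[of u v] f(3)[of u v] that by (auto simp: af)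
    qed (auto simp: out)
    show "\<exists>b. \<forall>q<k. (\<Sum>v\<in>UNIV. b v * a v q) = (if q = p then 1 else 0)" if p: "p < k" for p
    proof -
      obtain b where b: "\<And>q. q < k \<Longrightarrow> (\<Sum>v\<in>verts H. b v * A v q) = (if q = p then 1 else 0)"
        using spans[OF p] by blast
      have "(\<Sum>v\<in>UNIV. b (g v) * a v q) = (\<Sum>v\<in>verts H. b v * A v q)" for q
      proof -
        have "(\<Sum>v\<in>UNIV. b (g v) * a v q) = (\<Sum>v\<in>f ` verts H. b (g v) * a v q)"
          by (rule sum.mono_neutral_right) (auto simp: out)
        also have "\<dots> = (\<Sum>v\<in>verts H. b v * A v q)"
          by (subst sum.reindex[OF f(1)]) (simp add: gf af)
        finally show ?thesis .
      qed
      then show ?thesis using b by (intro exI[of _ "\<lambda>v. b (g v)"]) simp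
    qed
    fix U :: "nat \<Rightarrow> nat \<Rightarrow> complex"
    assume herm: "\<And>p q. p < k \<Longrightarrow> q < k \<Longrightarrow> cnj (U p q) = U q p"
      and zero: "\<And>i j. i \<in> verts G \<Longrightarrow> j \<in> verts G \<Longrightarrow> i \<noteq> j \<Longrightarrow> {i, j} \<notin> edges G \<Longrightarrow>
        (\<Sum>p<k. \<Sum>q<k. cnj (a i p) * U p q * a j q) = 0"
    show "\<exists>c. \<forall>p<k. \<forall>q<k. U p q = (if p = q then c else 0)"
    proof (rule rigid[OF herm])
      fix u v assume uv: "u \<in> verts H" "v \<in> verts H" "u \<noteq> v" "{u, v} \<notin> edges H"
      have "f u \<noteq> f v" using uv f(1) by (auto simp: inj_on_def)
      then show "(\<Sum>p<k. \<Sum>q<k. cnj (A u p) * U p q * A v q) = 0"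
        using zero[of "f u" "f v"] uv f by (auto simp: af)
    qed
  qed
qed

lemma extremal_if_contains_complement:
  fixes G :: "'n::finite ugraph" and F :: "'b ugraph" and A :: "'b \<Rightarrow> nat \<Rightarrow> complex"
  assumes F: "contains_induced G (complement F)"
    and orth: "\<And>u v. u \<in> verts F \<Longrightarrow> v \<in> verts F \<Longrightarrow> u \<noteq> v \<Longrightarrow> {u, v} \<in> edges F \<Longrightarrow>
      (\<Sum>l<3. cnj (A u l) * A v l) = 0"
    and spans: "\<And>p. p < 3 \<Longrightarrow> \<exists>b. \<forall>q<3. (\<Sum>v\<in>verts F. b v * A v q) = (if q = p then 1 else 0)"
    and rigid: "\<And>U. (\<And>p q. p < 3 \<Longrightarrow> q < 3 \<Longrightarrow> U p q = cnj (U q p)) \<Longrightarrow>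
      (\<And>u v. u \<in> verts F \<Longrightarrow> v \<in> verts F \<Longrightarrow> u \<noteq> v \<Longrightarrow> {u, v} \<in> edges F \<Longrightarrow>
        (\<Sum>p<3. \<Sum>q<3. cnj (A u p) * U p q * A v q) = 0) \<Longrightarrow>
      U 0 1 = 0 \<and> U 0 2 = 0 \<and> U 1 2 = 0 \<and> U 1 1 = U 0 0 \<and> U 2 2 = U 0 0"
  shows "\<exists>X. extremal G X \<and> 3 \<le> rank X"
proof -
  have ne: "{u, v} \<notin> edges (complement F) \<longleftrightarrow> {u, v} \<in> edges F" "verts (complement F) = verts F"
    if "u \<in> verts F" "v \<in> verts F" "u \<noteq> v" for u v
    using that by (auto simp: complement_def doubleton_eq_iff insert_commute)
  have V: "verts (complement F) = verts F" by (simp add: complement_def)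
  show ?thesis
  proof (rule extremal_if_contains_induced[OF F, of 3 A, unfolded V])
    show "(\<Sum>l<3. cnj (A u l) * A v l) = 0"
      if "u \<in> verts F" "v \<in> verts F" "u \<noteq> v" "{u, v} \<notin> edges (complement F)" for u v
      using that orth ne by blast
    fix U :: "nat \<Rightarrow> nat \<Rightarrow> complex"
    assume herm: "\<And>p q. p < 3 \<Longrightarrow> q < 3 \<Longrightarrow> cnj (U p q) = U q p"
      and zero: "\<And>u v. u \<in> verts F \<Longrightarrow> v \<in> verts F \<Longrightarrow> u \<noteq> v \<Longrightarrow> {u, v} \<notin> edges (complement F) \<Longrightarrow>
        (\<Sum>p<3. \<Sum>q<3. cnj (A u p) * U p q * A v q) = 0"
    have "U 0 1 = 0 \<and> U 0 2 = 0 \<and> U 1 2 = 0 \<and> U 1 1 = U 0 0 \<and> U 2 2 = U 0 0"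
    proof (rule rigid)
      show "U p q = cnj (U q p)" if "p < 3" "q < 3" for p q using herm[OF that(2,1)] by simp
    qed (use zero ne in blast)
    moreover from this have "U 1 0 = 0" "U 2 0 = 0" "U 2 1 = 0"
      using herm[of 0 1] herm[of 0 2] herm[of 1 2] by simp_all
    ultimately show "\<exists>c. \<forall>p<3. \<forall>q<3. U p q = (if p = q then c else 0)"
      by (intro exI[of _ "U 0 0"]) (auto simp: numeral_3_eq_3 numeral_2_eq_2 less_Suc_eq)
  qed (use spans in auto)
qed

section \<open>Extremal matrices of rank three and more for the forbidden patterns\<close>

lemma sum_3: "(\<Sum>l<(3::nat). f l) = f 0 + f 1 + (f 2 :: complex)"
  by (simp add: eval_nat_numeral)

lemma less_3_cases: "(k::nat) < 3 \<longleftrightarrow> k = 0 \<or> k = 1 \<or> k = 2"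
  by auto

lemma ball_3: "(\<forall>q<3::nat. Q q) \<longleftrightarrow> Q 0 \<and> Q 1 \<and> Q 2"
  by (auto simp: numeral_3_eq_3 numeral_2_eq_2 less_Suc_eq)

text \<open>
  The vectors of this and the following patterns were chosen small and with unit vectors among
  them. The edges at a unit vector involve only off-diagonal entries of \<open>U\<close>, and the other ones compare
  these with the diagonal entries.
\<close>

lemma extremal_D1:
  fixes G :: "'n::finite ugraph"
  assumes "contains_induced G D1"
  shows "\<exists>X. extremal G X \<and> 3 \<le> rank X"
proof (rule extremal_if_contains_complement[OF assms[unfolded D1_def],
      of "(\<lambda>i l. [[1, 0, 0], [0, 1, 0], [1, 0, 1], [- 1, - 1, 1], [1, - 1, 0], [0, 0, 1]] ! i ! l)"],
    goal_cases)
  case (1 u v)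
  then show ?case by (auto simp: pattern_simps sum_3)
next
  case (2 p)
  have V: "(\<Sum>v\<in>verts (path_graph 6). b v) =
      b 0 + b 1 + b 2 + b 3 + b 4 + b 5" for b :: "_ \<Rightarrow> complex"
    by (simp add: pattern_simps add.assoc)
  show ?case
    unfolding V ball_3
    by (rule exI[of _ "(\<lambda>i. [[1, 0, 0, 0, 0, 0], [0, 1, 0, 0, 0, 0], [0, 0, 0, 0, 0, 1]] ! p ! i)"])
      (use 2 in \<open>auto simp: less_3_cases\<close>)
next
  case (3 U)
  show ?case
    using 3(2)[of "0" "1"] 3(2)[of "1" "2"] 3(2)[of "2" "3"] 3(2)[of "3" "4"] 3(2)[of "4" "5"]
      3(1)[of 1 0] 3(1)[of 2 0] 3(1)[of 2 1] 3(1)[of 0 0] 3(1)[of 1 1] 3(1)[of 2 2]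
    by (simp add: pattern_simps sum_3 complex_eq_iff)
qed

lemma extremal_D2:
  fixes G :: "'n::finite ugraph"
  assumes "contains_induced G D2"
  shows "\<exists>X. extremal G X \<and> 3 \<le> rank X"
proof (rule extremal_if_contains_complement[OF assms[unfolded D2_def],
      of "(\<lambda>i l. [[1, 0, 0], [0, 1, 0], [1, 0, - 1], [- 1, 1, - 1], [- 1, - 1, 0], [0, 0, 1]] ! i ! l)"],
    goal_cases)
  case (1 u v)
  then show ?case by (auto simp: pattern_simps sum_3)
next
  case (2 p)
  have V: "(\<Sum>v\<in>verts (cycle_graph 6). b v) =
      b 0 + b 1 + b 2 + b 3 + b 4 + b 5" for b :: "_ \<Rightarrow> complex"
    by (simp add: pattern_simps add.assoc)
  show ?case
    unfolding V ball_3
    by (rule exI[of _ "(\<lambda>i. [[1, 0, 0, 0, 0, 0], [0, 1, 0, 0, 0, 0], [0, 0, 0, 0, 0, 1]] ! p ! i)"])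
      (use 2 in \<open>auto simp: less_3_cases\<close>)
next
  case (3 U)
  show ?case
    using 3(2)[of "0" "1"] 3(2)[of "1" "2"] 3(2)[of "2" "3"] 3(2)[of "3" "4"] 3(2)[of "4" "5"] 3(2)[of "5" "0"]
      3(1)[of 1 0] 3(1)[of 2 0] 3(1)[of 2 1] 3(1)[of 0 0] 3(1)[of 1 1] 3(1)[of 2 2]
    by (simp add: pattern_simps sum_3 complex_eq_iff)
qed

lemma extremal_D3:
  fixes G :: "'n::finite ugraph"
  assumes "contains_induced G D3"
  shows "\<exists>X. extremal G X \<and> 3 \<le> rank X"
proof (rule extremal_if_contains_complement[OF assms[unfolded D3_def],
      of "case_sum (\<lambda>i l. [[1, 0, 0], [0, 1, 0], [1, 0, 1], [- 1, 0, 1]] ! i ! l) (\<lambda>i l. [[- 1, 1, \<i>], [- 1, - 1, 0]] ! i ! l)"],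
    goal_cases)
  case (1 u v)
  then show ?case by (auto simp: pattern_simps sum_3)
next
  case (2 p)
  have V: "(\<Sum>v\<in>verts (path_graph 4 \<squnion>\<^sub>g complete_graph 2). b v) =
      b (Inl 0) + b (Inl 1) + b (Inl 2) + b (Inl 3) + b (Inr 0) + b (Inr 1)" for b :: "_ \<Rightarrow> complex"
    by (simp add: pattern_simps add.assoc)
  show ?case
    unfolding V ball_3
    by (rule exI[of _ "case_sum (\<lambda>i. [[1, 0, 0, 0], [0, 1, 0, 0], [- 1, 0, 1, 0]] ! p ! i) (\<lambda>i. [[0, 0], [0, 0], [0, 0]] ! p ! i)"])
      (use 2 in \<open>auto simp: less_3_cases\<close>)
next
  case (3 U)
  show ?case
    using 3(2)[of "Inl 0" "Inl 1"] 3(2)[of "Inl 1" "Inl 2"] 3(2)[of "Inl 2" "Inl 3"] 3(2)[of "Inr 0" "Inr 1"]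
      3(1)[of 1 0] 3(1)[of 2 0] 3(1)[of 2 1] 3(1)[of 0 0] 3(1)[of 1 1] 3(1)[of 2 2]
    by (simp add: pattern_simps sum_3 complex_eq_iff)
qed

text \<open>
  The three unit vectors make \<open>U\<close> diagonal. A single complex equation with coefficients
  \<open>1, \<i>, - 1 - \<i>\<close> then gives two real ones, which equate the three diagonal entries. Real
  vectors would not suffice.
\<close>

lemma extremal_D4:
  fixes G :: "'n::finite ugraph"
  assumes "contains_induced G D4"
  shows "\<exists>X. extremal G X \<and> 3 \<le> rank X"
proof (rule extremal_if_contains_complement[OF assms[unfolded D4_def],
      of "case_sum (\<lambda>i l. [[1, 0, 0], [0, 1, 0], [0, 0, 1]] ! i ! l) (\<lambda>i l. [[1, 1, 1], [1, \<i>, - 1 - \<i>]] ! i ! l)"],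
    goal_cases)
  case (1 u v)
  then show ?case by (auto simp: pattern_simps sum_3)
next
  case (2 p)
  have V: "(\<Sum>v\<in>verts (complete_graph 3 \<squnion>\<^sub>g complete_graph 2). b v) =
      b (Inl 0) + b (Inl 1) + b (Inl 2) + b (Inr 0) + b (Inr 1)" for b :: "_ \<Rightarrow> complex"
    by (simp add: pattern_simps add.assoc)
  show ?case
    unfolding V ball_3
    by (rule exI[of _ "case_sum (\<lambda>i. [[1, 0, 0], [0, 1, 0], [0, 0, 1]] ! p ! i) (\<lambda>i. [[0, 0], [0, 0], [0, 0]] ! p ! i)"])
      (use 2 in \<open>auto simp: less_3_cases\<close>)
next
  case (3 U)
  show ?case
    using 3(2)[of "Inl 0" "Inl 1"] 3(2)[of "Inl 0" "Inl 2"] 3(2)[of "Inl 1" "Inl 2"] 3(2)[of "Inr 0" "Inr 1"]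
      3(1)[of 1 0] 3(1)[of 2 0] 3(1)[of 2 1] 3(1)[of 0 0] 3(1)[of 1 1] 3(1)[of 2 2]
    by (simp add: pattern_simps sum_3 complex_eq_iff)
qed

lemma extremal_D5:
  fixes G :: "'n::finite ugraph"
  assumes "contains_induced G D5"
  shows "\<exists>X. extremal G X \<and> 3 \<le> rank X"
proof (rule extremal_if_contains_complement[OF assms[unfolded D5_def],
      of "case_sum (\<lambda>i l. [[1, 0, 0], [0, 1, 0], [0, 0, 1]] ! i ! l) (case_sum (\<lambda>i l. [[- 1, - 1, 1], [0, 1, 1]] ! i ! l) (\<lambda>i l. [[- 1, 0, \<i>], [\<i>, 0, - 1]] ! i ! l))"],
    goal_cases)
  case (1 u v)
  then show ?case by (auto simp: pattern_simps sum_3)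
next
  case (2 p)
  have V: "(\<Sum>v\<in>verts (path_graph 3 \<squnion>\<^sub>g complete_graph 2 \<squnion>\<^sub>g complete_graph 2). b v) =
      b (Inl 0) + b (Inl 1) + b (Inl 2) + b (Inr (Inl 0)) + b (Inr (Inl 1)) + b (Inr (Inr 0)) + b (Inr (Inr 1))" for b :: "_ \<Rightarrow> complex"
    by (simp add: pattern_simps add.assoc)
  show ?case
    unfolding V ball_3
    by (rule exI[of _ "case_sum (\<lambda>i. [[1, 0, 0], [0, 1, 0], [0, 0, 1]] ! p ! i) (case_sum (\<lambda>i. [[0, 0], [0, 0], [0, 0]] ! p ! i) (\<lambda>i. [[0, 0], [0, 0], [0, 0]] ! p ! i))"])
      (use 2 in \<open>auto simp: less_3_cases\<close>)
next
  case (3 U)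
  show ?case
    using 3(2)[of "Inl 0" "Inl 1"] 3(2)[of "Inl 1" "Inl 2"] 3(2)[of "(Inr (Inl 0))" "(Inr (Inl 1))"] 3(2)[of "(Inr (Inr 0))" "(Inr (Inr 1))"]
      3(1)[of 1 0] 3(1)[of 2 0] 3(1)[of 2 1] 3(1)[of 0 0] 3(1)[of 1 1] 3(1)[of 2 2]
    by (simp add: pattern_simps sum_3 complex_eq_iff)
qed

lemma extremal_D6:
  fixes G :: "'n::finite ugraph"
  assumes "contains_induced G D6"
  shows "\<exists>X. extremal G X \<and> 3 \<le> rank X"
proof (rule extremal_if_contains_complement[OF assms[unfolded D6_def],
      of "case_sum (\<lambda>i l. [[1, 0, 0], [0, 1, 0]] ! i ! l) (case_sum (\<lambda>i l. [[1, \<i>, - 1], [1, 0, 1]] ! i ! l) (case_sum (\<lambda>i l. [[0, 1, 1], [0, 1, - 1]] ! i ! l) (\<lambda>i l. [[1, 0, 0], [0, 0, 1]] ! i ! l)))"],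
    goal_cases)
  case (1 u v)
  then show ?case by (auto simp: pattern_simps sum_3)
next
  case (2 p)
  have V: "(\<Sum>v\<in>verts (complete_graph 2 \<squnion>\<^sub>g complete_graph 2 \<squnion>\<^sub>g complete_graph 2 \<squnion>\<^sub>g complete_graph 2). b v) =
      b (Inl 0) + b (Inl 1) + b (Inr (Inl 0)) + b (Inr (Inl 1)) + b (Inr (Inr (Inl 0))) + b (Inr (Inr (Inl 1))) + b (Inr (Inr (Inr 0))) + b (Inr (Inr (Inr 1)))" for b :: "_ \<Rightarrow> complex"
    by (simp add: pattern_simps add.assoc)
  show ?case
    unfolding V ball_3
    by (rule exI[of _ "case_sum (\<lambda>i. [[1, 0], [0, 1], [0, 0]] ! p ! i) (case_sum (\<lambda>i. [[0, 0], [0, 0], [0, 0]] ! p ! i) (case_sum (\<lambda>i. [[0, 0], [0, 0], [0, 0]] ! p ! i) (\<lambda>i. [[0, 0], [0, 0], [0, 1]] ! p ! i)))"])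
      (use 2 in \<open>auto simp: less_3_cases\<close>)
next
  case (3 U)
  show ?case
    using 3(2)[of "Inl 0" "Inl 1"] 3(2)[of "(Inr (Inl 0))" "(Inr (Inl 1))"] 3(2)[of "(Inr (Inr (Inl 0)))" "(Inr (Inr (Inl 1)))"] 3(2)[of "(Inr (Inr (Inr 0)))" "(Inr (Inr (Inr 1)))"]
      3(1)[of 1 0] 3(1)[of 2 0] 3(1)[of 2 1] 3(1)[of 0 0] 3(1)[of 1 1] 3(1)[of 2 2]
    by (simp add: pattern_simps sum_3 complex_eq_iff)
qed

lemma cycle_edge_iff_ordered:
  assumes "i < j" "j < Suc (Suc k)"
  shows "{i, j} \<in> edges (cycle_graph (Suc (Suc k))) \<longleftrightarrow> j = Suc i \<or> i = 0 \<and> j = Suc k"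
  using assms unfolding cycle_edge_iff by (auto simp: mod_Suc)

text \<open>
  The pairing with \<open>e\<^sub>i\<^sub>-\<^sub>1 + e\<^sub>i\<close> in dimension \<open>k\<close>, where a basis vector with an index outside the
  range is dropped; this covers the two ends of the path.
\<close>

lemma sum_two_consecutive:
  fixes g :: "nat \<Rightarrow> complex"
  shows "(\<Sum>l<k. (if l = i \<or> Suc l = i then 1 else 0) * g l) =
    (if i < k then g i else 0) + (if 0 < i \<and> i \<le> k then g (i - 1) else 0)"
proof -
  have "(\<Sum>l<k. (if l = i \<or> Suc l = i then 1 else 0) * g l) =
      (\<Sum>l<k. (if l = i then g l else 0) + (if 0 < i \<and> l = i - 1 then g l else 0))"
    by (intro sum.cong refl) auto
  then show ?thesis by (auto simp: sum.distrib)
qed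

text \<open>
  In dimension \<open>k = n - 2\<close> the vertices carry \<open>e\<^sub>0, e\<^sub>0 + e\<^sub>1, \<dots>, e\<^sub>k\<^sub>-\<^sub>2 + e\<^sub>k\<^sub>-\<^sub>1, e\<^sub>k\<^sub>-\<^sub>1\<close>, and the last
  one carries the alternating vector. The constraints along the path make \<open>U\<close> diagonal, row by row and
  from right to left; those of the last vertex equate neighbouring diagonal entries.
\<close>

lemma extremal_cycle:
  fixes G :: "'n::finite ugraph"
  assumes C: "contains_induced G (cycle_graph n)" and n: "n \<ge> 5"
  shows "\<exists>X. extremal G X \<and> 3 \<le> rank X"
proof -
  define k where "k = n - 2"
  have k: "3 \<le> k" and nk: "n = Suc (Suc k)" using n by (auto simp: k_def)
  define A :: "nat \<Rightarrow> nat \<Rightarrow> complex" where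
    "A i l = (if i = Suc k then (- 1) ^ l else if l = i \<or> Suc l = i then 1 else 0)" for i l
  have A: "A i l = (if l = i \<or> Suc l = i then 1 else 0)" if "i \<le> k" for i l
    using that by (simp add: A_def)
  have Acnj: "cnj (A i l) = A i l" for i l by (simp add: A_def)
  have nonadj: "(j \<le> k \<and> Suc i < j) \<or> (j = Suc k \<and> 0 < i \<and> i < k)"
    if "i < j" "j < n" "{i, j} \<notin> edges (cycle_graph n)" for i j
    using that cycle_edge_iff_ordered[of i j k] by (auto simp: nk)
  have sumA: "(\<Sum>l<k. A i l * g l) = (if i < k then g i else 0) + (if 0 < i then g (i - 1) else 0)"
    if "i \<le> k" for i g
    using sum_two_consecutive[of i g k] that by (simp add: A)
  have "\<exists>X. extremal G X \<and> k \<le> rank X"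
  proof (rule extremal_if_contains_induced[OF C])
    show "0 < k" using k by simp
    have orth: "(\<Sum>l<k. A u l * A v l) = 0" if "u < v" "v < n" "{u, v} \<notin> edges (cycle_graph n)" for u v
      using nonadj[OF that]
    proof
      assume "v \<le> k \<and> Suc u < v"
      then show ?thesis by (intro sum.neutral ballI) (auto simp: A)
    next
      assume *: "v = Suc k \<and> 0 < u \<and> u < k"
      then obtain m where "u = Suc m" by (cases u) auto
      then show ?thesis using * by (simp add: sumA) (simp add: A_def)
    qed
    show "(\<Sum>l<k. cnj (A u l) * A v l) = 0"
      if "u \<in> verts (cycle_graph n)" "v \<in> verts (cycle_graph n)" "u \<noteq> v" "{u, v} \<notin> edges (cycle_graph n)" for u v
    proof (cases "u < v")
      case True
      then show ?thesis using orth[of u v] that by (simp add: Acnj pattern_verts)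
    next
      case False
      then have "(\<Sum>l<k. A v l * A u l) = 0"
        using orth[of v u] that by (simp add: pattern_verts insert_commute)
      then show ?thesis by (simp add: Acnj mult.commute)
    qed
    show "\<exists>b. \<forall>q<k. (\<Sum>v\<in>verts (cycle_graph n). b v * A v q) = (if q = p then 1 else 0)" if "p < k" for p
      using that
    proof (induction p)
      case 0
      have "(\<Sum>v<n. (if v = 0 then 1 else 0) * A v q) = A 0 q" for q
        by (subst sum.remove[of _ 0]) (auto simp: nk)
      then show ?case
        by (intro exI[of _ "\<lambda>v. if v = 0 then 1 else 0"]) (simp add: pattern_verts A)
    next
      case (Suc p)
      then obtain b where b: "\<And>q. q < k \<Longrightarrow> (\<Sum>v<n. b v * A v q) = (if q = p then 1 else 0)"
        by (auto simp: pattern_verts)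
      have "(\<Sum>v<n. ((if v = Suc p then 1 else 0) - b v) * A v q) = (if q = Suc p then 1 else 0)" if "q < k" for q
      proof -
        have "(\<Sum>v<n. (if v = Suc p then 1 else 0) * A v q) = (\<Sum>v<n. if v = Suc p then A v q else 0)"
          by (intro sum.cong refl) simp
        also have "\<dots> = A (Suc p) q" using Suc.prems by (simp add: nk)
        finally show ?thesis
          using b[OF that] Suc.prems by (simp add: left_diff_distrib sum_subtractf A)
      qed
      then show ?case
        by (intro exI[of _ "\<lambda>v. (if v = Suc p then 1 else 0) - b v"]) (simp add: pattern_verts)
    qed
    fix U :: "nat \<Rightarrow> nat \<Rightarrow> complex"
    assume herm: "\<And>p q. p < k \<Longrightarrow> q < k \<Longrightarrow> cnj (U p q) = U q p"
      and zero: "\<And>u v. u \<in> verts (cycle_graph n) \<Longrightarrow> v \<in> verts (cycle_graph n) \<Longrightarrow> u \<noteq> v \<Longrightarrow>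
        {u, v} \<notin> edges (cycle_graph n) \<Longrightarrow> (\<Sum>p<k. \<Sum>q<k. cnj (A u p) * U p q * A v q) = 0"
    \<comment> \<open>Padding by zeros absorbs the basis vector \<open>e\<^sub>k\<close> that is missing at the end of the path.\<close>
    define V where "V p q = (if p < k \<and> q < k then U p q else 0)" for p q
    have form: "(\<Sum>p<k. \<Sum>q<k. cnj (A u p) * U p q * A v q) =
        (\<Sum>q<k. A v q * V u q) + (if 0 < u then (\<Sum>q<k. A v q * V (u - 1) q) else 0)" if "u \<le> k" for u v
    proof -
      have "(\<Sum>p<k. \<Sum>q<k. cnj (A u p) * U p q * A v q) = (\<Sum>p<k. A u p * (\<Sum>q<k. A v q * V p q))"
        by (intro sum.cong refl) (simp add: V_def Acnj sum_distrib_left mult_ac)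
      moreover have "(\<Sum>q<k. A v q * V u q) = 0" if "\<not> u < k" using that by (simp add: V_def)
      ultimately show ?thesis using that by (simp add: sumA)
    qed
    have upper: "V p q = 0" if "p < q" for p q
      using that
    proof (induction p arbitrary: q)
      case 0
      show ?case
      proof (cases "q \<le> k")
        case True
        then show ?thesis
        proof (induction rule: inc_induct)
          case base
          show ?case by (simp add: V_def)
        next
          case (step m)
          have "\<not> adj (cycle_graph n) 0 (Suc m)"
            using step 0 cycle_edge_iff_ordered[of 0 "Suc m" k] by (simp add: nk)
          then have "(\<Sum>l<k. A (Suc m) l * V 0 l) = 0"
            using zero[of 0 "Suc m"] form[of 0 "Suc m"] step by (simp add: pattern_verts nk)
          then show ?case using step by (simp add: sumA V_def split: if_splits)
        qed
      qed (simp add: V_def)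
    next
      case (Suc p)
      show ?case
      proof (cases "q \<le> k")
        case True
        then show ?thesis
        proof (induction rule: inc_induct)
          case base
          show ?case by (simp add: V_def)
        next
          case (step m)
          have "\<not> adj (cycle_graph n) (Suc p) (Suc m)"
            using step Suc.prems cycle_edge_iff_ordered[of "Suc p" "Suc m" k] by (simp add: nk)
          then have "(\<Sum>l<k. A (Suc m) l * V (Suc p) l) + (\<Sum>l<k. A (Suc m) l * V p l) = 0"
            using zero[of "Suc p" "Suc m"] form[of "Suc p" "Suc m"] step Suc.prems by (simp add: pattern_verts nk)
          moreover have "V p m = 0" "V p (Suc m) = 0" using Suc.IH[of m] Suc.IH[of "Suc m"] step Suc.prems by auto
          ultimately show ?case using step by (simp add: sumA V_def split: if_splits)
        qed
      qed (simp add: V_def)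
    qed
    have off_diag: "U p q = 0" if "p < k" "q < k" "p \<noteq> q" for p q
    proof (cases "p < q")
      case True
      then show ?thesis using upper[of p q] that by (simp add: V_def)
    next
      case False
      then have "U q p = 0" using upper[of q p] that by (simp add: V_def)
      then show ?thesis using herm[of q p] that by simp
    qed
    have alt: "(\<Sum>q<k. A (Suc k) q * V p q) = (- 1) ^ p * U p p" if "p < k" for p
    proof -
      have "(\<Sum>q<k. A (Suc k) q * V p q) = (\<Sum>q<k. if q = p then (- 1) ^ p * U p p else 0)"
        by (intro sum.cong refl) (use off_diag that in \<open>auto simp: V_def A_def\<close>)
      then show ?thesis using that by simp
    qed
    have diag: "U p p = U 0 0" if "p < k" for p
      using that
    proof (induction p)
      case (Suc p)
      have "\<not> adj (cycle_graph n) (Suc p) (Suc k)"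
        using Suc.prems cycle_edge_iff_ordered[of "Suc p" "Suc k" k] by (simp add: nk)
      then have "(\<Sum>q<k. A (Suc k) q * V (Suc p) q) + (\<Sum>q<k. A (Suc k) q * V p q) = 0"
        using zero[of "Suc p" "Suc k"] form[of "Suc p" "Suc k"] Suc.prems by (simp add: pattern_verts nk)
      then have "(- 1) ^ p * U p p = (- 1) ^ p * U (Suc p) (Suc p)" using alt[of p] alt[of "Suc p"] Suc.prems by simp
      then have "U p p = U (Suc p) (Suc p)" by simp
      then show ?case using Suc by simp
    qed simp
    show "\<exists>c. \<forall>p<k. \<forall>q<k. U p q = (if p = q then c else 0)"
    proof (intro exI[of _ "U 0 0"] allI impI)
      fix p q assume pq: "p < k" "q < k"
      show "U p q = (if p = q then U 0 0 else 0)"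
      proof (cases "p = q")
        case True
        then show ?thesis using diag[OF pq(1)] by simp
      next
        case False
        then show ?thesis using off_diag[OF pq] by simp
      qed
    qed
  qed
  then obtain X where "extremal G X" "k \<le> rank X" by blast
  then show ?thesis using k by (intro exI[of _ X]) simp
qed

section \<open>The equivalence\<close>

text \<open>
  The matrix with a single entry 1 on the diagonal; it shows that the maximum in the definition
  of the order is taken over a non-empty set.
\<close>

lemma extremal_exists:
  fixes G :: "'n::finite ugraph"
  assumes "v \<in> verts G"
  shows "\<exists>X. extremal G X"
proof -
  have one: "(0::nat) < 1" by simp
  have "\<exists>X. extremal G X \<and> 1 \<le> rank X"
  proof (rule rigid_frame_extremal[OF one, of G "\<lambda>i _. if i = v then 1 else 0"])
    have "(\<Sum>u\<in>UNIV. 1 * (if u = v then 1 else 0)) = (1::complex)" by simp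
    then show "\<exists>b. \<forall>q<1. (\<Sum>u\<in>UNIV. b u * (if u = v then 1 else 0)) = (if q = p then 1 else (0::complex))"
      if "p < 1" for p :: nat
      using that by (intro exI[of _ "\<lambda>_. 1"]) simp
    show "\<exists>c. \<forall>p<1. \<forall>q<1. U p q = (if p = q then c else 0)" for U :: "nat \<Rightarrow> nat \<Rightarrow> complex"
      by (intro exI[of _ "U 0 0"]) simp
    show "(if i = v then 1 else 0) = (0 :: complex)" if "i \<notin> verts G" for i
      using that assms by auto
    show "(\<Sum>l<1::nat. cnj (if i = v then 1 else 0) * (if j = v then 1 else 0)) = (0 :: complex)"
      if "i \<noteq> j" for i j
      using that by auto
  qed
  then show ?thesis by blast
qed

lemma finite_extremal_ranks: "finite {rank X |X. extremal G X}"
proof -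
  have "rank X \<le> vec.dim (UNIV :: (complex^'n) set)" for X :: "complex^'n::finite^'n"
    unfolding row_rank_def_gen by (rule vec.dim_subset) simp
  then have "{rank X |X. extremal G X} \<subseteq> {..vec.dim (UNIV :: (complex^'a) set)}" by auto
  then show ?thesis by (rule finite_subset) simp
qed

lemma sparsity_order_le_2_iff:
  assumes "verts G \<noteq> {}"
  shows "sparsity_order G \<le> 2 \<longleftrightarrow> order_le_2 G"
proof -
  obtain X0 where X0: "extremal G X0" using extremal_exists assms by blast
  then have "{rank X |X. extremal G X} \<noteq> {}" by blast
  then show ?thesis
    unfolding sparsity_order_def order_le_2_def
    by (subst Max_le_iff[OF finite_extremal_ranks]) auto
qed

lemma obstruction_free_if_order_le_2:
  assumes "order_le_2 G"
  shows "obstruction_free G"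
proof -
  have no: "\<not> (\<exists>X. extremal G X \<and> 3 \<le> rank X)"
    using assms unfolding order_le_2_def by (metis Suc_n_not_le_n numeral_3_eq_3 numeral_2_eq_2 order_trans)
  show ?thesis
    unfolding obstruction_free_def
    using no extremal_cycle extremal_D1 extremal_D2 extremal_D3 extremal_D4 extremal_D5 extremal_D6 by blast
qed

theorem theorem1p2:
  fixes G :: "'n::finite ugraph"
  assumes "simple_graph G" and "verts G \<noteq> {}"
  shows "(sparsity_order G \<le> 2 \<longleftrightarrow>
            (\<forall>n\<ge>5. \<not> contains_induced G (cycle_graph n)) \<and>
            \<not> contains_induced G D1 \<and> \<not> contains_induced G D2 \<and> \<not> contains_induced G D3 \<and>
            \<not> contains_induced G D4 \<and> \<not> contains_induced G D5 \<and> \<not> contains_induced G D6)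
       \<and> ((\<forall>n\<ge>5. \<not> contains_induced G (cycle_graph n)) \<and>
            \<not> contains_induced G D1 \<and> \<not> contains_induced G D2 \<and> \<not> contains_induced G D3 \<and>
            \<not> contains_induced G D4 \<and> \<not> contains_induced G D5 \<and> \<not> contains_induced G D6
          \<longleftrightarrow> clique_sum_of (\<lambda>H. in_K2 H \<or> in_K3 H) G)"
  unfolding obstruction_free_def[symmetric] sparsity_order_le_2_iff[OF assms(2)]
  using obstruction_free_if_order_le_2 clique_sum_of_if_obstruction_free[OF assms]
    order_le_2_if_clique_sum_of by blast

end
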